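(* Let $p$ be a prime and $G$ a finite group with commutator subgroup $G'$. Let $F$ be a (possibly infinite) field extension of $\mathbb{Q}_p$ and $R\subset F$ an integrally closed noetherian ring with field of fractions $F$. Then for every square matrix $H$ with entries in $R[G]$ one has $|G'|\,\mathrm{nr}(H)\in\zeta(R[G])$.
   Context: $\mathrm{nr}$ denotes the reduced norm of the separable $F$-algebra $F[G]$ (extended to matrix rings over it), with values in $\zeta(F[G])$; $\zeta(\cdot)$ denotes the centre. *)

theory Defs
  imports "HOL-Algebra.Algebraic_Closure_Type" "HOL-Algebra.Solvable_Groups"
    "Jordan_Normal_Form.Determinant"
begin

text \<open>Z_p as the inverse limit of the rings Z/p^n Z: coherent sequences of residues.\<close>
definition padic_ints :: "int \<Rightarrow> (nat \<Rightarrow> int) set" where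
  "padic_ints p = {x. \<forall>n. 0 \<le> x n \<and> x n < p ^ n \<and> x (Suc n) mod p ^ n = x n}"

definition zp_add :: "int \<Rightarrow> (nat \<Rightarrow> int) \<Rightarrow> (nat \<Rightarrow> int) \<Rightarrow> (nat \<Rightarrow> int)" where
  "zp_add p x y = (\<lambda>n. (x n + y n) mod p ^ n)"

definition zp_mult :: "int \<Rightarrow> (nat \<Rightarrow> int) \<Rightarrow> (nat \<Rightarrow> int) \<Rightarrow> (nat \<Rightarrow> int)" where
  "zp_mult p x y = (\<lambda>n. (x n * y n) mod p ^ n)"

definition zp_one :: "int \<Rightarrow> (nat \<Rightarrow> int)" where
  "zp_one p = (\<lambda>n. 1 mod p ^ n)"

text \<open>A field F (the type 'f) is an extension of Q_p iff Q_p = Frac(Z_p) embeds into F,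
  i.e. iff there is an injective unital ring homomorphism Z_p \<rightarrow> F (it extends uniquely
  to the fraction field Q_p).\<close>
definition extends_Qp :: "int \<Rightarrow> ((nat \<Rightarrow> int) \<Rightarrow> 'f::field) \<Rightarrow> bool" where
  "extends_Qp p \<phi> \<longleftrightarrow>
     inj_on \<phi> (padic_ints p) \<and> \<phi> (zp_one p) = 1 \<and>
     (\<forall>x\<in>padic_ints p. \<forall>y\<in>padic_ints p.
        \<phi> (zp_add p x y) = \<phi> x + \<phi> y \<and> \<phi> (zp_mult p x y) = \<phi> x * \<phi> y)"

definition subring_of :: "'f::field set \<Rightarrow> bool" where
  "subring_of R \<longleftrightarrow> 0 \<in> R \<and> 1 \<in> R \<and>
     (\<forall>a\<in>R. \<forall>b\<in>R. a + b \<in> R \<and> a - b \<in> R \<and> a * b \<in> R)"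

definition ideal_of :: "'f::field set \<Rightarrow> 'f set \<Rightarrow> bool" where
  "ideal_of R I \<longleftrightarrow> I \<subseteq> R \<and> 0 \<in> I \<and>
     (\<forall>a\<in>I. \<forall>b\<in>I. a + b \<in> I) \<and> (\<forall>r\<in>R. \<forall>a\<in>I. r * a \<in> I)"

definition noetherian_subring :: "'f::field set \<Rightarrow> bool" where
  "noetherian_subring R \<longleftrightarrow> subring_of R \<and>
     (\<forall>I. ideal_of R I \<longrightarrow>
        (\<exists>S. finite S \<and> S \<subseteq> I \<and>
             I = {\<Sum>s\<in>S. c s * s | c. \<forall>s\<in>S. c s \<in> R}))"

definition integrally_closed_in :: "'f::field set \<Rightarrow> bool" where
  "integrally_closed_in R \<longleftrightarrow>
     (\<forall>x. \<forall>P :: 'f poly. lead_coeff P = 1 \<longrightarrow> (\<forall>i. coeff P i \<in> R) \<longrightarrow> poly P x = 0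
        \<longrightarrow> x \<in> R)"

definition fraction_field_is_UNIV :: "'f::field set \<Rightarrow> bool" where
  "fraction_field_is_UNIV R \<longleftrightarrow> (\<forall>x. \<exists>a\<in>R. \<exists>b\<in>R. b \<noteq> 0 \<and> x = a / b)"

text \<open>Elements of S[G] (S a subset of the field 'f): functions on carrier G with values in S,
  zero outside the carrier (G is finite).\<close>
definition group_ring :: "('g, 'b) monoid_scheme \<Rightarrow> 'f::field set \<Rightarrow> ('g \<Rightarrow> 'f) set" where
  "group_ring G S = {a. (\<forall>g\<in>carrier G. a g \<in> S) \<and> (\<forall>g. g \<notin> carrier G \<longrightarrow> a g = 0)}"

definition gr_mult :: "('g, 'b) monoid_scheme \<Rightarrow> ('g \<Rightarrow> 'f::field) \<Rightarrow> ('g \<Rightarrow> 'f) \<Rightarrow> ('g \<Rightarrow> 'f)" where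
  "gr_mult G a b = (\<lambda>g. if g \<in> carrier G then
      (\<Sum>h\<in>carrier G. a h * b (inv\<^bsub>G\<^esub> h \<otimes>\<^bsub>G\<^esub> g)) else 0)"

definition gr_center :: "('g, 'b) monoid_scheme \<Rightarrow> 'f::field set \<Rightarrow> ('g \<Rightarrow> 'f) set" where
  "gr_center G S = {z \<in> group_ring G S. \<forall>a\<in>group_ring G S. gr_mult G z a = gr_mult G a z}"

definition is_rep :: "('g, 'b) monoid_scheme \<Rightarrow> nat \<Rightarrow> ('g \<Rightarrow> 'k::field mat) \<Rightarrow> bool" where
  "is_rep G d \<rho> \<longleftrightarrow> (\<forall>g\<in>carrier G. \<rho> g \<in> carrier_mat d d) \<and> \<rho> \<one>\<^bsub>G\<^esub> = 1\<^sub>m d \<and>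
     (\<forall>g\<in>carrier G. \<forall>h\<in>carrier G. \<rho> (g \<otimes>\<^bsub>G\<^esub> h) = \<rho> g * \<rho> h)"

definition is_irrep :: "('g, 'b) monoid_scheme \<Rightarrow> nat \<Rightarrow> ('g \<Rightarrow> 'k::field mat) \<Rightarrow> bool" where
  "is_irrep G d \<rho> \<longleftrightarrow> is_rep G d \<rho> \<and> d > 0 \<and>
     \<not> (\<exists>W. W \<subseteq> carrier_vec d \<and> 0\<^sub>v d \<in> W \<and>
            (\<forall>v\<in>W. \<forall>w\<in>W. v + w \<in> W) \<and> (\<forall>c. \<forall>v\<in>W. c \<cdot>\<^sub>v v \<in> W) \<and>
            (\<forall>g\<in>carrier G. \<forall>v\<in>W. \<rho> g *\<^sub>v v \<in> W) \<and>
            W \<noteq> {0\<^sub>v d} \<and> W \<noteq> carrier_vec d)"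

definition rep_ext :: "('g, 'b) monoid_scheme \<Rightarrow> nat \<Rightarrow> ('g \<Rightarrow> 'f::field alg_closure mat)
    \<Rightarrow> ('g \<Rightarrow> 'f) \<Rightarrow> 'f alg_closure mat" where
  "rep_ext G d \<rho> a = mat d d (\<lambda>(r, s). \<Sum>g\<in>carrier G. to_ac (a g) * \<rho> g $$ (r, s))"

text \<open>The n d x n d block matrix obtained by applying rho to each entry of the n x n matrix H
  over F[G].\<close>
definition rep_ext_mat :: "('g, 'b) monoid_scheme \<Rightarrow> nat \<Rightarrow> ('g \<Rightarrow> 'f::field alg_closure mat)
    \<Rightarrow> nat \<Rightarrow> (nat \<Rightarrow> nat \<Rightarrow> 'g \<Rightarrow> 'f) \<Rightarrow> 'f alg_closure mat" where
  "rep_ext_mat G d \<rho> n H = mat (n * d) (n * d) (\<lambda>(i, j).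
      \<Sum>g\<in>carrier G. to_ac (H (i div d) (j div d) g) * \<rho> g $$ (i mod d, j mod d))"

text \<open>Reduced norm of an n x n matrix H over F[G]: the unique central element z of F[G] which acts
  on every absolutely irreducible representation rho (over the algebraic closure of F) as the
  scalar det(rho(H)).\<close>
definition is_nr :: "('g, 'b) monoid_scheme \<Rightarrow> nat \<Rightarrow> (nat \<Rightarrow> nat \<Rightarrow> 'g \<Rightarrow> 'f::field)
    \<Rightarrow> ('g \<Rightarrow> 'f) \<Rightarrow> bool" where
  "is_nr G n H z \<longleftrightarrow> z \<in> gr_center G UNIV \<and>
     (\<forall>d \<rho>. is_irrep G d \<rho> \<longrightarrow>
        rep_ext G d \<rho> z = det (rep_ext_mat G d \<rho> n H) \<cdot>\<^sub>m 1\<^sub>m d)"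

definition nr :: "('g, 'b) monoid_scheme \<Rightarrow> nat \<Rightarrow> (nat \<Rightarrow> nat \<Rightarrow> 'g \<Rightarrow> 'f::field) \<Rightarrow> ('g \<Rightarrow> 'f)" where
  "nr G n H = (THE z. is_nr G n H z)"

end

theory Submission
  imports Defs "Jordan_Normal_Form.Char_Poly" "HOL-Algebra.Multiplicative_Group"
begin

text \<open>
  Let \<open>k\<close> be the algebraic closure of \<open>F\<close> and \<open>z = nr(H)\<close>. Since \<open>R\<close> is integrally closed,
  it suffices to show \<open>|G'| z(g) \<in> A\<close> for every valuation ring \<open>A\<close> of \<open>k\<close> containing \<open>R\<close>.

  Let \<open>z\<^sub>g\<close> be the part of \<open>z\<close> supported on the coset \<open>g G'\<close>. Twisting an irreducible
  representation \<open>\<rho>\<close> by the linear characters of \<open>G\<close> and using that \<open>\<rho>\<close> can be realised over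
  \<open>A\<close>, one sees that \<open>z\<^sub>g\<close> acts on \<open>\<rho>\<close> as a scalar \<open>c \<in> A\<close>, namely as a sum of coefficients
  of a determinant over \<open>A[G/G']\<close>. Now \<open>w = g\<inverse> z\<^sub>g\<close> lies in \<open>k[G']\<close>, and left multiplication
  by \<open>w\<close> on \<open>k[G']\<close> has trace \<open>|G'| z(g)\<close>. As \<open>z\<^sub>g\<close> acts by scalars, an eigenvalue \<open>\<mu>\<close> of this
  map satisfies \<open>\<mu>^|G| = c^|G|\<close> for one of the scalars \<open>c\<close>, so it lies in \<open>A\<close>, and so does the trace.

  The reduced norm exists because the element of \<open>k[G]\<close> acting on each irreducible representation
  \<open>\<rho>\<close> as \<open>det \<rho>(H)\<close> is invariant under the automorphisms of \<open>k\<close> over \<open>F\<close>.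
\<close>

section \<open>Valuation rings\<close>

text \<open>Valuation rings of \<open>k\<close> itself are used because the reduced norm is defined
  through representations over \<open>k\<close>. They repair two defects of a general
  \<open>R\<close>: a representation need not be realisable over \<open>R\<close>, whereas over
  \<open>A\<close> the lattice spanned by the translates of a basis is free; and \<open>x\<close>
  lies in \<open>A\<close> as soon as \<open>x^n\<close> does, which the eigenvalue comparison
  needs. The twists isolate a coset without introducing the denominator [G : G']: averaging over the
  linear characters multiplies by that index both the action of \<open>z\<^sub>g\<close> and the sum
  of coefficients, and it cancels in characteristic 0. The factor |G'| is the dimension of
  \<open>k[G']\<close>: all diagonal entries of left multiplication by \<open>w\<close> in the basis
  G' are \<open>w(1) = z(g)\<close>. The element \<open>w\<close> itself need not act as a scalar on
  \<open>\<rho>\<close>, only \<open>g w\<close> does; an eigenvector \<open>u\<close> in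
  \<open>k[G']\<close> gives \<open>\<mu> \<rho>(g) \<rho>(u) = c \<rho>(u)\<close>, and iterating
  until the power of \<open>g\<close> is trivial removes \<open>g\<close>.\<close>

definition valuation_subring :: "'k::field set \<Rightarrow> bool" where
  "valuation_subring A \<longleftrightarrow> subring_of A \<and> (\<forall>x. x \<in> A \<or> inverse x \<in> A)"

context
  fixes A :: "'k::field set"
  assumes A: "subring_of A"
begin

lemma subring_of_zero: "0 \<in> A" and subring_of_one: "1 \<in> A"
  using A by (auto simp: subring_of_def)

lemma subring_of_add: "a \<in> A \<Longrightarrow> b \<in> A \<Longrightarrow> a + b \<in> A"
  and subring_of_diff: "a \<in> A \<Longrightarrow> b \<in> A \<Longrightarrow> a - b \<in> A"
  and subring_of_mult: "a \<in> A \<Longrightarrow> b \<in> A \<Longrightarrow> a * b \<in> A"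
  using A by (auto simp: subring_of_def)

lemma subring_of_uminus: "a \<in> A \<Longrightarrow> - a \<in> A"
  using subring_of_diff[OF subring_of_zero, of a] by simp

lemma subring_of_sum: "(\<And>i. i \<in> I \<Longrightarrow> f i \<in> A) \<Longrightarrow> sum f I \<in> A"
  by (induction I rule: infinite_finite_induct) (auto intro: subring_of_add subring_of_zero)

lemma subring_of_power: "a \<in> A \<Longrightarrow> a ^ n \<in> A"
  by (induction n) (auto intro: subring_of_mult subring_of_one)

lemma subring_of_coeff_mult:
  assumes "\<And>i. coeff p i \<in> A" "\<And>i. coeff q i \<in> A"
  shows "coeff (p * q) i \<in> A"
  unfolding coeff_mult by (intro subring_of_sum subring_of_mult assms)

lemma subring_of_adjoin: "subring_of {poly p y | p. \<forall>i. coeff p i \<in> A}"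
  unfolding subring_of_def
proof (intro conjI ballI)
  show "0 \<in> {poly p y |p. \<forall>i. coeff p i \<in> A}"
    by (auto intro!: exI[of _ 0] subring_of_zero)
  show "1 \<in> {poly p y |p. \<forall>i. coeff p i \<in> A}"
    by (auto intro!: exI[of _ 1] subring_of_one subring_of_zero)
  fix a b assume "a \<in> {poly p y |p. \<forall>i. coeff p i \<in> A}" "b \<in> {poly p y |p. \<forall>i. coeff p i \<in> A}"
  then obtain p q where p: "a = poly p y" "\<And>i. coeff p i \<in> A" and q: "b = poly q y" "\<And>i. coeff q i \<in> A"
    by auto
  show "a + b \<in> {poly p y |p. \<forall>i. coeff p i \<in> A}"
    using p q by (auto intro!: exI[of _ "p + q"] subring_of_add)
  show "a - b \<in> {poly p y |p. \<forall>i. coeff p i \<in> A}"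
    using p q by (auto intro!: exI[of _ "p - q"] subring_of_diff)
  show "a * b \<in> {poly p y |p. \<forall>i. coeff p i \<in> A}"
    using p q by (auto intro!: exI[of _ "p * q"] subring_of_coeff_mult)
qed

lemma adjoin_base: "a \<in> A \<Longrightarrow> a \<in> {poly p y | p. \<forall>i. coeff p i \<in> A}"
  by (auto intro!: exI[of _ "[:a:]"] subring_of_zero simp: coeff_pCons split: nat.split)

lemma adjoin_generator: "y \<in> {poly p y | p. \<forall>i. coeff p i \<in> A}"
  by (auto intro!: exI[of _ "[:0,1:]"] subring_of_zero subring_of_one simp: coeff_pCons split: nat.split)

end

text \<open>The integral closedness of a valuation ring, for the equations \<open>X^n = a\<close>:
  otherwise \<open>inverse x\<close> lies in \<open>A\<close>, and
  \<open>x = x^n (1/x)^(n-1)\<close>.\<close>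

lemma valuation_subring_power_cancel:
  assumes "valuation_subring A" "x ^ n \<in> A" "n > 0"
  shows "x \<in> A"
proof (rule ccontr)
  assume "x \<notin> A"
  with assms have inv: "inverse x \<in> A" and A: "subring_of A"
    by (auto simp: valuation_subring_def)
  from \<open>x \<notin> A\<close> have x0: "x \<noteq> 0" using subring_of_zero[OF A] by auto
  obtain m where n: "n = Suc m" using assms(3) by (cases n) auto
  have "x = x ^ n * inverse x ^ m" using x0 by (simp add: n power_inverse)
  then show False using \<open>x \<notin> A\<close> subring_of_mult[OF A assms(2) subring_of_power[OF A inv]] by metis
qed

text \<open>The exchange step in the classical proof that a ring maximal without \<open>x\<close> is
  a valuation ring. The assumption \<open>unit\<close> says that \<open>1/x\<close> lies in the
  Jacobson radical of \<open>A\<close>. Dividing by the unit \<open>s\<close> removes the constant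
  term of the expression of \<open>x\<close> in \<open>1/y\<close>; what remains expresses
  \<open>y^(m+1)\<close> through lower powers of \<open>y\<close>, and this is put into the
  expression of \<open>x\<close> in \<open>y\<close>.\<close>

lemma degree_lowering:
  assumes A: "subring_of A" and x0: "x \<noteq> 0" and y0: "y \<noteq> 0" and tA: "inverse x \<in> A"
    and unit: "\<And>b. b \<in> A \<Longrightarrow> inverse (1 - inverse x * b) \<in> A \<and> 1 - inverse x * b \<noteq> 0"
    and p: "\<And>i. p i \<in> A" "x = (\<Sum>i\<le>Suc m. p i * y ^ i)"
    and q: "\<And>i. q i \<in> A" "x = (\<Sum>i\<le>Suc l. q i * inverse y ^ i)"
    and lm: "l \<le> m"
  shows "\<exists>r. (\<forall>i. r i \<in> A) \<and> x = (\<Sum>i\<le>m. r i * y ^ i)"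
proof -
  define s where "s = 1 - inverse x * q 0"
  have s: "inverse s \<in> A" "s \<noteq> 0" using unit[OF q(1)[of 0]] by (auto simp: s_def)
  have "x * s = x - q 0" using x0 by (simp add: s_def field_simps)
  also have "\<dots> = (\<Sum>i\<le>l. q (Suc i) * inverse y ^ Suc i)"
    by (subst q(2), subst sum.atMost_Suc_shift) simp
  finally have "x = inverse s * (\<Sum>i\<le>l. q (Suc i) * inverse y ^ Suc i)"
    using s by (simp add: field_simps)
  \<comment> \<open>Here \<open>y^(m+1) = (1/x) y^(m+1) x\<close>, with the last factor replaced.
    Since \<open>l \<le> m\<close>, no negative powers of \<open>y\<close> survive.\<close>
  then have "y ^ Suc m = inverse x * y ^ Suc m * (inverse s * (\<Sum>i\<le>l. q (Suc i) * inverse y ^ Suc i))"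
    using x0 by (metis (no_types, lifting) mult.assoc mult.commute mult.left_neutral right_inverse)
  also have "\<dots> = (\<Sum>i\<le>l. inverse x * inverse s * q (Suc i) * y ^ (m - i))"
    unfolding sum_distrib_left
  proof (intro sum.cong refl)
    fix i assume "i \<in> {..l}"
    then have "m = i + (m - i)" using lm by auto
    then have "y ^ Suc m = y ^ Suc i * y ^ (m - i)" by (metis add_Suc power_add)
    then show "inverse x * y ^ Suc m * (inverse s * (q (Suc i) * inverse y ^ Suc i)) =
      inverse x * inverse s * q (Suc i) * y ^ (m - i)"
      using y0 by (simp add: field_simps)
  qed
  also have "\<dots> = (\<Sum>i\<le>m. if i \<le> l then inverse x * inverse s * q (Suc i) * y ^ (m - i) else 0)"
    using lm by (subst sum.inter_filter[symmetric]) (auto intro!: sum.cong)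
  also have "\<dots> = (\<Sum>i\<le>m. if m - i \<le> l then inverse x * inverse s * q (Suc (m - i)) * y ^ i else 0)"
    by (rule sum.reindex_bij_witness[of _ "\<lambda>i. m - i" "\<lambda>i. m - i"]) auto
  finally have ym: "y ^ Suc m = (\<Sum>i\<le>m. (if m - i \<le> l then inverse x * inverse s * q (Suc (m - i)) else 0) * y ^ i)"
    (is "_ = (\<Sum>i\<le>m. ?c i * y ^ i)")
    by (simp add: if_distrib[of "\<lambda>x. x * _"] cong: if_cong)
  have cA: "?c i \<in> A" for i
    by (auto intro!: subring_of_mult[OF A] subring_of_zero[OF A] tA s q)
  have "x = (\<Sum>i\<le>m. p i * y ^ i) + p (Suc m) * (\<Sum>i\<le>m. ?c i * y ^ i)"
    by (subst p(2)) (simp only: sum.atMost_Suc ym[symmetric])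
  also have "\<dots> = (\<Sum>i\<le>m. (p i + p (Suc m) * ?c i) * y ^ i)"
    by (simp add: sum_distrib_left sum.distrib[symmetric] algebra_simps)
  finally show ?thesis
    by (intro exI[of _ "\<lambda>i. p i + p (Suc m) * ?c i"])
      (auto intro!: subring_of_add[OF A] subring_of_mult[OF A] p cA split del: if_split)
qed

text \<open>Among the subrings containing \<open>R\<close> and \<open>1/x\<close> but not \<open>x\<close>, a maximal one is a valuation ring.\<close>

theorem valuation_subring_avoiding_nonintegral:
  fixes x :: "'k::field"
  assumes R: "subring_of R"
    and nonint: "\<And>P. lead_coeff P = 1 \<Longrightarrow> (\<And>i. coeff P i \<in> R) \<Longrightarrow> poly P x \<noteq> 0"
  shows "\<exists>A. valuation_subring A \<and> R \<subseteq> A \<and> x \<notin> A"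
proof -
  define \<S> where "\<S> = {A. subring_of A \<and> R \<subseteq> A \<and> inverse x \<in> A \<and> x \<notin> A}"
  have x0: "x \<noteq> 0"
    using nonint[of "[:0,1:]"] subring_of_zero[OF R] subring_of_one[OF R]
    by (auto simp: coeff_pCons split: nat.splits)
  define A0 where "A0 = {poly p (inverse x) | p. \<forall>i. coeff p i \<in> R}"
  have "x \<notin> A0"
  proof
    assume "x \<in> A0"
    then obtain p where p: "x = poly p (inverse x)" "\<And>i. coeff p i \<in> R" by (auto simp: A0_def)
    define n where "n = degree p"
    \<comment> \<open>\<open>P\<close> is \<open>X^(n+1) - (p_0 X^n + ... + p_n)\<close>, the
      relation \<open>x = p(1/x)\<close> multiplied by \<open>x^n\<close>.\<close>
    define P where "P = monom 1 (Suc n) - (\<Sum>i\<le>n. monom (coeff p i) (n - i))"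
    have deg: "degree (\<Sum>i\<le>n. monom (coeff p i) (n - i)) \<le> n"
      by (intro degree_sum_le) (auto intro: order.trans[OF degree_monom_le])
    have "degree P = Suc n" "coeff P (Suc n) = 1"
    proof -
      show "degree P = Suc n" unfolding P_def
        using degree_add_eq_left[of "- (\<Sum>i\<le>n. monom (coeff p i) (n - i))" "monom 1 (Suc n) :: 'k poly"] deg
        by (simp add: degree_monom_eq)
      show "coeff P (Suc n) = 1" using deg by (simp add: P_def coeff_eq_0)
    qed
    then have "lead_coeff P = 1" by simp
    moreover have "coeff P i \<in> R" for i unfolding P_def coeff_diff coeff_sum
      by (intro subring_of_diff[OF R] subring_of_sum[OF R])
        (auto intro: subring_of_zero[OF R] subring_of_one[OF R] p)
    moreover have "poly P x = 0"
    proof -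
      have "x ^ Suc n = x ^ n * (\<Sum>i\<le>n. coeff p i * inverse x ^ i)"
        by (subst power_Suc2, subst (2) p(1)) (simp only: poly_altdef n_def)
      also have "\<dots> = (\<Sum>i\<le>n. coeff p i * x ^ (n - i))"
        unfolding sum_distrib_left
      proof (intro sum.cong refl)
        fix i assume "i \<in> {..n}"
        then have "x ^ n = x ^ i * x ^ (n - i)" by (simp flip: power_add)
        then show "x ^ n * (coeff p i * inverse x ^ i) = coeff p i * x ^ (n - i)"
          using x0 by (simp add: power_inverse)
      qed
      finally show ?thesis by (simp add: P_def poly_sum poly_monom)
    qed
    ultimately show False using nonint by blast
  qed
  then have A0: "A0 \<in> \<S>"
    using subring_of_adjoin[OF R, of "inverse x"] adjoin_base[OF R, of _ "inverse x"]
      adjoin_generator[OF R, of "inverse x"]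
    by (auto simp: \<S>_def A0_def)
  have "\<exists>M\<in>\<S>. \<forall>B\<in>\<S>. (M \<subseteq> B \<longrightarrow> B = M)"
  proof (rule subset_Zorn_nonempty)
    show "\<S> \<noteq> {}" using A0 by auto
    fix \<C> assume ne: "\<C> \<noteq> {}" and ch: "subset.chain \<S> \<C>"
    have sub: "\<C> \<subseteq> \<S>" and tot: "\<And>B C. B \<in> \<C> \<Longrightarrow> C \<in> \<C> \<Longrightarrow> B \<subseteq> C \<or> C \<subseteq> B"
      using ch by (auto simp: subset_chain_def)
    have "subring_of (\<Union>\<C>)" unfolding subring_of_def
    proof (intro conjI ballI)
      show "0 \<in> \<Union>\<C>" "1 \<in> \<Union>\<C>"
        using ne sub by (auto simp: \<S>_def subring_of_def)
      fix a b assume "a \<in> \<Union>\<C>" "b \<in> \<Union>\<C>"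
      then obtain B where B: "B \<in> \<C>" "a \<in> B" "b \<in> B" using tot by blast
      then have "subring_of B" using sub by (auto simp: \<S>_def)
      then show "a + b \<in> \<Union>\<C>" "a - b \<in> \<Union>\<C>" "a * b \<in> \<Union>\<C>"
        using B by (auto simp: subring_of_def)
    qed
    then show "\<Union>\<C> \<in> \<S>" using ne sub by (fastforce simp: \<S>_def)
  qed
  then obtain A where AA: "A \<in> \<S>" and max: "\<And>B. B \<in> \<S> \<Longrightarrow> A \<subseteq> B \<Longrightarrow> B = A" by blast
  have A: "subring_of A" and RA: "R \<subseteq> A" and tA: "inverse x \<in> A" and xA: "x \<notin> A"
    using AA by (auto simp: \<S>_def)
  \<comment> \<open>Maximality: \<open>A[y]\<close> contains \<open>R\<close> and \<open>1/x\<close>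
    and is larger than \<open>A\<close>, so it can only fail to belong to \<open>\<S>\<close> by
    containing \<open>x\<close>.\<close>
  have adj: "\<exists>p. (\<forall>i. coeff p i \<in> A) \<and> x = poly p y" if "y \<notin> A" for y
  proof (rule ccontr)
    assume neg: "\<not> ?thesis"
    let ?X = "{poly p y | p. \<forall>i. coeff p i \<in> A}"
    have "?X \<in> \<S>" using neg RA tA subring_of_adjoin[OF A, of y] adjoin_base[OF A, of _ y]
      by (auto simp: \<S>_def)
    moreover have "A \<subseteq> ?X" using adjoin_base[OF A, of _ y] by blast
    ultimately have "?X = A" by (rule max)
    then show False using adjoin_generator[OF A, of y] that by blast
  qed
  have unit: "inverse (1 - inverse x * b) \<in> A \<and> 1 - inverse x * b \<noteq> 0" if b: "b \<in> A" for b
  proof -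
    define s where "s = 1 - inverse x * b"
    have sA: "s \<in> A" unfolding s_def by (intro subring_of_diff[OF A] subring_of_mult[OF A] subring_of_one[OF A] tA b)
    have s0: "s \<noteq> 0"
    proof
      assume "s = 0"
      then have "b = x" using x0 by (simp add: s_def field_simps)
      then show False using b xA by simp
    qed
    have "inverse s \<in> A"
    proof (rule ccontr)
      \<comment> \<open>Then \<open>x\<close> is a polynomial in \<open>1/s\<close>, so
        \<open>x s^m\<close> lies in \<open>A\<close> for its degree \<open>m\<close>. As
        \<open>s\<close> is 1 modulo \<open>(1/x) A\<close>, also \<open>x s^m = x - e\<close> with
        \<open>e\<close> in \<open>A\<close>, which would put \<open>x\<close> in
        \<open>A\<close>.\<close>
      assume "inverse s \<notin> A"
      from adj[OF this] obtain p where p: "\<And>i. coeff p i \<in> A" "x = poly p (inverse s)" by auto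
      define m where "m = degree p"
      have "x * s ^ m = (\<Sum>i\<le>m. coeff p i * s ^ (m - i))"
        unfolding p(2)[unfolded poly_altdef, folded m_def] sum_distrib_right
      proof (intro sum.cong refl)
        fix i assume "i \<in> {..m}"
        then have "s ^ m = s ^ i * s ^ (m - i)" by (simp flip: power_add)
        then show "coeff p i * inverse s ^ i * s ^ m = coeff p i * s ^ (m - i)"
          using s0 by (simp add: power_inverse)
      qed
      also have "\<dots> \<in> A" by (intro subring_of_sum[OF A] subring_of_mult[OF A] subring_of_power[OF A] p sA)
      finally have 1: "x * s ^ m \<in> A" .
      have "\<exists>e\<in>A. s ^ m = 1 - inverse x * e" for m
      proof (induction m)
        case 0 show ?case by (intro bexI[of _ 0] subring_of_zero[OF A]) auto
      next
        case (Suc m)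
        then obtain e where e: "e \<in> A" "s ^ m = 1 - inverse x * e" by auto
        have "s ^ Suc m = 1 - inverse x * (b + e - inverse x * b * e)"
          unfolding power_Suc e(2) unfolding s_def by (simp add: algebra_simps)
        then show ?case
          by (intro bexI[of _ "b + e - inverse x * b * e"])
            (auto intro!: subring_of_diff[OF A] subring_of_add[OF A] subring_of_mult[OF A] tA b e)
      qed
      then obtain e where e: "e \<in> A" "s ^ m = 1 - inverse x * e" by blast
      have "x = x * s ^ m + e" using x0 by (simp add: e field_simps)
      then show False using xA subring_of_add[OF A 1 e(1)] by simp
    qed
    with s0 show ?thesis by (simp add: s_def)
  qed
  have "y \<in> A \<or> inverse y \<in> A" for y
  proof (rule ccontr)
    assume neg: "\<not> (y \<in> A \<or> inverse y \<in> A)"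
    then have y0: "y \<noteq> 0" using subring_of_zero[OF A] by auto
    define E where "E y m \<longleftrightarrow> (\<exists>a. (\<forall>i. a i \<in> A) \<and> x = (\<Sum>i\<le>m. a i * y ^ i))" for y and m :: nat
    have E: "\<exists>m. E y m" if "y \<notin> A" for y
      using adj[OF that] by (auto simp: E_def poly_altdef)
    have E0: "\<not> E y 0" for y using xA by (auto simp: E_def)
    have low: "E y m" if "E y (Suc m)" "E (inverse y) (Suc l)" "l \<le> m" "y \<noteq> 0" for y m l
      using that degree_lowering[OF A x0 \<open>y \<noteq> 0\<close> tA unit, of _ m _ l] unfolding E_def by blast
    \<comment> \<open>Both degrees are minimal, and positive because \<open>x\<close> is not in
      \<open>A\<close>; the larger one can be lowered by \<open>degree_lowering\<close>, applied to
      \<open>y\<close> or to \<open>1/y\<close>.\<close>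
    define m where "m = (LEAST m. E y m)"
    define l where "l = (LEAST m. E (inverse y) m)"
    have m: "E y m" "\<And>m'. m' < m \<Longrightarrow> \<not> E y m'"
      using E[of y] neg by (auto simp: m_def intro: LeastI_ex dest: not_less_Least)
    have l: "E (inverse y) l" "\<And>m'. m' < l \<Longrightarrow> \<not> E (inverse y) m'"
      using E[of "inverse y"] neg by (auto simp: l_def intro: LeastI_ex dest: not_less_Least)
    obtain m' l' where ml: "m = Suc m'" "l = Suc l'"
      using m(1) l(1) E0 by (metis not0_implies_Suc)
    show False
    proof (cases "l' \<le> m'")
      case True
      then show False using low[of y m' l'] m l y0 by (auto simp: ml)
    next
      case False
      then show False using low[of "inverse y" l' m'] m l y0 by (auto simp: ml)
    qed
  qed
  then show ?thesis using A RA xA by (auto simp: valuation_subring_def)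
qed

section \<open>Automorphisms of the algebraic closure\<close>

text \<open>A partial isomorphism over \<open>F\<close> is represented by its graph, a subring of \<open>k \<times> k\<close>.\<close>

definition partial_iso :: "'k::field set \<Rightarrow> ('k \<times> 'k) set \<Rightarrow> bool" where
  "partial_iso F \<Gamma> \<longleftrightarrow> (\<forall>a\<in>F. (a, a) \<in> \<Gamma>) \<and>
     (\<forall>a b c d. (a, b) \<in> \<Gamma> \<longrightarrow> (c, d) \<in> \<Gamma> \<longrightarrow>
        (a + c, b + d) \<in> \<Gamma> \<and> (a - c, b - d) \<in> \<Gamma> \<and> (a * c, b * d) \<in> \<Gamma>) \<and>
     (\<forall>b. (0, b) \<in> \<Gamma> \<longrightarrow> b = 0)"

text \<open>\<open>f'\<close> is the image of \<open>f\<close> when \<open>\<Gamma>\<close> is read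
  as a map on coefficients; keeping the pair avoids partial functions.\<close>

definition paired_polys :: "('k::field \<times> 'k) set \<Rightarrow> 'k poly \<Rightarrow> 'k poly \<Rightarrow> bool" where
  "paired_polys \<Gamma> f f' \<longleftrightarrow> (\<forall>i. (coeff f i, coeff f' i) \<in> \<Gamma>)"

context
  fixes F :: "'k::field set"
  assumes F: "subring_of F"
    and algebraic: "\<And>x. \<exists>p. p \<noteq> 0 \<and> (\<forall>i. coeff p i \<in> F) \<and> poly p x = 0"
begin

text \<open>Divide an annihilating polynomial of \<open>a\<close> by \<open>X\<close> until its
  constant term is nonzero, then solve for that term. A relation compatible with the ring operations
  is therefore compatible with inverses, which \<open>partial_iso\<close> does not demand.\<close>

lemma inverse_eq_poly:
  assumes inv: "\<And>a. a \<in> F \<Longrightarrow> inverse a \<in> F" and "a \<noteq> 0"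
  shows "\<exists>q. (\<forall>i. coeff q i \<in> F) \<and> a * poly q a = 1"
proof -
  have *: "\<exists>q. (\<forall>i. coeff q i \<in> F) \<and> a * poly q a = 1"
    if "p \<noteq> 0" "\<forall>i. coeff p i \<in> F" "poly p a = 0" for p
    using that
  proof (induction p)
    case (pCons c p)
    have c: "c \<in> F" and p: "\<forall>i. coeff p i \<in> F"
      using pCons.prems(2) by (metis coeff_pCons_0, metis coeff_pCons_Suc)
    show ?case
    proof (cases "c = 0")
      case True
      then show ?thesis using pCons p \<open>a \<noteq> 0\<close> by auto
    next
      case False
      have "a * poly p a = - c" using pCons.prems(3) by (simp add: add_eq_0_iff)
      then have "a * (- inverse c * poly p a) = 1" using False by (simp add: field_simps)
      then show ?thesis
        by (intro exI[of _ "smult (- inverse c) p"])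
          (auto intro!: subring_of_uminus[OF F] subring_of_mult[OF F] inv c p[rule_format])
    qed
  qed auto
  show ?thesis using algebraic[of a] * by blast
qed

context
  fixes \<Gamma> :: "('k \<times> 'k) set"
  assumes \<Gamma>: "partial_iso F \<Gamma>"
begin

lemma partial_iso_base: "a \<in> F \<Longrightarrow> (a, a) \<in> \<Gamma>"
  and partial_iso_add: "(a, b) \<in> \<Gamma> \<Longrightarrow> (c, d) \<in> \<Gamma> \<Longrightarrow> (a + c, b + d) \<in> \<Gamma>"
  and partial_iso_diff: "(a, b) \<in> \<Gamma> \<Longrightarrow> (c, d) \<in> \<Gamma> \<Longrightarrow> (a - c, b - d) \<in> \<Gamma>"
  and partial_iso_mult: "(a, b) \<in> \<Gamma> \<Longrightarrow> (c, d) \<in> \<Gamma> \<Longrightarrow> (a * c, b * d) \<in> \<Gamma>"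
  and partial_iso_zero: "(0, b) \<in> \<Gamma> \<Longrightarrow> b = 0"
  using \<Gamma> unfolding partial_iso_def by blast+

lemma partial_iso_unique: "(a, b) \<in> \<Gamma> \<Longrightarrow> (a, c) \<in> \<Gamma> \<Longrightarrow> b = c"
  using partial_iso_zero[of "b - c"] partial_iso_diff[of a b a c] by simp

lemma partial_iso_sum:
  "(\<And>i. i \<in> I \<Longrightarrow> (f i, g i) \<in> \<Gamma>) \<Longrightarrow> (sum f I, sum g I) \<in> \<Gamma>"
  by (induction I rule: infinite_finite_induct)
    (auto intro: partial_iso_add partial_iso_base subring_of_zero[OF F])

lemma partial_iso_poly:
  assumes "paired_polys \<Gamma> f f'" "(y, y') \<in> \<Gamma>"
  shows "(poly f y, poly f' y') \<in> \<Gamma>"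
proof -
  have pow: "(y ^ n, y' ^ n) \<in> \<Gamma>" for n
    by (induction n) (auto intro: partial_iso_mult assms partial_iso_base subring_of_one[OF F])
  let ?n = "max (degree f) (degree f')"
  have "poly f y = (\<Sum>i\<le>?n. coeff f i * y ^ i)" "poly f' y' = (\<Sum>i\<le>?n. coeff f' i * y' ^ i)"
    by (auto simp: poly_altdef intro!: sum.mono_neutral_left le_degree)
  then show ?thesis
    using assms(1) pow by (auto intro!: partial_iso_sum partial_iso_mult simp: paired_polys_def)
qed

lemma paired_polys_add: "paired_polys \<Gamma> f f' \<Longrightarrow> paired_polys \<Gamma> g g' \<Longrightarrow> paired_polys \<Gamma> (f + g) (f' + g')"
  and paired_polys_diff: "paired_polys \<Gamma> f f' \<Longrightarrow> paired_polys \<Gamma> g g' \<Longrightarrow> paired_polys \<Gamma> (f - g) (f' - g')"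
  and paired_polys_mult: "paired_polys \<Gamma> f f' \<Longrightarrow> paired_polys \<Gamma> g g' \<Longrightarrow> paired_polys \<Gamma> (f * g) (f' * g')"
  by (auto simp: paired_polys_def coeff_mult
      intro: partial_iso_add partial_iso_diff intro!: partial_iso_sum partial_iso_mult)

lemma paired_polys_monom: "(a, b) \<in> \<Gamma> \<Longrightarrow> paired_polys \<Gamma> (monom a n) (monom b n)"
  by (auto simp: paired_polys_def intro: partial_iso_base subring_of_zero[OF F])

lemma paired_polys_base: "(\<And>i. coeff f i \<in> F) \<Longrightarrow> paired_polys \<Gamma> f f"
  by (auto simp: paired_polys_def intro: partial_iso_base)

text \<open>Both claims come from \<open>a q(a) = 1\<close> with \<open>q\<close> over
  \<open>F\<close>, a relation that \<open>\<Gamma>\<close> carries to \<open>b q(b) = 1\<close>.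
  The claim \<open>b \<noteq> 0\<close> is the injectivity of the isomorphism, since
  \<open>partial_iso\<close> itself only makes the graph single-valued.\<close>

lemma partial_iso_inverse:
  assumes inv: "\<And>a. a \<in> F \<Longrightarrow> inverse a \<in> F" and ab: "(a, b) \<in> \<Gamma>" "a \<noteq> 0"
  shows "(inverse a, inverse b) \<in> \<Gamma>" "b \<noteq> 0"
proof -
  from inverse_eq_poly[OF inv ab(2)] obtain q where q: "\<And>i. coeff q i \<in> F" "a * poly q a = 1" by auto
  have 1: "(poly q a, poly q b) \<in> \<Gamma>" by (intro partial_iso_poly paired_polys_base q ab)
  from partial_iso_mult[OF ab(1) this] have "(1, b * poly q b) \<in> \<Gamma>" by (simp add: q)
  then have "b * poly q b = 1"
    using partial_iso_unique partial_iso_base[OF subring_of_one[OF F]] by blast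
  then show "(inverse a, inverse b) \<in> \<Gamma>" "b \<noteq> 0"
    using 1 inverse_unique[OF q(2)] inverse_unique[of b] by auto
qed

text \<open>Adjoining \<open>y\<close> to the domain and sending it to \<open>y'\<close>. Here
  \<open>f\<close> is a minimal polynomial of \<open>y\<close> over the domain, not necessarily
  monic, and \<open>y'\<close> is a root of its image. Sending \<open>g(y)\<close> to
  \<open>g'(y')\<close> is well defined because \<open>f\<close> divides every \<open>g\<close> that
  vanishes at \<open>y\<close>, and the division is mirrored by \<open>f'\<close> and
  \<open>g'\<close>.\<close>

lemma partial_iso_extend:
  assumes inv: "\<And>a. a \<in> F \<Longrightarrow> inverse a \<in> F"
    and f: "paired_polys \<Gamma> f f'" "f \<noteq> 0" "poly f' y' = 0"
    and min: "\<And>g g'. paired_polys \<Gamma> g g' \<Longrightarrow> g \<noteq> 0 \<Longrightarrow> poly g y = 0 \<Longrightarrow> degree f \<le> degree g"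
    and fy: "poly f y = 0"
  shows "\<exists>\<Gamma>'. partial_iso F \<Gamma>' \<and> \<Gamma> \<subseteq> \<Gamma>' \<and> (y, y') \<in> \<Gamma>'"
proof -
  have vanish: "poly g' y' = 0" if "paired_polys \<Gamma> g g'" "poly g y = 0" for g g'
    using that
  proof (induction "degree g" arbitrary: g g' rule: less_induct)
    case less
    show ?case
    proof (cases "g = 0")
      case True
      then have "g' = 0"
        using less.prems(1) by (auto simp: paired_polys_def poly_eq_iff intro: partial_iso_zero)
      then show ?thesis by simp
    next
      case False
      define m where "m = degree g - degree f"
      define c where "c = lead_coeff g * inverse (lead_coeff f)"
      define c' where "c' = coeff g' (degree g) * inverse (coeff f' (degree f))"
      have deg: "degree f \<le> degree g" using min less.prems False by auto
      have cc: "(c, c') \<in> \<Gamma>" unfolding c_def c'_def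
        using less.prems(1) f(1,2) unfolding paired_polys_def
        by (intro partial_iso_mult partial_iso_inverse(1) inv) auto
      \<comment> \<open>One step of long division, done on \<open>g\<close> and \<open>g'\<close> in
        parallel: the leading term of \<open>g\<close> cancels, so either the degree drops or
        \<open>h = 0\<close>.\<close>
      define h where "h = g - monom c m * f"
      define h' where "h' = g' - monom c' m * f'"
      have hh: "paired_polys \<Gamma> h h'" unfolding h_def h'_def
        by (intro paired_polys_diff paired_polys_mult paired_polys_monom cc less.prems f)
      have hy: "poly h y = 0" by (simp add: h_def less.prems fy)
      have "poly h' y' = 0"
      proof (cases "degree h < degree g")
        case True
        then show ?thesis using less.hyps hh hy by blast
      next
        case False
        have dm: "degree (monom c m * f) \<le> degree g"
          using degree_mult_le[of "monom c m" f] degree_monom_le[of c m] deg by (simp add: m_def)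
        have "coeff (monom c m * f) (degree g) = lead_coeff g"
          using deg f(2) by (simp add: coeff_monom_mult m_def c_def)
        then have "coeff h (degree g) = 0" by (simp add: h_def)
        moreover have "degree h \<le> degree g" unfolding h_def using dm by (intro degree_diff_le) auto
        ultimately have "h = 0" using False
          by (metis le_antisym leading_coeff_0_iff not_less)
        then have "h' = 0" using hh by (auto simp: paired_polys_def poly_eq_iff intro: partial_iso_zero)
        then show ?thesis by simp
      qed
      then show ?thesis using f(3) by (simp add: h'_def)
    qed
  qed
  let ?\<Gamma> = "{(poly g y, poly g' y') | g g'. paired_polys \<Gamma> g g'}"
  have sub: "\<Gamma> \<subseteq> ?\<Gamma>"
  proof clarify
    fix a b assume "(a, b) \<in> \<Gamma>"
    from paired_polys_monom[OF this, of 0] show "\<exists>g g'. (a, b) = (poly g y, poly g' y') \<and> paired_polys \<Gamma> g g'"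
      by (intro exI[of _ "monom a 0"] exI[of _ "monom b 0"]) (simp add: poly_monom)
  qed
  have one: "(1, 1) \<in> \<Gamma>" by (intro partial_iso_base subring_of_one[OF F])
  have "(y, y') \<in> ?\<Gamma>"
    using paired_polys_monom[OF one, of 1]
    by (auto intro!: exI[of _ "monom 1 1"] simp: poly_monom)
  moreover have "partial_iso F ?\<Gamma>" unfolding partial_iso_def
  proof (intro conjI allI impI ballI)
    fix a assume "a \<in> F" then show "(a, a) \<in> ?\<Gamma>" using sub partial_iso_base by blast
  next
    fix b assume "(0, b) \<in> ?\<Gamma>" then show "b = 0" using vanish by auto
  next
    fix a b c d assume "(a, b) \<in> ?\<Gamma>" "(c, d) \<in> ?\<Gamma>"
    then obtain g g' h h' where g: "a = poly g y" "b = poly g' y'" "paired_polys \<Gamma> g g'"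
      and h: "c = poly h y" "d = poly h' y'" "paired_polys \<Gamma> h h'" by auto
    show "(a + c, b + d) \<in> ?\<Gamma>" unfolding mem_Collect_eq using paired_polys_add[OF g(3) h(3)] g h
      by (intro exI[of _ "g + h"] exI[of _ "g' + h'"]) simp
    show "(a - c, b - d) \<in> ?\<Gamma>" unfolding mem_Collect_eq using paired_polys_diff[OF g(3) h(3)] g h
      by (intro exI[of _ "g - h"] exI[of _ "g' - h'"]) simp
    show "(a * c, b * d) \<in> ?\<Gamma>" unfolding mem_Collect_eq using paired_polys_mult[OF g(3) h(3)] g h
      by (intro exI[of _ "g * h"] exI[of _ "g' * h'"]) simp
  qed
  ultimately show ?thesis using sub by blast
qed

lemma minimal_paired_polys:
  "\<exists>f f'. paired_polys \<Gamma> f f' \<and> f \<noteq> 0 \<and> poly f y = 0 \<and>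
    (\<forall>g g'. paired_polys \<Gamma> g g' \<longrightarrow> g \<noteq> 0 \<longrightarrow> poly g y = 0 \<longrightarrow> degree f \<le> degree g)"
proof -
  let ?P = "\<lambda>n. \<exists>f f'. paired_polys \<Gamma> f f' \<and> f \<noteq> 0 \<and> poly f y = 0 \<and> degree f = n"
  have "\<exists>n. ?P n" using algebraic[of y] paired_polys_base by blast
  then have "?P (LEAST n. ?P n)" by (rule LeastI_ex)
  moreover have "(LEAST n. ?P n) \<le> n" if "?P n" for n by (rule Least_le) (rule that)
  ultimately show ?thesis by metis
qed

end

end

text \<open>A minimal polynomial of \<open>x\<close> over \<open>F\<close> has degree above 1, and
  in characteristic 0 \<open>x\<close> is a simple root of it, so it has another root
  \<open>x'\<close>. The isomorphism sending \<open>x\<close> to \<open>x'\<close> is extended to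
  all of \<open>k\<close> by Zorn's lemma.\<close>

theorem automorphism_moving:
  fixes F :: "'k::alg_closed_field set"
  assumes F: "subring_of F" and inv: "\<And>a. a \<in> F \<Longrightarrow> inverse a \<in> F"
    and algebraic: "\<And>x. \<exists>p. p \<noteq> 0 \<and> (\<forall>i. coeff p i \<in> F) \<and> poly p x = 0"
    and char0: "\<And>n. n > 0 \<Longrightarrow> of_nat n \<noteq> (0 :: 'k)"
    and x: "x \<notin> F"
  shows "\<exists>\<sigma>. bij \<sigma> \<and> \<sigma> 1 = 1 \<and> (\<forall>a b. \<sigma> (a + b) = \<sigma> a + \<sigma> b \<and> \<sigma> (a * b) = \<sigma> a * \<sigma> b) \<and>
    (\<forall>a\<in>F. \<sigma> a = a) \<and> \<sigma> x \<noteq> x"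
proof -
  note pi = F algebraic
  have Id: "partial_iso F (Id_on F)"
    using F by (auto simp: partial_iso_def subring_of_def)
  have Idp: "paired_polys (Id_on F) f f' \<longleftrightarrow> f = f' \<and> (\<forall>i. coeff f i \<in> F)" for f f'
    by (auto simp: paired_polys_def poly_eq_iff Id_on_def)
  obtain f where f: "\<And>i. coeff f i \<in> F" "f \<noteq> 0" "poly f x = 0"
    and min: "\<And>g. (\<And>i. coeff g i \<in> F) \<Longrightarrow> g \<noteq> 0 \<Longrightarrow> poly g x = 0 \<Longrightarrow> degree f \<le> degree g"
    using minimal_paired_polys[OF pi Id, of x] by (auto simp: Idp)
  have deg0: "degree f \<noteq> 0"
  proof
    assume "degree f = 0"
    then obtain c where "f = [:c:]" by (rule degree_eq_zeroE)
    then show False using f by simp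
  qed
  have deg1: "degree f \<noteq> 1"
  proof
    assume "degree f = 1"
    then obtain a b where ab: "f = [:b, a:]" "a \<noteq> 0" using degree1_coeffs by blast
    then have "x = (0 - b) * inverse a" using f(3) by (simp add: field_simps add_eq_0_iff2)
    moreover have "b \<in> F" "a \<in> F" using f(1)[of 0] f(1)[of 1] ab by auto
    ultimately show False
      using x subring_of_mult[OF F subring_of_diff[OF F subring_of_zero[OF F]] inv] by blast
  qed
  have "pderiv f \<noteq> 0" "degree (pderiv f) < degree f"
  proof -
    have "coeff (pderiv f) (degree f - 1) = of_nat (degree f) * lead_coeff f"
      using deg0 by (simp add: coeff_pderiv del: of_nat_Suc)
    also have "\<dots> \<noteq> 0" using char0[of "degree f"] deg0 f(2) by simp
    finally show "pderiv f \<noteq> 0" by auto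
    show "degree (pderiv f) < degree f"
      using deg0 degree_le[of "degree f - 1" "pderiv f"] by (force simp: coeff_pderiv coeff_eq_0)
  qed
  moreover have "coeff (pderiv f) i \<in> F" for i
  proof -
    have "of_nat n \<in> F" for n
      by (induction n) (auto intro: subring_of_zero[OF F] subring_of_one[OF F] subring_of_add[OF F])
    then show ?thesis unfolding coeff_pderiv by (intro subring_of_mult[OF F] f)
  qed
  ultimately have px: "poly (pderiv f) x \<noteq> 0" using min[of "pderiv f"] by auto
  obtain q where q: "f = [:- x, 1:] * q" using f(3) by (metis dvdE poly_eq_0_iff_dvd)
  have "poly q x \<noteq> 0" using px by (simp add: q pderiv_mult pderiv_pCons del: mult_pCons_left)
  moreover have "degree q > 0"
  proof -
    have "q \<noteq> 0" using q f(2) by auto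
    then have "degree f = Suc (degree q)" unfolding q by (subst degree_mult_eq) auto
    then show ?thesis using deg1 by simp
  qed
  ultimately obtain x' where x': "poly q x' = 0" "x' \<noteq> x"
    using alg_closed_imp_poly_has_root by metis
  have fx': "poly f x' = 0" by (simp add: q x')
  have "\<exists>\<Gamma>'. partial_iso F \<Gamma>' \<and> Id_on F \<subseteq> \<Gamma>' \<and> (x, x') \<in> \<Gamma>'"
    by (rule partial_iso_extend[OF pi Id inv, of f f]) (use f min fx' in \<open>auto simp: Idp\<close>)
  then obtain \<Gamma>1 where \<Gamma>1: "partial_iso F \<Gamma>1" "(x, x') \<in> \<Gamma>1" by blast
  define \<S> where "\<S> = {\<Gamma>. partial_iso F \<Gamma> \<and> \<Gamma>1 \<subseteq> \<Gamma>}"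
  have "\<exists>M\<in>\<S>. \<forall>B\<in>\<S>. M \<subseteq> B \<longrightarrow> B = M"
  proof (rule subset_Zorn_nonempty)
    show "\<S> \<noteq> {}" using \<Gamma>1 by (auto simp: \<S>_def)
    fix \<C> assume ne: "\<C> \<noteq> {}" and ch: "subset.chain \<S> \<C>"
    have sub: "\<C> \<subseteq> \<S>" and tot: "\<And>B C. B \<in> \<C> \<Longrightarrow> C \<in> \<C> \<Longrightarrow> B \<subseteq> C \<or> C \<subseteq> B"
      using ch by (auto simp: subset_chain_def)
    have "partial_iso F (\<Union>\<C>)" unfolding partial_iso_def
    proof (intro conjI allI impI ballI)
      fix a assume "a \<in> F"
      then show "(a, a) \<in> \<Union>\<C>" using ne sub by (fastforce simp: \<S>_def partial_iso_def)
    next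
      fix b assume "(0, b) \<in> \<Union>\<C>"
      then show "b = 0" using sub by (auto simp: \<S>_def partial_iso_def)
    next
      fix a b c d assume "(a, b) \<in> \<Union>\<C>" "(c, d) \<in> \<Union>\<C>"
      then obtain B where B: "B \<in> \<C>" "(a, b) \<in> B" "(c, d) \<in> B" using tot by blast
      then have "partial_iso F B" using sub by (auto simp: \<S>_def)
      then have "(a + c, b + d) \<in> B" "(a - c, b - d) \<in> B" "(a * c, b * d) \<in> B"
        using B by (auto simp: partial_iso_def)
      then show "(a + c, b + d) \<in> \<Union>\<C>" "(a - c, b - d) \<in> \<Union>\<C>" "(a * c, b * d) \<in> \<Union>\<C>"
        using B by auto
    qed
    then show "\<Union>\<C> \<in> \<S>" using ne sub by (fastforce simp: \<S>_def)
  qed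
  then obtain \<Gamma> where \<Gamma>S: "\<Gamma> \<in> \<S>" and max: "\<And>B. B \<in> \<S> \<Longrightarrow> \<Gamma> \<subseteq> B \<Longrightarrow> B = \<Gamma>" by blast
  have \<Gamma>: "partial_iso F \<Gamma>" and sub: "\<Gamma>1 \<subseteq> \<Gamma>" using \<Gamma>S by (auto simp: \<S>_def)
  \<comment> \<open>A maximal partial isomorphism is defined everywhere: the image of a minimal
    polynomial of \<open>y\<close> keeps a nonzero coefficient in positive degree, so it has a root
    to which \<open>y\<close> can be sent.\<close>
  have total: "\<exists>b. (y, b) \<in> \<Gamma>" for y
  proof -
    obtain f f' where f: "paired_polys \<Gamma> f f'" "f \<noteq> 0" "poly f y = 0"
      and min: "\<And>g g'. paired_polys \<Gamma> g g' \<Longrightarrow> g \<noteq> 0 \<Longrightarrow> poly g y = 0 \<Longrightarrow> degree f \<le> degree g"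
      using minimal_paired_polys[OF pi \<Gamma>, of y] by blast
    have "degree f \<noteq> 0"
    proof
      assume "degree f = 0"
      then obtain c where "f = [:c:]" by (rule degree_eq_zeroE)
      then show False using f by simp
    qed
    moreover have "coeff f' (degree f) \<noteq> 0"
      using partial_iso_inverse(2)[OF pi \<Gamma> inv, of "lead_coeff f" "coeff f' (degree f)"] f(1,2)
      by (auto simp: paired_polys_def)
    ultimately have "degree f' > 0" by (metis coeff_eq_0 gr0I)
    then obtain y' where "poly f' y' = 0" using alg_closed_imp_poly_has_root by blast
    then have "\<exists>\<Gamma>'. partial_iso F \<Gamma>' \<and> \<Gamma> \<subseteq> \<Gamma>' \<and> (y, y') \<in> \<Gamma>'"
      using f min by (intro partial_iso_extend[OF pi \<Gamma> inv, of f f' y' y]) auto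
    then obtain \<Gamma>' where \<Gamma>': "partial_iso F \<Gamma>'" "\<Gamma> \<subseteq> \<Gamma>'" "(y, y') \<in> \<Gamma>'" by blast
    then have "\<Gamma>' = \<Gamma>" using sub by (intro max) (auto simp: \<S>_def)
    then show ?thesis using \<Gamma>' by blast
  qed
  define \<sigma> where "\<sigma> y = (SOME b. (y, b) \<in> \<Gamma>)" for y
  have \<sigma>: "(y, \<sigma> y) \<in> \<Gamma>" for y unfolding \<sigma>_def using total by (rule someI_ex)
  have \<sigma>I: "(y, b) \<in> \<Gamma> \<Longrightarrow> \<sigma> y = b" for y b
    by (rule partial_iso_unique[OF pi \<Gamma> \<sigma>])
  have add: "\<sigma> (a + b) = \<sigma> a + \<sigma> b" and mult: "\<sigma> (a * b) = \<sigma> a * \<sigma> b" for a b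
    by (auto intro!: \<sigma>I partial_iso_add[OF pi \<Gamma>] partial_iso_mult[OF pi \<Gamma>] \<sigma>)
  have fix_F: "\<sigma> a = a" if "a \<in> F" for a
    by (intro \<sigma>I partial_iso_base[OF pi \<Gamma>] that)
  have "inj \<sigma>"
  proof (rule injI)
    fix a b assume "\<sigma> a = \<sigma> b"
    then have "(a - b, 0) \<in> \<Gamma>" using partial_iso_diff[OF pi \<Gamma> \<sigma>[of a] \<sigma>[of b]] by simp
    then show "a = b" using partial_iso_inverse(2)[OF pi \<Gamma> inv, of "a - b" 0] by auto
  qed
  moreover have "surj \<sigma>"
    unfolding surj_def
  proof
    fix b
    obtain p where p: "p \<noteq> 0" "\<And>i. coeff p i \<in> F" "poly p b = 0" using algebraic by blast
    \<comment> \<open>\<open>\<sigma>\<close> maps the finite set of roots of \<open>p\<close>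
      injectively into itself, hence onto itself, and \<open>b\<close> is one of them.\<close>
    let ?S = "{a. poly p a = 0}"
    have "\<sigma> ` ?S \<subseteq> ?S"
    proof clarify
      fix a assume "poly p a = 0"
      moreover have "(poly p a, poly p (\<sigma> a)) \<in> \<Gamma>"
        by (intro partial_iso_poly[OF pi \<Gamma>] paired_polys_base[OF pi \<Gamma>] p \<sigma>)
      ultimately show "poly p (\<sigma> a) = 0" using partial_iso_zero[OF pi \<Gamma>] by simp
    qed
    then have "\<sigma> ` ?S = ?S"
      using \<open>inj \<sigma>\<close> poly_roots_finite[OF p(1)] by (intro endo_inj_surj) (auto intro: inj_on_subset)
    then show "\<exists>a. b = \<sigma> a" using p(3) by blast
  qed
  moreover have "\<sigma> x = x'" using \<Gamma>1 sub by (intro \<sigma>I) auto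
  ultimately show ?thesis
    using add mult fix_F x' subring_of_one[OF F] by (intro exI[of _ \<sigma>]) (auto simp: bij_def)
qed

section \<open>Invariant subspaces and traces\<close>

definition mtrace :: "'a::comm_ring_1 mat \<Rightarrow> 'a" where
  "mtrace A = (\<Sum>i<dim_row A. A $$ (i, i))"

lemma mult_mat_index:
  assumes "A \<in> carrier_mat n m" "B \<in> carrier_mat m l" "i < n" "j < l"
  shows "(A * B) $$ (i, j) = (\<Sum>k<m. A $$ (i, k) * B $$ (k, j))"
  using assms by (auto simp: scalar_prod_def lessThan_atLeast0 intro!: sum.cong)

lemma mult_mat_vec_index:
  assumes "A \<in> carrier_mat n m" "v \<in> carrier_vec m" "i < n"
  shows "(A *\<^sub>v v) $ i = (\<Sum>k<m. A $$ (i, k) * v $ k)"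
  using assms by (auto simp: scalar_prod_def lessThan_atLeast0 intro!: sum.cong)

lemma mtrace_mult_commute:
  assumes "A \<in> carrier_mat n m" "B \<in> carrier_mat m n"
  shows "mtrace (A * B) = mtrace (B * A)"
proof -
  have "mtrace (A * B) = (\<Sum>i<n. \<Sum>k<m. A $$ (i, k) * B $$ (k, i))"
    unfolding mtrace_def using assms by (auto intro!: sum.cong simp: mult_mat_index[OF assms] simp del: index_mult_mat(1))
  also have "\<dots> = (\<Sum>k<m. \<Sum>i<n. B $$ (k, i) * A $$ (i, k))"
    by (subst sum.swap) (simp add: mult.commute)
  also have "\<dots> = mtrace (B * A)"
    unfolding mtrace_def using assms by (auto intro!: sum.cong simp: mult_mat_index[OF assms(2,1)] simp del: index_mult_mat(1))
  finally show ?thesis .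
qed

lemma mtrace_conjugate:
  assumes "A \<in> carrier_mat n n" "P \<in> carrier_mat n n" "Q \<in> carrier_mat n n" "P * Q = 1\<^sub>m n"
  shows "mtrace (Q * A * P) = mtrace A"
proof -
  have "mtrace (Q * A * P) = mtrace (P * (Q * A))"
    using assms by (intro mtrace_mult_commute) auto
  also have "P * (Q * A) = (P * Q) * A" using assms by (intro assoc_mult_mat[symmetric]) auto
  finally show ?thesis using assms by simp
qed

lemma mtrace_four_block:
  assumes "A \<in> carrier_mat r r" "D \<in> carrier_mat s s"
  shows "mtrace (four_block_mat A B C D) = mtrace A + mtrace D"
proof -
  have "mtrace (four_block_mat A B C D) = (\<Sum>i<r. A $$ (i, i)) + (\<Sum>i=r..<r+s. D $$ (i - r, i - r))"
    unfolding mtrace_def lessThan_atLeast0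
    using assms sum.atLeastLessThan_concat[of 0 r "r + s" "\<lambda>i. four_block_mat A B C D $$ (i, i)"]
    by simp
  also have "(\<Sum>i=r..<r+s. D $$ (i - r, i - r)) = (\<Sum>i<s. D $$ (i, i))"
    by (rule sum.reindex_bij_witness[of _ "\<lambda>i. i + r" "\<lambda>i. i - r"]) auto
  finally show ?thesis using assms by (simp add: mtrace_def)
qed

lemma det_nonzero_inverse:
  assumes "P \<in> carrier_mat n n" "det P \<noteq> (0::'a::field)"
  obtains Q where "Q \<in> carrier_mat n n" "P * Q = 1\<^sub>m n" "Q * P = 1\<^sub>m n"
  using det_non_zero_imp_unit[OF assms, of "()"]
  by (auto simp: Units_def ring_mat_def)

definition vec_subspace :: "nat \<Rightarrow> 'a::field vec set \<Rightarrow> bool" where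
  "vec_subspace d W \<longleftrightarrow> W \<subseteq> carrier_vec d \<and> 0\<^sub>v d \<in> W \<and>
     (\<forall>v\<in>W. \<forall>w\<in>W. v + w \<in> W) \<and> (\<forall>c. \<forall>v\<in>W. c \<cdot>\<^sub>v v \<in> W)"

text \<open>An invertible \<open>P\<close> is chosen with as many leading columns in
  \<open>W\<close> as possible; \<open>r\<close> is that number, the dimension of \<open>W\<close>.
  A vector of \<open>W\<close> with a nonzero coordinate \<open>i \<ge> r\<close> could be exchanged
  for column \<open>i\<close> and moved to position \<open>r\<close>, contradicting
  maximality.\<close>

lemma adapted_basis:
  fixes W :: "'a::field vec set"
  assumes W: "vec_subspace d W"
  obtains P Q r where "P \<in> carrier_mat d d" "Q \<in> carrier_mat d d" "P * Q = 1\<^sub>m d" "Q * P = 1\<^sub>m d" "r \<le> d"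
    "\<And>j. j < r \<Longrightarrow> col P j \<in> W" "\<And>w i. w \<in> W \<Longrightarrow> r \<le> i \<Longrightarrow> i < d \<Longrightarrow> (Q *\<^sub>v w) $ i = 0"
proof -
  define Ok where "Ok r \<longleftrightarrow> r \<le> d \<and> (\<exists>P. P \<in> carrier_mat d d \<and> det P \<noteq> 0 \<and> (\<forall>j<r. col P j \<in> W))" for r
  have "Ok 0" by (auto simp: Ok_def intro!: exI[of _ "1\<^sub>m d"])
  define r where "r = Greatest Ok"
  have bound: "\<And>y. Ok y \<Longrightarrow> y \<le> d" by (auto simp: Ok_def)
  have r: "Ok r" unfolding r_def using \<open>Ok 0\<close> bound by (rule GreatestI_nat)
  have rmax: "s \<le> r" if "Ok s" for s unfolding r_def using that bound by (rule Greatest_le_nat)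
  from r obtain P where P: "P \<in> carrier_mat d d" "det P \<noteq> 0" "\<And>j. j < r \<Longrightarrow> col P j \<in> W" and rd: "r \<le> d"
    by (auto simp: Ok_def)
  from det_nonzero_inverse[OF P(1,2)] obtain Q where
    Q: "Q \<in> carrier_mat d d" "P * Q = 1\<^sub>m d" "Q * P = 1\<^sub>m d" by metis
  have "(Q *\<^sub>v w) $ i = 0" if w: "w \<in> W" "r \<le> i" "i < d" for w i
  proof (rule ccontr)
    assume nz: "(Q *\<^sub>v w) $ i \<noteq> 0"
    have wc: "w \<in> carrier_vec d" using W w by (auto simp: vec_subspace_def)
    have "P *\<^sub>v (Q *\<^sub>v w) = w"
      using P Q wc by (simp flip: assoc_mult_mat_vec)
    \<comment> \<open>By Cramer's rule the new determinant is \<open>det P\<close> times the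
      coordinate \<open>i\<close> of \<open>w\<close> in the basis of columns of
      \<open>P\<close>.\<close>
    then have det1: "det (replace_col P w i) \<noteq> 0"
      using cramer_lemma_mat[OF P(1), of "Q *\<^sub>v w" i] Q wc w nz P(2) by auto
    define P1 where "P1 = replace_col P w i"
    have P1: "P1 \<in> carrier_mat d d" using P by (auto simp: P1_def replace_col_def)
    have c1: "col P1 j = (if j = i then w else col P j)" if "j < d" for j
      using that P wc by (auto simp: P1_def replace_col_def intro!: eq_vecI)
    define P2 where "P2 = swapcols r i P1"
    have P2: "P2 \<in> carrier_mat d d" using P1 by (auto simp: P2_def mat_swapcols_def)
    have d2: "det P2 \<noteq> 0"
    proof (cases "r = i")
      case True
      then have "P2 = P1" using P1 by (auto simp: P2_def intro!: eq_matI)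
      then show ?thesis using det1 by (simp add: P1_def)
    next
      case False
      then show ?thesis using det_swapcols[of r d i P1] P1 w det1 by (auto simp: P2_def P1_def)
    qed
    have c2: "col P2 j = (if j = r then col P1 i else if j = i then col P1 r else col P1 j)" if "j < d" for j
      using that P1 w by (auto simp: P2_def intro!: eq_vecI)
    have "col P2 j \<in> W" if "j < Suc r" for j
      using that w P(3) c1[of i] c1[of j] c2[of j] by (cases "j = r") auto
    then have "Ok (Suc r)" using P2 d2 w by (auto simp: Ok_def)
    then show False using rmax by fastforce
  qed
  then show thesis using that P Q rd by blast
qed

text \<open>Stated for a family over an index set so that it covers both a single matrix, with index
  type \<open>unit\<close>, and a representation of a group. The columns of \<open>P\<close> are a
  basis adapted to \<open>W\<close>, which makes the lower left block vanish.\<close>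

lemma invariant_subspace_blocks:
  fixes \<rho> :: "'i \<Rightarrow> 'a::field mat"
  assumes W: "vec_subspace d W" "W \<noteq> {0\<^sub>v d}" "W \<noteq> carrier_vec d"
    and \<rho>: "\<And>i. i \<in> I \<Longrightarrow> \<rho> i \<in> carrier_mat d d"
    and inv: "\<And>i v. i \<in> I \<Longrightarrow> v \<in> W \<Longrightarrow> \<rho> i *\<^sub>v v \<in> W"
  obtains P Q r s A B D where
    "P \<in> carrier_mat d d" "Q \<in> carrier_mat d d" "P * Q = 1\<^sub>m d" "Q * P = 1\<^sub>m d"
    "d = r + s" "0 < r" "0 < s"
    "\<And>i. A i \<in> carrier_mat r r" "\<And>i. B i \<in> carrier_mat r s" "\<And>i. D i \<in> carrier_mat s s"
    "\<And>i. i \<in> I \<Longrightarrow> Q * \<rho> i * P = four_block_mat (A i) (B i) (0\<^sub>m s r) (D i)"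
proof -
  obtain P Q r where P: "P \<in> carrier_mat d d" and Q: "Q \<in> carrier_mat d d" and PQ: "P * Q = 1\<^sub>m d" and QP: "Q * P = 1\<^sub>m d"
    and rd: "r \<le> d"
    and cP: "\<And>j. j < r \<Longrightarrow> col P j \<in> W" and Qw: "\<And>w i. w \<in> W \<Longrightarrow> r \<le> i \<Longrightarrow> i < d \<Longrightarrow> (Q *\<^sub>v w) $ i = 0"
    using adapted_basis[OF W(1)] by metis
  define s where "s = d - r"
  have Wc: "W \<subseteq> carrier_vec d" using W(1) by (auto simp: vec_subspace_def)
  have PQw: "P *\<^sub>v (Q *\<^sub>v w) = w" if "w \<in> carrier_vec d" for w
    using P Q PQ that by (simp flip: assoc_mult_mat_vec)
  have "r \<noteq> 0"
  proof
    assume "r = 0"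
    have "w = 0\<^sub>v d" if "w \<in> W" for w
    proof -
      have "Q *\<^sub>v w = 0\<^sub>v d" using Qw[OF that] Q \<open>r = 0\<close> by (intro eq_vecI) auto
      then have "P *\<^sub>v 0\<^sub>v d = w" using PQw[of w] that Wc by auto
      then show ?thesis using P by auto
    qed
    then show False using W by (auto simp: vec_subspace_def)
  qed
  moreover have "r \<noteq> d"
  proof
    assume "r = d"
    have "v \<in> W" if v: "v \<in> carrier_vec d" for v
    proof -
      \<comment> \<open>The combination of the columns of \<open>P\<close> with coefficients
        \<open>Q *\<^sub>v v\<close> is built up one column at a time, since \<open>W\<close> is
        only known to be closed under sums of two vectors.\<close>
      have part: "(P *\<^sub>v vec d (\<lambda>i. if i < m then (Q *\<^sub>v v) $ i else 0)) \<in> W" if "m \<le> d" for m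
        using that
      proof (induction m)
        case 0
        have "P *\<^sub>v vec d (\<lambda>i. if i < 0 then (Q *\<^sub>v v) $ i else 0) = 0\<^sub>v d"
          using P by (intro eq_vecI) (auto simp: scalar_prod_def)
        then show ?case using W(1) by (simp add: vec_subspace_def)
      next
        case (Suc m)
        let ?u = "\<lambda>m. vec d (\<lambda>i. if i < m then (Q *\<^sub>v v) $ i else 0)"
        have "P *\<^sub>v ?u (Suc m) = P *\<^sub>v ?u m + ((Q *\<^sub>v v) $ m) \<cdot>\<^sub>v col P m"
        proof (rule eq_vecI)
          fix i assume "i < dim_vec (P *\<^sub>v ?u m + ((Q *\<^sub>v v) $ m) \<cdot>\<^sub>v col P m)"
          then have i: "i < d" using P by simp
          have "(P *\<^sub>v ?u (Suc m)) $ i = (\<Sum>k<d. P $$ (i, k) * (if k < Suc m then (Q *\<^sub>v v) $ k else 0))"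
            using i P by (subst mult_mat_vec_index[of _ d d]) auto
          also have "\<dots> = (\<Sum>k<d. P $$ (i, k) * (if k < m then (Q *\<^sub>v v) $ k else 0) +
              (if k = m then P $$ (i, k) * (Q *\<^sub>v v) $ k else 0))"
            by (intro sum.cong) auto
          also have "\<dots> = (P *\<^sub>v ?u m) $ i + P $$ (i, m) * (Q *\<^sub>v v) $ m"
            using Suc.prems i P by (subst mult_mat_vec_index[of _ d d]) (auto simp: sum.distrib)
          finally show "(P *\<^sub>v ?u (Suc m)) $ i = (P *\<^sub>v ?u m + ((Q *\<^sub>v v) $ m) \<cdot>\<^sub>v col P m) $ i"
            using i P Suc.prems by (simp add: mult.commute)
        qed (use P in auto)
        moreover have "((Q *\<^sub>v v) $ m) \<cdot>\<^sub>v col P m \<in> W"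
          using cP[of m] Suc.prems \<open>r = d\<close> W(1) by (auto simp: vec_subspace_def)
        ultimately show ?case using Suc W(1) by (auto simp: vec_subspace_def)
      qed
      have "vec d (\<lambda>i. if i < d then (Q *\<^sub>v v) $ i else 0) = Q *\<^sub>v v" using Q by auto
      then show ?thesis using part[of d] PQw[OF v] by simp
    qed
    then show False using W Wc by auto
  qed
  ultimately have rs: "d = r + s" "0 < r" "0 < s" using rd by (auto simp: s_def)
  define A where "A i = mat r r (\<lambda>(a, b). (Q * \<rho> i * P) $$ (a, b))" for i
  define B where "B i = mat r s (\<lambda>(a, b). (Q * \<rho> i * P) $$ (a, b + r))" for i
  define D where "D i = mat s s (\<lambda>(a, b). (Q * \<rho> i * P) $$ (a + r, b + r))" for i
  have "Q * \<rho> i * P = four_block_mat (A i) (B i) (0\<^sub>m s r) (D i)" if i: "i \<in> I" for i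
  proof (rule eq_matI)
    fix a b assume "a < dim_row (four_block_mat (A i) (B i) (0\<^sub>m s r) (D i))"
      "b < dim_col (four_block_mat (A i) (B i) (0\<^sub>m s r) (D i))"
    then have ab: "a < d" "b < d" by (auto simp: A_def D_def rs)
    have zero: "(Q * \<rho> i * P) $$ (a, b) = 0" if "r \<le> a" "b < r"
    proof -
      have "(Q * \<rho> i * P) $$ (a, b) = (Q *\<^sub>v (\<rho> i *\<^sub>v col P b)) $ a"
      proof -
        have "Q * \<rho> i * P = Q * (\<rho> i * P)" using P Q \<rho>[OF i] by (simp add: assoc_mult_mat)
        then have "(Q * \<rho> i * P) $$ (a, b) = col (Q * (\<rho> i * P)) b $ a" using ab P Q \<rho>[OF i] by auto
        also have "col (Q * (\<rho> i * P)) b = Q *\<^sub>v (\<rho> i *\<^sub>v col P b)"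
          using ab P Q \<rho>[OF i] by (subst col_mult2[of _ d d _ d], auto)+
        finally show ?thesis .
      qed
      also have "\<dots> = 0" using that ab cP inv[OF i] by (intro Qw) auto
      finally show ?thesis .
    qed
    show "(Q * \<rho> i * P) $$ (a, b) = four_block_mat (A i) (B i) (0\<^sub>m s r) (D i) $$ (a, b)"
      using ab zero rs(1) by (auto simp: A_def B_def D_def simp del: index_mult_mat)
  qed (use P Q rs in \<open>auto simp: A_def D_def\<close>)
  moreover have "A i \<in> carrier_mat r r" "B i \<in> carrier_mat r s" "D i \<in> carrier_mat s s" for i
    by (auto simp: A_def B_def D_def)
  ultimately show thesis using that[OF P Q PQ QP rs, of A B D] by blast
qed

lemma char_poly_block_triangular:
  fixes A :: "'a::field mat"
  assumes "A \<in> carrier_mat r r" "B \<in> carrier_mat r s" "D \<in> carrier_mat s s"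
  shows "char_poly (four_block_mat A B (0\<^sub>m s r) D) = char_poly A * char_poly D"
proof -
  have "char_poly_matrix (four_block_mat A B (0\<^sub>m s r) D) =
    four_block_mat (char_poly_matrix A) (map_mat (\<lambda>a. [:- a:]) B) (0\<^sub>m s r) (char_poly_matrix D)"
    using assms by (intro eq_matI) (auto simp: char_poly_matrix_def)
  then show ?thesis unfolding char_poly_def using assms
    by (simp add: det_four_block_mat_lower_left_zero[of _ r _ s])
qed

text \<open>The trace is a sum of eigenvalues. The induction splits off the eigenspace of some
  \<open>e\<close>: if it is the whole space, then all diagonal entries are \<open>e\<close>;
  otherwise \<open>A\<close> is similar to a block triangular matrix whose diagonal blocks have no
  new eigenvalues.\<close>

lemma mtrace_mem_subring:
  fixes A :: "'a::alg_closed_field mat"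
  assumes S: "subring_of S"
  shows "A \<in> carrier_mat d d \<Longrightarrow> (\<And>e. eigenvalue A e \<Longrightarrow> e \<in> S) \<Longrightarrow> mtrace A \<in> S"
proof (induction d arbitrary: A rule: less_induct)
  case (less d)
  note A = less.prems(1)
  show ?case
  proof (cases "d = 0")
    case True
    then show ?thesis using A subring_of_zero[OF S] by (simp add: mtrace_def)
  next
    case False
    then obtain e where e: "poly (char_poly A) e = 0"
      using degree_monic_char_poly[OF A] alg_closed_imp_poly_has_root[of "char_poly A"] by auto
    then have ev: "eigenvalue A e" using eigenvalue_root_char_poly[OF A] by simp
    define W where "W = {v \<in> carrier_vec d. A *\<^sub>v v = e \<cdot>\<^sub>v v}"
    have W: "vec_subspace d W" unfolding vec_subspace_def W_def
      using A by (auto simp: mult_add_distrib_mat_vec[OF A] smult_add_distrib_vec mult_mat_vec[OF A]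
          smult_smult_assoc mult.commute)
    obtain v where "v \<in> carrier_vec d" "v \<noteq> 0\<^sub>v d" "A *\<^sub>v v = e \<cdot>\<^sub>v v"
      using ev A unfolding eigenvalue_def eigenvector_def by auto
    then have "v \<in> W" "v \<noteq> 0\<^sub>v d" by (simp_all add: W_def)
    then have W0: "W \<noteq> {0\<^sub>v d}" by blast
    show ?thesis
    proof (cases "W = carrier_vec d")
      case True
      have "A $$ (i, i) = e" if "i < d" for i
      proof -
        have "unit_vec d i \<in> W" unfolding True by simp
        then have "A *\<^sub>v unit_vec d i = e \<cdot>\<^sub>v unit_vec d i" by (simp add: W_def)
        from arg_cong[OF this, of "\<lambda>v. vec_index v i"] show ?thesis using that A by auto
      qed
      then show ?thesis unfolding mtrace_def using A less.prems(2)[OF ev] by (intro subring_of_sum[OF S]) auto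
    next
      case False
      have inv: "A *\<^sub>v v \<in> W" if "v \<in> W" for v
        using that A by (auto simp: W_def mult_mat_vec[OF A])
      obtain P Q r s AA BB DD where PQ: "P \<in> carrier_mat d d" "Q \<in> carrier_mat d d" "P * Q = 1\<^sub>m d" "Q * P = 1\<^sub>m d"
        and rs: "d = r + s" "0 < r" "0 < s"
        and bl0: "\<And>i :: unit. AA i \<in> carrier_mat r r" "\<And>i :: unit. BB i \<in> carrier_mat r s"
          "\<And>i :: unit. DD i \<in> carrier_mat s s"
        and eq0: "\<And>i :: unit. i \<in> UNIV \<Longrightarrow> Q * A * P = four_block_mat (AA i) (BB i) (0\<^sub>m s r) (DD i)"
        by (rule invariant_subspace_blocks[OF W W0 False, of "UNIV :: unit set" "\<lambda>_. A"]) (rule A, erule inv, rule that)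
      define A' B D where "A' = AA ()" and "B = BB ()" and "D = DD ()"
      have bl: "A' \<in> carrier_mat r r" "B \<in> carrier_mat r s" "D \<in> carrier_mat s s"
        and eq: "Q * A * P = four_block_mat A' B (0\<^sub>m s r) D"
        using bl0 eq0 by (simp_all add: A'_def B_def D_def)
      have "similar_mat (Q * A * P) A"
        unfolding similar_mat_def
        by (rule exI[of _ Q], rule exI[of _ P]) (use PQ A in \<open>auto simp: similar_mat_wit_def Let_def\<close>)
      then have cp: "char_poly A = char_poly A' * char_poly D"
        using char_poly_similar char_poly_block_triangular[OF bl] eq by metis
      have "mtrace A' \<in> S" "mtrace D \<in> S"
        using less.prems(2) cp rs
        by (auto intro!: less.IH[OF _ bl(1)] less.IH[OF _ bl(3)] simp: eigenvalue_root_char_poly[OF A]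
            eigenvalue_root_char_poly[OF bl(1)] eigenvalue_root_char_poly[OF bl(3)])
      moreover have "mtrace A = mtrace A' + mtrace D"
        using mtrace_conjugate[OF A PQ(1,2,3)] mtrace_four_block[OF bl(1,3)] eq by metis
      ultimately show ?thesis using subring_of_add[OF S] by simp
    qed
  qed
qed

section \<open>Representations of finite groups\<close>

lemma is_repD:
  assumes "is_rep G d \<rho>"
  shows "g \<in> carrier G \<Longrightarrow> \<rho> g \<in> carrier_mat d d" "\<rho> \<one>\<^bsub>G\<^esub> = 1\<^sub>m d"
    "g \<in> carrier G \<Longrightarrow> h \<in> carrier G \<Longrightarrow> \<rho> (g \<otimes>\<^bsub>G\<^esub> h) = \<rho> g * \<rho> h"
  using assms by (auto simp: is_rep_def)

lemma is_irrep_iff: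
  "is_irrep G d \<rho> \<longleftrightarrow> is_rep G d \<rho> \<and> d > 0 \<and>
    (\<forall>W. vec_subspace d W \<longrightarrow> (\<forall>g\<in>carrier G. \<forall>v\<in>W. \<rho> g *\<^sub>v v \<in> W) \<longrightarrow> W = {0\<^sub>v d} \<or> W = carrier_vec d)"
  unfolding is_irrep_def vec_subspace_def by blast

lemma is_irrepD:
  assumes "is_irrep G d \<rho>"
  shows "is_rep G d \<rho>" "d > 0"
    "vec_subspace d W \<Longrightarrow> (\<And>g v. g \<in> carrier G \<Longrightarrow> v \<in> W \<Longrightarrow> \<rho> g *\<^sub>v v \<in> W) \<Longrightarrow> W = {0\<^sub>v d} \<or> W = carrier_vec d"
  using assms unfolding is_irrep_iff by blast+

lemma four_block_mat_inject:
  assumes "A \<in> carrier_mat r r" "D \<in> carrier_mat s s" "A' \<in> carrier_mat r r" "D' \<in> carrier_mat s s"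
    and eq: "four_block_mat A B C D = four_block_mat A' B' C' D'"
  shows "A = A'" "D = D'"
proof -
  show "A = A'"
  proof (rule eq_matI)
    fix i j assume "i < dim_row A'" "j < dim_col A'"
    then show "A $$ (i, j) = A' $$ (i, j)"
      using assms(1-4) arg_cong[OF eq, of "\<lambda>M. M $$ (i, j)"] by simp
  qed (use assms in auto)
  show "D = D'"
  proof (rule eq_matI)
    fix i j assume "i < dim_row D'" "j < dim_col D'"
    then show "D $$ (i, j) = D' $$ (i, j)"
      using assms(1-4) arg_cong[OF eq, of "\<lambda>M. M $$ (i + r, j + r)"] by simp
  qed (use assms in auto)
qed

text \<open>Only traces are kept, so a subrepresentation and its quotient may replace
  \<open>\<rho>\<close>: conjugation makes \<open>\<rho>\<close> block triangular, and the
  off-diagonal block does not affect the trace.\<close>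

lemma (in monoid) rep_composition_factors:
  fixes \<rho> :: "'a \<Rightarrow> 'k::field mat"
  shows "is_rep G d \<rho> \<Longrightarrow> \<exists>L. (\<forall>(e, \<tau>)\<in>set L. is_irrep G e \<tau>) \<and>
    (\<forall>g\<in>carrier G. mtrace (\<rho> g) = (\<Sum>(e, \<tau>)\<leftarrow>L. mtrace (\<tau> g)))"
proof (induction d arbitrary: \<rho> rule: less_induct)
  case (less d)
  note \<rho> = is_repD[OF less.prems]
  show ?case
  proof (cases "d = 0 \<or> is_irrep G d \<rho>")
    case True
    then show ?thesis
    proof
      assume "d = 0"
      then show ?thesis using carrier_matD(1)[OF \<rho>(1)] by (intro exI[of _ "[]"]) (auto simp: mtrace_def)
    next
      assume "is_irrep G d \<rho>"
      then show ?thesis by (intro exI[of _ "[(d, \<rho>)]"]) auto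
    qed
  next
    case False
    then obtain W where W: "vec_subspace d W" "W \<noteq> {0\<^sub>v d}" "W \<noteq> carrier_vec d"
      and inv: "\<And>g v. g \<in> carrier G \<Longrightarrow> v \<in> W \<Longrightarrow> \<rho> g *\<^sub>v v \<in> W"
      using less.prems unfolding is_irrep_iff by auto
    obtain P Q r s A B D where P: "P \<in> carrier_mat d d" and Q: "Q \<in> carrier_mat d d"
      and PQ: "P * Q = 1\<^sub>m d" and QP: "Q * P = 1\<^sub>m d"
      and rs: "d = r + s" "0 < r" "0 < s"
      and bl: "\<And>g. A g \<in> carrier_mat r r" "\<And>g. B g \<in> carrier_mat r s" "\<And>g. D g \<in> carrier_mat s s"
      and eq: "\<And>g. g \<in> carrier G \<Longrightarrow> Q * \<rho> g * P = four_block_mat (A g) (B g) (0\<^sub>m s r) (D g)"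
      by (rule invariant_subspace_blocks[OF W, of "carrier G" \<rho>]) (erule \<rho>(1), erule (1) inv, rule that)
    have "four_block_mat (A \<one>) (B \<one>) (0\<^sub>m s r) (D \<one>) = four_block_mat (1\<^sub>m r) (0\<^sub>m r s) (0\<^sub>m s r) (1\<^sub>m s)"
      using eq[OF one_closed] P Q QP \<rho>(2) rs by simp
    from four_block_mat_inject[OF bl(1) bl(3) _ _ this]
    have 1: "A \<one> = 1\<^sub>m r" "D \<one> = 1\<^sub>m s" by auto
    have 2: "A (g \<otimes> h) = A g * A h" "D (g \<otimes> h) = D g * D h" if gh: "g \<in> carrier G" "h \<in> carrier G" for g h
    proof -
      have c: "\<rho> g \<in> carrier_mat d d" "\<rho> h \<in> carrier_mat d d" using \<rho>(1) gh by auto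
      have "Q * \<rho> (g \<otimes> h) * P = Q * \<rho> g * (P * Q) * \<rho> h * P"
        using c P Q PQ gh \<rho>(3) by (simp add: assoc_mult_mat[of _ d d _ d _ d])
      also have "\<dots> = (Q * \<rho> g * P) * (Q * \<rho> h * P)"
        using c P Q by (simp add: assoc_mult_mat[of _ d d _ d _ d])
      finally have "four_block_mat (A (g \<otimes> h)) (B (g \<otimes> h)) (0\<^sub>m s r) (D (g \<otimes> h)) =
        four_block_mat (A g * A h) (A g * B h + B g * D h) (0\<^sub>m s r) (D g * D h)"
        unfolding eq[OF gh(1)] eq[OF gh(2)] eq[OF m_closed[OF gh]]
        using bl right_mult_zero_mat[OF bl(2), of g r] right_mult_zero_mat[OF bl(3), of g r]
          left_mult_zero_mat[OF bl(1), of s h] left_mult_zero_mat[OF bl(2), of s h]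
          right_add_zero_mat[OF mult_carrier_mat[OF bl(1) bl(1)], of g h]
          left_add_zero_mat[OF mult_carrier_mat[OF bl(3) bl(3)], of g h]
        by (subst (asm) mult_four_block_mat[of _ r r _ s _ s _ _ r _ s]) auto
      from four_block_mat_inject[OF bl(1) bl(3) mult_carrier_mat[OF bl(1) bl(1)] mult_carrier_mat[OF bl(3) bl(3)] this]
      show "A (g \<otimes> h) = A g * A h" "D (g \<otimes> h) = D g * D h" .
    qed
    have "is_rep G r A" "is_rep G s D" using 1 2 bl by (auto simp: is_rep_def)
    then obtain L L' where L: "\<forall>(e, \<tau>)\<in>set L. is_irrep G e \<tau>" "\<forall>(e, \<tau>)\<in>set L'. is_irrep G e \<tau>"
      "\<And>g. g \<in> carrier G \<Longrightarrow> mtrace (A g) = (\<Sum>(e, \<tau>)\<leftarrow>L. mtrace (\<tau> g))"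
      "\<And>g. g \<in> carrier G \<Longrightarrow> mtrace (D g) = (\<Sum>(e, \<tau>)\<leftarrow>L'. mtrace (\<tau> g))"
      using less.IH[of r A] less.IH[of s D] rs by auto
    have "mtrace (\<rho> g) = mtrace (A g) + mtrace (D g)" if g: "g \<in> carrier G" for g
      using mtrace_conjugate[OF \<rho>(1)[OF g] P Q PQ] mtrace_four_block[OF bl(1,3)] eq[OF g] by metis
    then show ?thesis using L by (intro exI[of _ "L @ L'"]) auto
  qed
qed

section \<open>Schur's lemma and the regular representation\<close>

definition rep_iso :: "('g, 'b) monoid_scheme \<Rightarrow> nat \<Rightarrow> ('g \<Rightarrow> 'k::field mat) \<Rightarrow> nat \<Rightarrow> ('g \<Rightarrow> 'k mat) \<Rightarrow> bool" where
  "rep_iso G d \<rho> e \<tau> \<longleftrightarrow> d = e \<and>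
    (\<exists>T\<in>carrier_mat d d. det T \<noteq> 0 \<and> (\<forall>g\<in>carrier G. \<rho> g * T = T * \<tau> g))"

text \<open>Kernel and image of \<open>T\<close> are invariant, so \<open>T\<close> is bijective. A
  two-sided inverse \<open>S\<close> is assembled from preimages of unit vectors, and
  \<open>d = e\<close> follows by comparing the traces of \<open>T * S\<close> and
  \<open>S * T\<close>, which determine the dimensions in characteristic 0.\<close>

lemma schur:
  fixes \<rho> \<tau> :: "'g \<Rightarrow> 'k::field mat"
  assumes char0: "\<And>n. n > 0 \<Longrightarrow> of_nat n \<noteq> (0 :: 'k)"
    and \<rho>: "is_irrep G d \<rho>" and \<tau>: "is_irrep G e \<tau>"
    and T: "T \<in> carrier_mat d e" "T \<noteq> 0\<^sub>m d e"
    and comm: "\<And>g. g \<in> carrier G \<Longrightarrow> \<rho> g * T = T * \<tau> g"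
  shows "rep_iso G d \<rho> e \<tau>"
proof -
  note \<rho>c = is_repD(1)[OF is_irrepD(1)[OF \<rho>]] and \<tau>c = is_repD(1)[OF is_irrepD(1)[OF \<tau>]]
  have commv: "\<rho> g *\<^sub>v (T *\<^sub>v v) = T *\<^sub>v (\<tau> g *\<^sub>v v)" if "g \<in> carrier G" "v \<in> carrier_vec e" for g v
    using T(1) \<rho>c[OF that(1)] \<tau>c[OF that(1)] that comm[OF that(1)]
    by (simp flip: assoc_mult_mat_vec)
  define K where "K = {v \<in> carrier_vec e. T *\<^sub>v v = 0\<^sub>v d}"
  define M where "M = (\<lambda>v. T *\<^sub>v v) ` carrier_vec e"
  have Tcol: "T *\<^sub>v unit_vec e j = col T j" if "j < e" for j
    using T(1) that by (intro eq_vecI) auto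
  have "K = {0\<^sub>v e} \<or> K = carrier_vec e"
  proof (rule is_irrepD(3)[OF \<tau>])
    show "vec_subspace e K" unfolding vec_subspace_def K_def using T(1)
      by (auto simp: mult_add_distrib_mat_vec[OF T(1)] mult_mat_vec[OF T(1)])
    fix g v assume g: "g \<in> carrier G" and v: "v \<in> K"
    have "T *\<^sub>v (\<tau> g *\<^sub>v v) = \<rho> g *\<^sub>v 0\<^sub>v d" using commv[OF g, of v, symmetric] v by (simp add: K_def)
    also have "\<dots> = 0\<^sub>v d" using \<rho>c[OF g] by (intro eq_vecI) auto
    finally show "\<tau> g *\<^sub>v v \<in> K" using \<tau>c[OF g] v by (auto simp: K_def)
  qed
  moreover have "K \<noteq> carrier_vec e"
  proof
    assume *: "K = carrier_vec e"
    have "T = 0\<^sub>m d e"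
    proof (rule eq_matI)
      fix i j assume ij: "i < dim_row (0\<^sub>m d e :: 'k mat)" "j < dim_col (0\<^sub>m d e :: 'k mat)"
      have "unit_vec e j \<in> K" using * by simp
      then have "col T j = 0\<^sub>v d" using Tcol[of j] ij by (simp add: K_def)
      then show "T $$ (i, j) = 0\<^sub>m d e $$ (i, j)" using ij T(1) by (metis carrier_matD index_col index_zero_mat index_zero_vec(1))
    qed (use T in auto)
    then show False using T by simp
  qed
  ultimately have ker: "K = {0\<^sub>v e}" by blast
  have "M = {0\<^sub>v d} \<or> M = carrier_vec d"
  proof (rule is_irrepD(3)[OF \<rho>])
    show "vec_subspace d M" unfolding vec_subspace_def
    proof (intro conjI ballI allI)
      show "M \<subseteq> carrier_vec d" using T(1) by (auto simp: M_def)
      have "T *\<^sub>v 0\<^sub>v e = 0\<^sub>v d" using T(1) by (intro eq_vecI) auto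
      then show "0\<^sub>v d \<in> M" unfolding M_def by (metis image_eqI zero_carrier_vec)
    next
      fix v w assume "v \<in> M" "w \<in> M"
      then obtain v' w' where "v = T *\<^sub>v v'" "w = T *\<^sub>v w'" "v' \<in> carrier_vec e" "w' \<in> carrier_vec e" by (auto simp: M_def)
      then show "v + w \<in> M" using mult_add_distrib_mat_vec[OF T(1)] unfolding M_def
        by (metis add_carrier_vec image_eqI)
    next
      fix c v assume "v \<in> M"
      then obtain v' where "v = T *\<^sub>v v'" "v' \<in> carrier_vec e" by (auto simp: M_def)
      then show "c \<cdot>\<^sub>v v \<in> M" using mult_mat_vec[OF T(1)] unfolding M_def
        by (metis smult_carrier_vec image_eqI)
    qed
    fix g v assume g: "g \<in> carrier G" and "v \<in> M"
    then obtain v' where v': "v = T *\<^sub>v v'" "v' \<in> carrier_vec e" by (auto simp: M_def)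
    then show "\<rho> g *\<^sub>v v \<in> M" using commv[OF g v'(2)] \<tau>c[OF g] unfolding M_def
      by (metis mult_mat_vec_carrier image_eqI)
  qed
  moreover have "M \<noteq> {0\<^sub>v d}"
  proof
    assume "M = {0\<^sub>v d}"
    then have "K = carrier_vec e" by (auto simp: K_def M_def)
    then show False using ker is_irrepD(2)[OF \<tau>]
      by (metis index_unit_vec(2) index_zero_vec(1) one_neq_zero singletonD unit_vec_carrier)
  qed
  ultimately have im: "M = carrier_vec d" by blast
  have "\<exists>u. \<forall>i<d. u i \<in> carrier_vec e \<and> T *\<^sub>v u i = unit_vec d i"
  proof -
    have "\<exists>u. u \<in> carrier_vec e \<and> T *\<^sub>v u = unit_vec d i" for i
    proof -
      have "unit_vec d i \<in> M" by (simp add: im)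
      then show ?thesis by (auto simp: M_def)
    qed
    then show ?thesis by metis
  qed
  then obtain u where u: "\<And>i. i < d \<Longrightarrow> u i \<in> carrier_vec e" "\<And>i. i < d \<Longrightarrow> T *\<^sub>v u i = unit_vec d i" by blast
  define S where "S = mat e d (\<lambda>(a, b). u b $ a)"
  have S: "S \<in> carrier_mat e d" by (simp add: S_def)
  have colS: "col S j = u j" if "j < d" for j using that u(1)[OF that] by (intro eq_vecI) (auto simp: S_def)
  have TS: "T * S = 1\<^sub>m d"
  proof (rule eq_matI)
    fix i j assume ij: "i < dim_row (1\<^sub>m d :: 'k mat)" "j < dim_col (1\<^sub>m d :: 'k mat)"
    then have "(T * S) $$ (i, j) = col (T * S) j $ i" using T S by auto
    also have "col (T * S) j = unit_vec d j" using ij T S col_mult2[OF T(1) S] colS u by simp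
    finally show "(T * S) $$ (i, j) = 1\<^sub>m d $$ (i, j)" using ij by auto
  qed (use T S in auto)
  have ST: "S * T = 1\<^sub>m e"
  proof (rule eq_matI)
    fix i j assume ij: "i < dim_row (1\<^sub>m e :: 'k mat)" "j < dim_col (1\<^sub>m e :: 'k mat)"
    let ?v = "unit_vec e j :: 'k vec"
    let ?w = "(S * T) *\<^sub>v ?v"
    have w: "?w \<in> carrier_vec e" using S T by auto
    have "T *\<^sub>v ?w = (T * S) *\<^sub>v (T *\<^sub>v ?v)" using S T by (simp add: assoc_mult_mat_vec[of _ _ e] assoc_mult_mat_vec[of _ _ d])
    also have "\<dots> = T *\<^sub>v ?v" using T(1) by (simp add: TS)
    finally have Tw: "T *\<^sub>v ?w = T *\<^sub>v ?v" .
    have "T *\<^sub>v (?w - ?v) = 0\<^sub>v d"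
    proof -
      have "T *\<^sub>v (?w - ?v) = T *\<^sub>v ?w - T *\<^sub>v ?v" using T(1) w by (intro mult_minus_distrib_mat_vec) auto
      then show ?thesis using Tw T(1) by simp
    qed
    then have "?w - ?v \<in> K" using w by (auto simp: K_def)
    then have z: "?w - ?v = 0\<^sub>v e" using ker by auto
    have "?w $ i = ?v $ i" using arg_cong[OF z, of "\<lambda>x. vec_index x i"] ij w by simp
    moreover have "?w $ i = (S * T) $$ (i, j)" using ij S T by (auto simp: mult_mat_vec_def)
    ultimately show "(S * T) $$ (i, j) = 1\<^sub>m e $$ (i, j)" using ij by auto
  qed (use T S in auto)
  have "of_nat d = (of_nat e :: 'k)"
    using mtrace_mult_commute[OF T(1) S] by (simp add: TS ST mtrace_def)
  then have de: "d = e"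
  proof -
    have "x = y" if "x \<le> y" "of_nat x = (of_nat y :: 'k)" for x y :: nat
    proof (rule ccontr)
      assume "x \<noteq> y"
      then have "y - x > 0" using that by simp
      moreover have "of_nat (y - x) = (0 :: 'k)" using that by (simp add: of_nat_diff)
      ultimately show False using char0 by blast
    qed
    then show ?thesis using \<open>of_nat d = (of_nat e :: 'k)\<close> by (cases "d \<le> e") (auto, metis nat_le_linear)
  qed
  have "det T * det S = 1" using det_mult[of T d S] T S TS de by simp
  then have "det T \<noteq> 0" by auto
  then show ?thesis using T comm de by (auto simp: rep_iso_def)
qed

text \<open>Like \<open>rep_ext\<close>, but with coefficients in the field of the representation,
  so that elements of \<open>k[G]\<close> outside \<open>F[G]\<close> can act.\<close>

definition alg_act :: "('g, 'b) monoid_scheme \<Rightarrow> nat \<Rightarrow> ('g \<Rightarrow> 'k::field mat) \<Rightarrow> ('g \<Rightarrow> 'k) \<Rightarrow> 'k mat" where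
  "alg_act G d \<rho> a = mat d d (\<lambda>(r, s). \<Sum>g\<in>carrier G. a g * \<rho> g $$ (r, s))"

lemma alg_act_carrier [simp]: "alg_act G d \<rho> a \<in> carrier_mat d d"
  by (simp add: alg_act_def)

lemma alg_act_index: "i < d \<Longrightarrow> j < d \<Longrightarrow> alg_act G d \<rho> a $$ (i, j) = (\<Sum>g\<in>carrier G. a g * \<rho> g $$ (i, j))"
  by (simp add: alg_act_def)

lemma (in monoid) mtrace_alg_act_mult:
  assumes \<rho>: "is_rep G d \<rho>" and x: "x \<in> carrier G"
  shows "mtrace (alg_act G d \<rho> v * \<rho> x) = (\<Sum>h\<in>carrier G. v h * mtrace (\<rho> (h \<otimes> x)))"
proof -
  note c = is_repD(1)[OF \<rho>]
  have "mtrace (alg_act G d \<rho> v * \<rho> x) = (\<Sum>i<d. \<Sum>k<d. (\<Sum>h\<in>carrier G. v h * \<rho> h $$ (i, k)) * \<rho> x $$ (k, i))"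
    unfolding mtrace_def using c[OF x]
    by (intro sum.cong) (auto simp: mult_mat_index[OF alg_act_carrier c[OF x]] alg_act_index carrier_matD[OF alg_act_carrier] simp del: index_mult_mat(1))
  also have "\<dots> = (\<Sum>h\<in>carrier G. \<Sum>i<d. \<Sum>k<d. v h * (\<rho> h $$ (i, k) * \<rho> x $$ (k, i)))"
    by (simp add: sum_distrib_right mult.assoc sum.swap[of _ "{..<d}" "carrier G"])
  also have "\<dots> = (\<Sum>h\<in>carrier G. v h * mtrace (\<rho> (h \<otimes> x)))"
  proof (intro sum.cong refl)
    fix h assume h: "h \<in> carrier G"
    have "mtrace (\<rho> (h \<otimes> x)) = (\<Sum>i<d. \<Sum>k<d. \<rho> h $$ (i, k) * \<rho> x $$ (k, i))"
      unfolding mtrace_def is_repD(3)[OF \<rho> h x] using c[OF h] c[OF x]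
      by (auto intro!: sum.cong simp: mult_mat_index[OF c[OF h] c[OF x]] simp del: index_mult_mat(1))
    then show "(\<Sum>i<d. \<Sum>k<d. v h * (\<rho> h $$ (i, k) * \<rho> x $$ (k, i))) = v h * mtrace (\<rho> (h \<otimes> x))"
      by (simp add: sum_distrib_left)
  qed
  finally show ?thesis .
qed

lemma (in group) sum_translate:
  assumes "h \<in> carrier G"
  shows "(\<Sum>g\<in>carrier G. f (h \<otimes> g)) = (\<Sum>g\<in>carrier G. f g)"
  using assms
  by (intro sum.reindex_bij_witness[of _ "\<lambda>g. inv h \<otimes> g" "\<lambda>g. h \<otimes> g"]) (auto simp: m_assoc[symmetric])

text \<open>\<open>T\<close> is the sum over \<open>g\<close> of
  \<open>\<rho> g * E * \<tau> (inv g)\<close>, where \<open>E\<close> is the matrix unit at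
  position \<open>(b, c)\<close>. A group sum of this shape intertwines \<open>\<rho>\<close> and
  \<open>\<tau>\<close>, so \<open>schur\<close> forces it to vanish.\<close>

lemma (in group) schur_orthogonality:
  fixes \<rho> \<tau> :: "'a \<Rightarrow> 'k::field mat"
  assumes char0: "\<And>n. n > 0 \<Longrightarrow> of_nat n \<noteq> (0 :: 'k)"
    and \<rho>: "is_irrep G d \<rho>" and \<tau>: "is_irrep G e \<tau>" and niso: "\<not> rep_iso G d \<rho> e \<tau>"
    and ij: "a < d" "b < d" "c < e" "f < e"
  shows "(\<Sum>g\<in>carrier G. \<rho> g $$ (a, b) * \<tau> (inv g) $$ (c, f)) = 0"
proof -
  note \<rho>r = is_irrepD(1)[OF \<rho>] and \<tau>r = is_irrepD(1)[OF \<tau>]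
  note \<rho>c = is_repD(1)[OF \<rho>r] and \<tau>c = is_repD(1)[OF \<tau>r]
  define T where "T = mat d e (\<lambda>(a, f). \<Sum>g\<in>carrier G. \<rho> g $$ (a, b) * \<tau> (inv g) $$ (c, f))"
  have T: "T \<in> carrier_mat d e" by (simp add: T_def)
  have comm: "\<rho> h * T = T * \<tau> h" if h: "h \<in> carrier G" for h
  proof (rule eq_matI)
    fix i j assume "i < dim_row (T * \<tau> h)" "j < dim_col (T * \<tau> h)"
    then have ij: "i < d" "j < e" using T \<tau>c[OF h] by auto
    have "(\<rho> h * T) $$ (i, j) = (\<Sum>k<d. \<rho> h $$ (i, k) * (\<Sum>g\<in>carrier G. \<rho> g $$ (k, b) * \<tau> (inv g) $$ (c, j)))"
      using mult_mat_index[OF \<rho>c[OF h] T ij] ij by (simp add: T_def)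
    also have "\<dots> = (\<Sum>g\<in>carrier G. (\<Sum>k<d. \<rho> h $$ (i, k) * \<rho> g $$ (k, b)) * \<tau> (inv g) $$ (c, j))"
      by (simp add: sum_distrib_left sum_distrib_right mult.assoc sum.swap[of _ "{..<d}" "carrier G"])
    also have "\<dots> = (\<Sum>g\<in>carrier G. \<rho> (h \<otimes> g) $$ (i, b) * \<tau> (inv g) $$ (c, j))"
      using h assms(6) ij mult_mat_index[OF \<rho>c[OF h] \<rho>c] by (intro sum.cong refl) (simp add: is_repD(3)[OF \<rho>r])
    also have "\<dots> = (\<Sum>g\<in>carrier G. \<rho> (h \<otimes> g) $$ (i, b) * \<tau> (inv (h \<otimes> g) \<otimes> h) $$ (c, j))"
      using h by (intro sum.cong refl) (simp add: inv_mult_group m_assoc)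
    also have "\<dots> = (\<Sum>g\<in>carrier G. \<rho> g $$ (i, b) * \<tau> (inv g \<otimes> h) $$ (c, j))"
      using h by (rule sum_translate)
    also have "\<dots> = (\<Sum>g\<in>carrier G. \<rho> g $$ (i, b) * (\<Sum>k<e. \<tau> (inv g) $$ (c, k) * \<tau> h $$ (k, j)))"
      using h assms(7) ij mult_mat_index[OF \<tau>c \<tau>c[OF h]] by (intro sum.cong refl) (simp add: is_repD(3)[OF \<tau>r])
    also have "\<dots> = (\<Sum>k<e. (\<Sum>g\<in>carrier G. \<rho> g $$ (i, b) * \<tau> (inv g) $$ (c, k)) * \<tau> h $$ (k, j))"
      by (simp add: sum_distrib_left sum_distrib_right mult.assoc sum.swap[of _ "{..<e}" "carrier G"])
    also have "\<dots> = (T * \<tau> h) $$ (i, j)"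
      using mult_mat_index[OF T \<tau>c[OF h] ij] ij by (simp add: T_def)
    finally show "(\<rho> h * T) $$ (i, j) = (T * \<tau> h) $$ (i, j)" .
  qed (use T \<rho>c[OF h] \<tau>c[OF h] in auto)
  have "T = 0\<^sub>m d e"
    using schur[OF char0 \<rho> \<tau> T _ comm] niso by blast
  then have "T $$ (a, f) = 0" using ij by simp
  then show ?thesis using ij by (simp add: T_def)
qed

lemma (in group) alg_act_character_eq_0:
  fixes \<rho> \<tau> :: "'a \<Rightarrow> 'k::field mat"
  assumes char0: "\<And>n. n > 0 \<Longrightarrow> of_nat n \<noteq> (0 :: 'k)"
    and \<rho>: "is_irrep G d \<rho>" and \<tau>: "is_irrep G e \<tau>" and niso: "\<not> rep_iso G d \<rho> e \<tau>"
    and ij: "a < d" "b < d"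
  shows "(\<Sum>g\<in>carrier G. mtrace (\<tau> (inv g)) * \<rho> g $$ (a, b)) = 0"
proof -
  note \<tau>c = is_repD(1)[OF is_irrepD(1)[OF \<tau>]]
  have "(\<Sum>g\<in>carrier G. mtrace (\<tau> (inv g)) * \<rho> g $$ (a, b)) =
    (\<Sum>g\<in>carrier G. \<Sum>i<e. \<rho> g $$ (a, b) * \<tau> (inv g) $$ (i, i))"
    using carrier_matD(1)[OF \<tau>c] by (intro sum.cong refl) (simp add: mtrace_def sum_distrib_left mult.commute)
  also have "\<dots> = (\<Sum>i<e. \<Sum>g\<in>carrier G. \<rho> g $$ (a, b) * \<tau> (inv g) $$ (i, i))"
    by (rule sum.swap)
  also have "\<dots> = 0" using schur_orthogonality[OF char0 \<rho> \<tau> niso ij] by simp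
  finally show ?thesis .
qed

text \<open>The list holds the composition factors of the permutation representation of
  \<open>G\<close> on itself, whose trace counts fixed points and so vanishes off the identity. It
  supplies enough irreducible representations for the detection arguments that follow.\<close>

lemma (in group) regular_character:
  assumes fin: "finite (carrier G)"
  shows "\<exists>L :: (nat \<times> ('a \<Rightarrow> 'k::field mat)) list. (\<forall>(e, \<tau>)\<in>set L. is_irrep G e \<tau>) \<and>
    (\<forall>g\<in>carrier G. (\<Sum>(e, \<tau>)\<leftarrow>L. mtrace (\<tau> g)) = (if g = \<one> then of_nat (card (carrier G)) else 0))"
proof -
  define N where "N = card (carrier G)"
  obtain e where e: "bij_betw e {..<N} (carrier G)"
    using ex_bij_betw_nat_finite[OF fin] by (auto simp: N_def lessThan_atLeast0)
  have ec: "e i \<in> carrier G" if "i < N" for i using e that by (auto simp: bij_betw_def)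
  have ei: "e i = e j \<longleftrightarrow> i = j" if "i < N" "j < N" for i j
    using e that by (auto simp: bij_betw_def inj_on_def)
  define \<rho> where "\<rho> g = mat N N (\<lambda>(a, b). if e a = g \<otimes> e b then 1 else 0 :: 'k)" for g
  have \<rho>c: "\<rho> g \<in> carrier_mat N N" for g by (simp add: \<rho>_def)
  have "\<rho> (g \<otimes> h) = \<rho> g * \<rho> h" if gh: "g \<in> carrier G" "h \<in> carrier G" for g h
  proof (rule eq_matI)
    fix i j assume "i < dim_row (\<rho> g * \<rho> h)" "j < dim_col (\<rho> g * \<rho> h)"
    then have ij: "i < N" "j < N" by (auto simp: \<rho>_def)
    obtain l where l: "l < N" "e l = h \<otimes> e j"
      using e gh ec[OF ij(2)] unfolding bij_betw_def by (metis imageE lessThan_iff m_closed)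
    have "(\<rho> g * \<rho> h) $$ (i, j) = (\<Sum>k<N. \<rho> g $$ (i, k) * \<rho> h $$ (k, j))"
      by (rule mult_mat_index[OF \<rho>c \<rho>c ij])
    also have "\<dots> = (\<Sum>k<N. if k = l then (if e i = g \<otimes> e k then 1 else 0) else 0)"
      using ij l ei by (intro sum.cong refl) (auto simp: \<rho>_def simp flip: l(2))
    also have "\<dots> = (if e i = g \<otimes> (h \<otimes> e j) then 1 else 0)" using l by simp
    also have "\<dots> = \<rho> (g \<otimes> h) $$ (i, j)" using ij gh ec by (simp add: \<rho>_def m_assoc)
    finally show "\<rho> (g \<otimes> h) $$ (i, j) = (\<rho> g * \<rho> h) $$ (i, j)" ..
  qed (auto simp: \<rho>_def)
  moreover have "\<rho> \<one> = 1\<^sub>m N" using ec ei by (intro eq_matI) (auto simp: \<rho>_def)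
  ultimately have "is_rep G N \<rho>" using \<rho>c by (auto simp: is_rep_def)
  from rep_composition_factors[OF this] obtain L where L: "\<forall>(e, \<tau>)\<in>set L. is_irrep G e \<tau>"
    "\<And>g. g \<in> carrier G \<Longrightarrow> mtrace (\<rho> g) = (\<Sum>(e, \<tau>)\<leftarrow>L. mtrace (\<tau> g))" by blast
  have "mtrace (\<rho> g) = (if g = \<one> then of_nat N else 0)" if g: "g \<in> carrier G" for g
  proof -
    have "e i = g \<otimes> e i \<longleftrightarrow> g = \<one>" if "i < N" for i using ec[OF that] g by (metis l_one one_closed r_cancel)
    then have "mtrace (\<rho> g) = (\<Sum>i<N. if g = \<one> then 1 else 0)"
      unfolding mtrace_def by (intro sum.cong) (auto simp: \<rho>_def)
    then show ?thesis by simp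
  qed
  then show ?thesis using L unfolding N_def by (intro exI[of _ L]) auto
qed

lemma sum_list_sum_swap:
  "(\<Sum>x\<leftarrow>xs. \<Sum>i\<in>I. f x i) = (\<Sum>i\<in>I. \<Sum>x\<leftarrow>xs. f x i)"
  by (induction xs) (auto simp: sum.distrib)

text \<open>The regular character, applied to \<open>v\<close> translated by \<open>inv g\<close>,
  returns \<open>|G|\<close> times \<open>v g\<close>. If \<open>v\<close> acted as zero on every
  irreducible representation, this value would be zero.\<close>

lemma (in group) exists_irrep_nonzero:
  fixes v :: "'a \<Rightarrow> 'k::field"
  assumes fin: "finite (carrier G)"
    and char0: "\<And>n. n > 0 \<Longrightarrow> of_nat n \<noteq> (0 :: 'k)"
    and g: "g \<in> carrier G" "v g \<noteq> 0"
  shows "\<exists>d \<rho>. is_irrep G d \<rho> \<and> alg_act G d \<rho> v \<noteq> 0\<^sub>m d d"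
proof (rule ccontr)
  assume neg: "\<not> ?thesis"
  obtain L :: "(nat \<times> ('a \<Rightarrow> 'k mat)) list" where L: "\<And>e \<tau>. (e, \<tau>) \<in> set L \<Longrightarrow> is_irrep G e \<tau>"
    and tr: "\<And>g. g \<in> carrier G \<Longrightarrow> (\<Sum>(e, \<tau>)\<leftarrow>L. mtrace (\<tau> g)) = (if g = \<one> then of_nat (card (carrier G)) else 0)"
    using regular_character[OF fin] by blast
  have "(\<Sum>(e, \<tau>)\<leftarrow>L. \<Sum>h\<in>carrier G. v h * mtrace (\<tau> (h \<otimes> inv g))) = (\<Sum>(e, \<tau>)\<leftarrow>L. 0)"
  proof (intro arg_cong[of _ _ sum_list] map_cong refl, clarify)
    fix e \<tau> assume et: "(e, \<tau>) \<in> set L"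
    note i = L[OF et]
    note r = is_irrepD(1)[OF i]
    have gi: "inv g \<in> carrier G" using g by simp
    have "mtrace (alg_act G e \<tau> v * \<tau> (inv g)) = 0"
    proof -
      have "alg_act G e \<tau> v = 0\<^sub>m e e" using neg i by blast
      then have "alg_act G e \<tau> v * \<tau> (inv g) = 0\<^sub>m e e" using is_repD(1)[OF r gi] by simp
      then show ?thesis by (simp add: mtrace_def)
    qed
    then show "(\<Sum>h\<in>carrier G. v h * mtrace (\<tau> (h \<otimes> inv g))) = 0"
      by (simp add: mtrace_alg_act_mult[OF r gi])
  qed
  then have "0 = (\<Sum>x\<leftarrow>L. \<Sum>h\<in>carrier G. v h * mtrace (snd x (h \<otimes> inv g)))"
    by (simp add: case_prod_unfold)
  also have "\<dots> = (\<Sum>h\<in>carrier G. v h * (\<Sum>(e, \<tau>)\<leftarrow>L. mtrace (\<tau> (h \<otimes> inv g))))"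
    by (simp add: sum_list_sum_swap sum_list_const_mult case_prod_unfold)
  also have "\<dots> = (\<Sum>h\<in>carrier G. if h = g then v h * of_nat (card (carrier G)) else 0)"
    using g by (intro sum.cong refl) (auto simp: tr inv_solve_right')
  also have "\<dots> = v g * of_nat (card (carrier G))" using fin g by simp
  finally show False using g char0[of "card (carrier G)"] fin by (auto simp: card_gt_0_iff)
qed

text \<open>The composition factors of the regular representation contain each irreducible
  representation with the right multiplicity, so multiplicities need not be computed.\<close>

lemma (in group) central_element_of_scalars:
  fixes s :: "nat \<Rightarrow> ('a \<Rightarrow> 'k::field mat) \<Rightarrow> 'k"
  assumes fin: "finite (carrier G)"
    and char0: "\<And>n. n > 0 \<Longrightarrow> of_nat n \<noteq> (0 :: 'k)"
    and s: "\<And>d \<rho> e \<tau>. is_irrep G d \<rho> \<Longrightarrow> is_irrep G e \<tau> \<Longrightarrow> rep_iso G d \<rho> e \<tau> \<Longrightarrow> s d \<rho> = s e \<tau>"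
  shows "\<exists>z. (\<forall>g\<in>carrier G. \<forall>h\<in>carrier G. z (h \<otimes> g \<otimes> inv h) = z g) \<and>
    (\<forall>d \<rho>. is_irrep G d \<rho> \<longrightarrow> alg_act G d \<rho> z = s d \<rho> \<cdot>\<^sub>m 1\<^sub>m d)"
proof -
  obtain L :: "(nat \<times> ('a \<Rightarrow> 'k mat)) list" where L: "\<And>e \<tau>. (e, \<tau>) \<in> set L \<Longrightarrow> is_irrep G e \<tau>"
    and tr: "\<And>g. g \<in> carrier G \<Longrightarrow> (\<Sum>(e, \<tau>)\<leftarrow>L. mtrace (\<tau> g)) = (if g = \<one> then of_nat (card (carrier G)) else 0)"
    using regular_character[OF fin] by blast
  define N :: 'k where "N = of_nat (card (carrier G))"
  have N0: "N \<noteq> 0" using char0[of "card (carrier G)"] fin by (auto simp: N_def card_gt_0_iff)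
  \<comment> \<open>A combination of the central idempotents, whose coefficients are
    \<open>\<chi>(1) \<chi>(inv g) / |G|\<close>; the factor \<open>\<chi>(1)\<close> is supplied by
    the repetitions in \<open>L\<close>.\<close>
  define z where "z g = inverse N * (\<Sum>(e, \<tau>)\<leftarrow>L. s e \<tau> * mtrace (\<tau> (inv g)))" for g
  have "z (h \<otimes> g \<otimes> inv h) = z g" if gh: "g \<in> carrier G" "h \<in> carrier G" for g h
  proof -
    have "mtrace (\<tau> (inv (h \<otimes> g \<otimes> inv h))) = mtrace (\<tau> (inv g))" if "(e, \<tau>) \<in> set L" for e \<tau>
    proof -
      note r = is_repD[OF is_irrepD(1)[OF L[OF that]]]
      have hi: "inv h \<in> carrier G" "inv g \<in> carrier G" using gh by auto
      have "inv (h \<otimes> g \<otimes> inv h) = h \<otimes> inv g \<otimes> inv h" using gh by (simp add: inv_mult_group m_assoc)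
      then have "\<tau> (inv (h \<otimes> g \<otimes> inv h)) = \<tau> h * \<tau> (inv g) * \<tau> (inv h)" using gh hi r(3) by simp
      moreover have "\<tau> (inv h) * \<tau> h = 1\<^sub>m e" using gh hi r(2) r(3)[symmetric] by simp
      ultimately show ?thesis
        using mtrace_conjugate[OF r(1)[OF hi(2)] r(1)[OF hi(1)] r(1)[OF gh(2)]] by simp
    qed
    then show ?thesis unfolding z_def by (intro arg_cong[of _ _ "\<lambda>x. _ * x"] arg_cong[of _ _ sum_list] map_cong) auto
  qed
  moreover have "alg_act G d \<rho> z = s d \<rho> \<cdot>\<^sub>m 1\<^sub>m d" if \<rho>: "is_irrep G d \<rho>" for d \<rho>
  proof (rule eq_matI)
    note r = is_repD[OF is_irrepD(1)[OF \<rho>]]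
    fix i j assume "i < dim_row (s d \<rho> \<cdot>\<^sub>m 1\<^sub>m d)" "j < dim_col (s d \<rho> \<cdot>\<^sub>m 1\<^sub>m d)"
    then have ij: "i < d" "j < d" by auto
    let ?E = "\<lambda>\<tau>. \<Sum>g\<in>carrier G. mtrace (\<tau> (inv g)) * \<rho> g $$ (i, j)"
    have "alg_act G d \<rho> z $$ (i, j) = inverse N * (\<Sum>g\<in>carrier G. \<Sum>(e, \<tau>)\<leftarrow>L. s e \<tau> * (mtrace (\<tau> (inv g)) * \<rho> g $$ (i, j)))"
      using ij by (simp add: alg_act_def z_def sum_distrib_left mult.assoc case_prod_unfold flip: sum_list_mult_const)
    also have "\<dots> = inverse N * (\<Sum>(e, \<tau>)\<leftarrow>L. s e \<tau> * ?E \<tau>)"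
      by (simp add: case_prod_unfold sum_distrib_left flip: sum_list_sum_swap)
    \<comment> \<open>Factors isomorphic to \<open>\<rho>\<close> have the same scalar, and for the
      others \<open>?E \<tau>\<close> vanishes. With a constant scalar the sum collapses to the
      regular character.\<close>
    also have "(\<Sum>(e, \<tau>)\<leftarrow>L. s e \<tau> * ?E \<tau>) = (\<Sum>(e, \<tau>)\<leftarrow>L. s d \<rho> * ?E \<tau>)"
    proof (intro arg_cong[of _ _ sum_list] map_cong refl, clarify)
      fix e \<tau> assume et: "(e, \<tau>) \<in> set L"
      show "s e \<tau> * ?E \<tau> = s d \<rho> * ?E \<tau>"
      proof (cases "rep_iso G d \<rho> e \<tau>")
        case True
        then show ?thesis using s[OF \<rho> L[OF et]] by simp
      next
        case False
        then show ?thesis using alg_act_character_eq_0[OF char0 \<rho> L[OF et] False ij] by simp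
      qed
    qed
    also have "\<dots> = s d \<rho> * (\<Sum>g\<in>carrier G. (\<Sum>(e, \<tau>)\<leftarrow>L. mtrace (\<tau> (inv g))) * \<rho> g $$ (i, j))"
      by (simp add: case_prod_unfold sum_list_const_mult sum_list_sum_swap flip: sum_list_mult_const)
    also have "(\<Sum>g\<in>carrier G. (\<Sum>(e, \<tau>)\<leftarrow>L. mtrace (\<tau> (inv g))) * \<rho> g $$ (i, j)) =
      (\<Sum>g\<in>carrier G. if g = \<one> then N * \<rho> g $$ (i, j) else 0)"
      by (intro sum.cong refl) (auto simp: tr N_def inv_eq_1_iff)
    also have "\<dots> = N * 1\<^sub>m d $$ (i, j)" using fin r(2) by simp
    finally show "alg_act G d \<rho> z $$ (i, j) = (s d \<rho> \<cdot>\<^sub>m 1\<^sub>m d) $$ (i, j)"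
      using ij N0 by (simp add: field_simps)
  qed (auto simp: alg_act_def)
  ultimately show ?thesis by blast
qed

section \<open>Existence of the reduced norm\<close>

text \<open>\<open>rep_ext_mat\<close> with coefficients in the field of the representation, where
  valuation rings and field automorphisms live.\<close>

definition block_rep :: "('g, 'b) monoid_scheme \<Rightarrow> nat \<Rightarrow> ('g \<Rightarrow> 'k::field mat)
    \<Rightarrow> nat \<Rightarrow> (nat \<Rightarrow> nat \<Rightarrow> 'g \<Rightarrow> 'k) \<Rightarrow> 'k mat" where
  "block_rep G d \<rho> n K = mat (n * d) (n * d) (\<lambda>(i, j).
      \<Sum>g\<in>carrier G. K (i div d) (j div d) g * \<rho> g $$ (i mod d, j mod d))"

text \<open>The Kronecker product of the identity of size \<open>n\<close> with \<open>T\<close>: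
  the change of basis on \<open>n\<close> copies of a representation.\<close>

definition block_diag :: "nat \<Rightarrow> nat \<Rightarrow> 'k::field mat \<Rightarrow> 'k mat" where
  "block_diag d n T = mat (n * d) (n * d) (\<lambda>(i, j). if i div d = j div d then T $$ (i mod d, j mod d) else 0)"

lemma rep_ext_mat_eq: "rep_ext_mat G d \<rho> n H = block_rep G d \<rho> n (\<lambda>i j g. to_ac (H i j g))"
  by (simp add: rep_ext_mat_def block_rep_def)

lemma rep_ext_eq: "rep_ext G d \<rho> a = alg_act G d \<rho> (\<lambda>g. to_ac (a g))"
  by (simp add: rep_ext_def alg_act_def)

lemma block_rep_carrier [simp]: "block_rep G d \<rho> n K \<in> carrier_mat (n * d) (n * d)"
  by (simp add: block_rep_def)

lemma block_diag_carrier [simp]: "block_diag d n T \<in> carrier_mat (n * d) (n * d)"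
  by (simp add: block_diag_def)

lemma sum_div_mod:
  assumes "d > (0::nat)"
  shows "(\<Sum>k<n * d. f (k div d) (k mod d)) = (\<Sum>a<n. \<Sum>b<d. f a b)"
proof -
  have "(\<Sum>a<n. \<Sum>b<d. f a b) = (\<Sum>(a, b)\<in>{..<n} \<times> {..<d}. f a b)"
    by (simp add: sum.cartesian_product)
  also have "\<dots> = (\<Sum>k<n * d. f (k div d) (k mod d))"
  proof (rule sum.reindex_bij_witness[of _ "\<lambda>k. (k div d, k mod d)" "\<lambda>(a, b). a * d + b"])
    fix x assume "x \<in> {..<n} \<times> {..<d}"
    then obtain a b where x: "x = (a, b)" "a < n" "b < d" by auto
    have "a * d + b < Suc a * d" using x by simp
    also have "\<dots> \<le> n * d" using x by (intro mult_le_mono1) auto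
    finally show "(case x of (a, b) \<Rightarrow> a * d + b) \<in> {..<n * d}" using x by simp
    show "((case x of (a, b) \<Rightarrow> a * d + b) div d, (case x of (a, b) \<Rightarrow> a * d + b) mod d) = x"
      using x by simp
    show "f ((case x of (a, b) \<Rightarrow> a * d + b) div d) ((case x of (a, b) \<Rightarrow> a * d + b) mod d) = (case x of (a, b) \<Rightarrow> f a b)"
      using x by simp
  next
    fix k assume "k \<in> {..<n * d}"
    then show "(k div d, k mod d) \<in> {..<n} \<times> {..<d}"
      using assms by (auto simp: less_mult_imp_div_less)
  qed auto
  finally show ?thesis ..
qed

lemma block_rep_mult_block_diag:
  assumes T: "T \<in> carrier_mat d d" and \<rho>: "\<And>g. g \<in> carrier G \<Longrightarrow> \<rho> g \<in> carrier_mat d d"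
  shows "block_rep G d \<rho> n K * block_diag d n T = block_rep G d (\<lambda>g. \<rho> g * T) n K" (is "?l = ?r")
    and "block_diag d n T * block_rep G d \<rho> n K = block_rep G d (\<lambda>g. T * \<rho> g) n K" (is "?l' = ?r'")
proof -
  have *: "?l $$ (i, j) = ?r $$ (i, j) \<and> ?l' $$ (i, j) = ?r' $$ (i, j)" if ij: "i < n * d" "j < n * d" for i j
  proof -
    have d: "d > 0" using ij by (cases d) auto
    have q: "i div d < n" "j div d < n" "i mod d < d" "j mod d < d"
      using ij d by (auto simp: less_mult_imp_div_less)
    let ?K = "K (i div d) (j div d)"
    have "?l $$ (i, j) = (\<Sum>k<n * d. (\<Sum>g\<in>carrier G. K (i div d) (k div d) g * \<rho> g $$ (i mod d, k mod d)) *
        (if k div d = j div d then T $$ (k mod d, j mod d) else 0))"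
      unfolding mult_mat_index[OF block_rep_carrier block_diag_carrier ij]
      using ij by (intro sum.cong refl) (simp add: block_rep_def block_diag_def)
    also have "\<dots> = (\<Sum>a<n. \<Sum>b<d. (\<Sum>g\<in>carrier G. K (i div d) a g * \<rho> g $$ (i mod d, b)) *
        (if a = j div d then T $$ (b, j mod d) else 0))"
      by (rule sum_div_mod[OF d, of "\<lambda>a b. (\<Sum>g\<in>carrier G. K (i div d) a g * \<rho> g $$ (i mod d, b)) *
        (if a = j div d then T $$ (b, j mod d) else 0)"])
    also have "\<dots> = (\<Sum>a<n. if a = j div d then (\<Sum>b<d. (\<Sum>g\<in>carrier G. K (i div d) a g * \<rho> g $$ (i mod d, b)) *
        T $$ (b, j mod d)) else 0)"
      by (intro sum.cong refl) auto
    also have "\<dots> = (\<Sum>b<d. (\<Sum>g\<in>carrier G. ?K g * \<rho> g $$ (i mod d, b)) * T $$ (b, j mod d))"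
      using q by simp
    also have "\<dots> = (\<Sum>g\<in>carrier G. ?K g * (\<Sum>b<d. \<rho> g $$ (i mod d, b) * T $$ (b, j mod d)))"
      by (simp add: sum_distrib_left sum_distrib_right mult.assoc sum.swap[of _ "{..<d}" "carrier G"])
    also have "\<dots> = ?r $$ (i, j)"
      using ij q mult_mat_index[OF \<rho> T] by (simp add: block_rep_def)
    finally have 1: "?l $$ (i, j) = ?r $$ (i, j)" .
    have "?l' $$ (i, j) = (\<Sum>k<n * d. (if i div d = k div d then T $$ (i mod d, k mod d) else 0) *
        (\<Sum>g\<in>carrier G. K (k div d) (j div d) g * \<rho> g $$ (k mod d, j mod d)))"
      unfolding mult_mat_index[OF block_diag_carrier block_rep_carrier ij]
      using ij by (intro sum.cong refl) (simp add: block_rep_def block_diag_def)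
    also have "\<dots> = (\<Sum>a<n. \<Sum>b<d. (if i div d = a then T $$ (i mod d, b) else 0) *
        (\<Sum>g\<in>carrier G. K a (j div d) g * \<rho> g $$ (b, j mod d)))"
      by (rule sum_div_mod[OF d, of "\<lambda>a b. (if i div d = a then T $$ (i mod d, b) else 0) *
        (\<Sum>g\<in>carrier G. K a (j div d) g * \<rho> g $$ (b, j mod d))"])
    also have "\<dots> = (\<Sum>a<n. if a = i div d then (\<Sum>b<d. T $$ (i mod d, b) *
        (\<Sum>g\<in>carrier G. K a (j div d) g * \<rho> g $$ (b, j mod d))) else 0)"
      by (intro sum.cong refl) auto
    also have "\<dots> = (\<Sum>b<d. T $$ (i mod d, b) * (\<Sum>g\<in>carrier G. ?K g * \<rho> g $$ (b, j mod d)))"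
      using q by simp
    also have "\<dots> = (\<Sum>g\<in>carrier G. ?K g * (\<Sum>b<d. T $$ (i mod d, b) * \<rho> g $$ (b, j mod d)))"
      by (simp add: sum_distrib_left mult.left_commute sum.swap[of _ "{..<d}" "carrier G"])
    also have "\<dots> = ?r' $$ (i, j)"
      using ij q mult_mat_index[OF T \<rho>] by (simp add: block_rep_def)
    finally show ?thesis using 1 by blast
  qed
  show "?l = ?r" "?l' = ?r'"
    by (intro eq_matI; use * in \<open>auto simp: block_rep_def block_diag_def\<close>)+
qed

lemma block_diag_inverse:
  assumes T: "T \<in> carrier_mat d d" and S: "S \<in> carrier_mat d d" and TS: "T * S = 1\<^sub>m d"
  shows "block_diag d n T * block_diag d n S = 1\<^sub>m (n * d)"
proof (rule eq_matI)
  fix i j assume "i < dim_row (1\<^sub>m (n * d) :: 'a mat)" "j < dim_col (1\<^sub>m (n * d) :: 'a mat)"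
  then have ij: "i < n * d" "j < n * d" by auto
  then have d: "d > 0" by (cases d) auto
  have q: "i div d < n" "j div d < n" "i mod d < d" "j mod d < d"
    using ij d by (auto simp: less_mult_imp_div_less)
  let ?f = "\<lambda>a b. (if i div d = a then T $$ (i mod d, b) else 0) * (if a = j div d then S $$ (b, j mod d) else 0)"
  have "(block_diag d n T * block_diag d n S) $$ (i, j) = (\<Sum>k<n * d. ?f (k div d) (k mod d))"
    unfolding mult_mat_index[OF block_diag_carrier block_diag_carrier ij]
    using ij by (intro sum.cong refl) (simp add: block_diag_def)
  also have "\<dots> = (\<Sum>a<n. \<Sum>b<d. ?f a b)" by (rule sum_div_mod[OF d])
  also have "\<dots> = (\<Sum>a<n. if a = i div d then (if i div d = j div d then
      (\<Sum>b<d. T $$ (i mod d, b) * S $$ (b, j mod d)) else 0) else 0)"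
    by (intro sum.cong refl) auto
  also have "\<dots> = (if i div d = j div d then (T * S) $$ (i mod d, j mod d) else 0)"
    using q by (simp add: mult_mat_index[OF T S] del: index_mult_mat)
  also have "\<dots> = 1\<^sub>m (n * d) $$ (i, j)"
    using q ij by (simp add: TS) (metis div_mult_mod_eq)
  finally show "(block_diag d n T * block_diag d n S) $$ (i, j) = 1\<^sub>m (n * d) $$ (i, j)" .
qed (auto simp: block_diag_def)

text \<open>\<open>block_diag d n T\<close> intertwines the two block matrices. The lemma speaks of
  families of matrices because \<open>integral_form\<close> delivers its \<open>\<tau>\<close> in
  this shape, and twists of it are compared later.\<close>

lemma det_block_rep_iso:
  fixes \<rho> \<tau> :: "'g \<Rightarrow> 'k::field mat"
  assumes T: "T \<in> carrier_mat d d" "det T \<noteq> 0"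
    and \<rho>: "\<And>g. g \<in> carrier G \<Longrightarrow> \<rho> g \<in> carrier_mat d d" and \<tau>: "\<And>g. g \<in> carrier G \<Longrightarrow> \<tau> g \<in> carrier_mat d d"
    and comm: "\<And>g. g \<in> carrier G \<Longrightarrow> \<rho> g * T = T * \<tau> g"
  shows "det (block_rep G d \<rho> n K) = det (block_rep G d \<tau> n K)"
proof -
  obtain S where S: "S \<in> carrier_mat d d" "T * S = 1\<^sub>m d" using det_nonzero_inverse[OF T] by metis
  have "det (block_diag d n T) * det (block_diag d n S) = 1"
    using det_mult[OF block_diag_carrier block_diag_carrier, of d n T S] block_diag_inverse[OF T(1) S]
    by simp
  then have nz: "det (block_diag d n T) \<noteq> 0" by auto
  have "block_rep G d \<rho> n K * block_diag d n T = block_rep G d (\<lambda>g. \<rho> g * T) n K"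
    by (rule block_rep_mult_block_diag(1)[OF T(1) \<rho>])
  also have "\<dots> = block_rep G d (\<lambda>g. T * \<tau> g) n K"
    unfolding block_rep_def using comm by (intro eq_matI) auto
  also have "\<dots> = block_diag d n T * block_rep G d \<tau> n K"
    by (rule block_rep_mult_block_diag(2)[OF T(1) \<tau>, symmetric])
  finally have "block_rep G d \<rho> n K * block_diag d n T = block_diag d n T * block_rep G d \<tau> n K" .
  then have "det (block_rep G d \<rho> n K) * det (block_diag d n T) = det (block_diag d n T) * det (block_rep G d \<tau> n K)"
    by (metis det_mult block_rep_carrier block_diag_carrier)
  then show ?thesis using nz by simp
qed

text \<open>The vectors that \<open>\<sigma>\<close> maps into \<open>W\<close> form a subspace,
  because \<open>\<sigma>\<close> acts semilinearly, and it is invariant under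
  \<open>\<rho>\<close>. Surjectivity of \<open>\<sigma>\<close> recovers \<open>W\<close> from
  it.\<close>

lemma is_irrep_map:
  fixes \<sigma> :: "'k::field \<Rightarrow> 'k"
  assumes \<sigma>: "comm_ring_hom \<sigma>" "bij \<sigma>" and \<rho>: "is_irrep G d \<rho>"
  shows "is_irrep G d (\<lambda>g. map_mat \<sigma> (\<rho> g))"
proof -
  interpret \<sigma>: comm_ring_hom \<sigma> by fact
  note r = is_repD[OF is_irrepD(1)[OF \<rho>]]
  have "is_rep G d (\<lambda>g. map_mat \<sigma> (\<rho> g))"
    using r by (auto simp: is_rep_def \<sigma>.mat_hom_one intro!: \<sigma>.mat_hom_mult)
  moreover have "W = {0\<^sub>v d} \<or> W = carrier_vec d"
    if W: "vec_subspace d W" and inv: "\<And>g v. g \<in> carrier G \<Longrightarrow> v \<in> W \<Longrightarrow> map_mat \<sigma> (\<rho> g) *\<^sub>v v \<in> W" for W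
  proof -
    define U where "U = {v \<in> carrier_vec d. map_vec \<sigma> v \<in> W}"
    have sm: "map_vec \<sigma> (c \<cdot>\<^sub>v v) = \<sigma> c \<cdot>\<^sub>v map_vec \<sigma> v" for c v by (intro eq_vecI) (auto simp: \<sigma>.hom_mult)
    have z: "map_vec \<sigma> (0\<^sub>v d) = 0\<^sub>v d" by (intro eq_vecI) auto
    have ad: "map_vec \<sigma> (v + w) = map_vec \<sigma> v + map_vec \<sigma> w" if "v \<in> carrier_vec d" "w \<in> carrier_vec d" for v w
      using that by (intro eq_vecI) (auto simp: \<sigma>.hom_add)
    have U: "U = {0\<^sub>v d} \<or> U = carrier_vec d"
    proof (rule is_irrepD(3)[OF \<rho>])
      show "vec_subspace d U" using W by (auto simp: vec_subspace_def U_def sm z ad)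
      fix g v assume g: "g \<in> carrier G" and v: "v \<in> U"
      then have "map_vec \<sigma> (\<rho> g *\<^sub>v v) = map_mat \<sigma> (\<rho> g) *\<^sub>v map_vec \<sigma> v"
        using r(1)[OF g] by (intro \<sigma>.mult_mat_vec_hom) (auto simp: U_def)
      then show "\<rho> g *\<^sub>v v \<in> U" using inv[OF g, of "map_vec \<sigma> v"] v r(1)[OF g] by (auto simp: U_def)
    qed
    have lift: "\<exists>v\<in>carrier_vec d. w = map_vec \<sigma> v" if "w \<in> carrier_vec d" for w
      using that \<sigma>(2) by (intro bexI[of _ "map_vec (inv_into UNIV \<sigma>) w"] eq_vecI) (auto simp: bij_is_surj surj_f_inv_f)
    from U show ?thesis
    proof
      assume U: "U = {0\<^sub>v d}"
      have "w = 0\<^sub>v d" if w: "w \<in> W" for w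
      proof -
        have "w \<in> carrier_vec d" using W w by (auto simp: vec_subspace_def)
        with lift obtain v where v: "v \<in> carrier_vec d" "w = map_vec \<sigma> v" by blast
        then have "v \<in> U" using w by (simp add: U_def)
        then show ?thesis using v U z by auto
      qed
      then show ?thesis using W by (auto simp: vec_subspace_def)
    next
      assume U: "U = carrier_vec d"
      have "w \<in> W" if w: "w \<in> carrier_vec d" for w
      proof -
        obtain v where v: "v \<in> carrier_vec d" "w = map_vec \<sigma> v" using lift[OF w] by blast
        then have "v \<in> U" using U by simp
        then show ?thesis using v by (simp add: U_def)
      qed
      then show ?thesis using W by (auto simp: vec_subspace_def)
    qed
  qed
  ultimately show ?thesis using is_irrepD(2)[OF \<rho>] unfolding is_irrep_iff by blast
qed

lemma alg_act_map:
  fixes \<sigma> :: "'k::field \<Rightarrow> 'k"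
  assumes "comm_ring_hom \<sigma>" and \<rho>: "\<And>g. g \<in> carrier G \<Longrightarrow> \<rho> g \<in> carrier_mat d d"
  shows "alg_act G d (\<lambda>g. map_mat \<sigma> (\<rho> g)) (\<lambda>g. \<sigma> (a g)) = map_mat \<sigma> (alg_act G d \<rho> a)"
proof -
  interpret \<sigma>: comm_ring_hom \<sigma> by fact
  show ?thesis
    using carrier_matD[OF \<rho>] by (intro eq_matI) (auto simp: alg_act_def \<sigma>.hom_sum \<sigma>.hom_mult intro!: sum.cong)
qed

lemma block_rep_map:
  fixes \<sigma> :: "'k::field \<Rightarrow> 'k"
  assumes "comm_ring_hom \<sigma>" and \<rho>: "\<And>g. g \<in> carrier G \<Longrightarrow> \<rho> g \<in> carrier_mat d d"
  shows "block_rep G d (\<lambda>g. map_mat \<sigma> (\<rho> g)) n (\<lambda>i j g. \<sigma> (K i j g)) = map_mat \<sigma> (block_rep G d \<rho> n K)"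
proof -
  interpret \<sigma>: comm_ring_hom \<sigma> by fact
  have "i mod d < d" if "i < n * d" for i using that by (cases d) auto
  then show ?thesis
    using carrier_matD[OF \<rho>] by (intro eq_matI) (auto simp: block_rep_def \<sigma>.hom_sum \<sigma>.hom_mult intro!: sum.cong)
qed

lemma (in group) alg_act_eqI:
  fixes v w :: "'a \<Rightarrow> 'k::field"
  assumes fin: "finite (carrier G)" and char0: "\<And>n. n > 0 \<Longrightarrow> of_nat n \<noteq> (0 :: 'k)"
    and eq: "\<And>d \<rho>. is_irrep G d \<rho> \<Longrightarrow> alg_act G d \<rho> v = alg_act G d \<rho> w"
    and g: "g \<in> carrier G"
  shows "v g = w g"
proof (rule ccontr)
  assume "v g \<noteq> w g"
  then have "v g - w g \<noteq> 0" by simp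
  from exists_irrep_nonzero[OF fin char0 g, of "\<lambda>g. v g - w g", OF _ this]
  obtain d \<rho> where \<rho>: "is_irrep G d \<rho>" "alg_act G d \<rho> (\<lambda>g. v g - w g) \<noteq> 0\<^sub>m d d" by blast
  have "alg_act G d \<rho> (\<lambda>g. v g - w g) = 0\<^sub>m d d"
  proof (rule eq_matI)
    fix i j assume "i < dim_row (0\<^sub>m d d :: 'k mat)" "j < dim_col (0\<^sub>m d d :: 'k mat)"
    then have ij: "i < d" "j < d" by auto
    then have "alg_act G d \<rho> (\<lambda>g. v g - w g) $$ (i, j) = alg_act G d \<rho> v $$ (i, j) - alg_act G d \<rho> w $$ (i, j)"
      by (simp add: alg_act_index left_diff_distrib sum_subtractf)
    then show "alg_act G d \<rho> (\<lambda>g. v g - w g) $$ (i, j) = 0\<^sub>m d d $$ (i, j)"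
      using eq[OF \<rho>(1)] ij by simp
  qed (auto simp: alg_act_def)
  then show False using \<rho>(2) by blast
qed

lemma (in group) class_function_central:
  fixes z :: "'a \<Rightarrow> 'f::field"
  assumes z: "z \<in> group_ring G S"
    and cl: "\<And>g h. g \<in> carrier G \<Longrightarrow> h \<in> carrier G \<Longrightarrow> z (h \<otimes> g \<otimes> inv h) = z g"
  shows "z \<in> gr_center G S"
proof -
  have "gr_mult G z a = gr_mult G a z" for a
  proof
    fix g
    show "gr_mult G z a g = gr_mult G a z g"
    proof (cases "g \<in> carrier G")
      case True
      have "(\<Sum>h\<in>carrier G. z h * a (inv h \<otimes> g)) = (\<Sum>h\<in>carrier G. a h * z (inv h \<otimes> g))"
      proof (rule sum.reindex_bij_witness[of _ "\<lambda>h. g \<otimes> inv h" "\<lambda>h. inv h \<otimes> g"])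
        fix h assume h: "h \<in> carrier G"
        show "g \<otimes> inv (inv h \<otimes> g) = h" using h True by (simp add: inv_mult_group m_assoc[symmetric])
        show "inv h \<otimes> g \<in> carrier G" using h True by simp
        have "z h = z (inv g \<otimes> h \<otimes> inv (inv g))" using h True by (intro cl[symmetric]) auto
        then show "a (inv h \<otimes> g) * z (inv (inv h \<otimes> g) \<otimes> g) = z h * a (inv h \<otimes> g)"
          using h True by (simp add: inv_mult_group)
      next
        fix h assume h: "h \<in> carrier G"
        show "inv (g \<otimes> inv h) \<otimes> g = h" using h True by (simp add: inv_mult_group m_assoc)
        show "g \<otimes> inv h \<in> carrier G" using h True by simp
      qed
      then show ?thesis using True by (simp add: gr_mult_def)
    qed (simp add: gr_mult_def)
  qed
  then show ?thesis using z by (simp add: gr_center_def)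
qed

text \<open>The class function property is recorded separately, because centrality in
  \<open>R[G]\<close> is deduced from it at the end.\<close>

theorem (in group) is_nr_nr:
  fixes H :: "nat \<Rightarrow> nat \<Rightarrow> 'a \<Rightarrow> 'f::field"
  assumes fin: "finite (carrier G)" and char0: "\<And>n. n > 0 \<Longrightarrow> of_nat n \<noteq> (0 :: 'f)"
  shows "is_nr G n H (nr G n H)"
    and "\<And>g h. g \<in> carrier G \<Longrightarrow> h \<in> carrier G \<Longrightarrow> nr G n H (h \<otimes> g \<otimes> inv h) = nr G n H g"
proof -
  have char0': "of_nat n \<noteq> (0 :: 'f alg_closure)" if "n > 0" for n
    using char0[OF that] by (metis to_ac_eq_0_iff to_ac_of_nat)
  define K where "K = (\<lambda>i j g. to_ac (H i j g))"
  define s where "s d \<rho> = det (block_rep G d \<rho> n K)" for d and \<rho> :: "'a \<Rightarrow> 'f alg_closure mat"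
  have s_iso: "s d \<rho> = s e \<tau>" if irr: "is_irrep G d \<rho>" "is_irrep G e \<tau>" "rep_iso G d \<rho> e \<tau>" for d \<rho> e \<tau>
  proof -
    obtain T where T: "d = e" "T \<in> carrier_mat d d" "det T \<noteq> 0" "\<And>g. g \<in> carrier G \<Longrightarrow> \<rho> g * T = T * \<tau> g"
      using irr(3) unfolding rep_iso_def by blast
    have "\<And>g. g \<in> carrier G \<Longrightarrow> \<rho> g \<in> carrier_mat d d" "\<And>g. g \<in> carrier G \<Longrightarrow> \<tau> g \<in> carrier_mat d d"
      using is_repD(1)[OF is_irrepD(1)[OF irr(1)]] is_repD(1)[OF is_irrepD(1)[OF irr(2)]] T(1) by auto
    from det_block_rep_iso[OF T(2,3) this T(4)] show ?thesis by (simp add: s_def T(1))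
  qed
  obtain z where cl: "\<And>g h. g \<in> carrier G \<Longrightarrow> h \<in> carrier G \<Longrightarrow> z (h \<otimes> g \<otimes> inv h) = z g"
    and z: "\<And>d \<rho>. is_irrep G d \<rho> \<Longrightarrow> alg_act G d \<rho> z = s d \<rho> \<cdot>\<^sub>m 1\<^sub>m d"
    using central_element_of_scalars[of s, OF fin char0' s_iso] by metis
  have "z g \<in> range to_ac" if g: "g \<in> carrier G" for g
  proof (rule ccontr)
    assume ng: "z g \<notin> range to_ac"
    have sub: "subring_of (range (to_ac :: 'f \<Rightarrow> _))"
      unfolding subring_of_def by (auto simp flip: to_ac_0 to_ac_1 to_ac_add to_ac_diff to_ac_mult)
    have inv: "inverse a \<in> range to_ac" if "a \<in> range (to_ac :: 'f \<Rightarrow> _)" for a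
      using that by (auto simp flip: to_ac_inverse)
    have alg: "\<exists>p. p \<noteq> 0 \<and> (\<forall>i. coeff p i \<in> range to_ac) \<and> poly p x = 0" for x :: "'f alg_closure"
    proof -
      obtain p :: "'f poly" where p: "p \<noteq> 0" "poly (map_poly to_ac p) x = 0" by (rule alg_closure_algebraic)
      then show ?thesis
        by (intro exI[of _ "map_poly to_ac p"]) (auto simp: coeff_map_poly map_poly_eq_0_iff)
    qed
    obtain \<sigma> :: "'f alg_closure \<Rightarrow> 'f alg_closure" where bij: "bij \<sigma>" and one: "\<sigma> 1 = 1"
      and hom: "\<And>a b. \<sigma> (a + b) = \<sigma> a + \<sigma> b" "\<And>a b. \<sigma> (a * b) = \<sigma> a * \<sigma> b"
      and fix_F: "\<And>a. \<sigma> (to_ac a) = to_ac a" and neq: "\<sigma> (z g) \<noteq> z g"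
      using automorphism_moving[OF sub inv alg char0' ng] by blast
    have zero: "\<sigma> 0 = 0" using hom(1)[of 0 0] by (metis add.right_neutral add_left_cancel)
    have \<sigma>: "comm_ring_hom \<sigma>"
      by unfold_locales (auto simp: hom one zero)
    define \<theta> where "\<theta> = inv_into UNIV \<sigma>"
    have \<sigma>\<theta>: "\<sigma> (\<theta> x) = x" and \<theta>\<sigma>: "\<theta> (\<sigma> x) = x" for x
      using bij by (auto simp: \<theta>_def bij_is_surj surj_f_inv_f bij_is_inj)
    have \<theta>: "comm_ring_hom \<theta>"
      by unfold_locales (metis \<sigma>\<theta> \<theta>\<sigma> hom one zero)+
    have bij\<theta>: "bij \<theta>" using bij by (simp add: \<theta>_def bij_imp_bij_inv)
    \<comment> \<open>The image of \<open>z\<close> under \<open>\<sigma>\<close> acts on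
      \<open>\<rho>\<close> as \<open>z\<close> acts on the conjugate \<open>\<rho>'\<close>,
      transported back by \<open>\<sigma>\<close>. Since \<open>\<sigma>\<close> fixes the entries
      of \<open>K\<close>, it carries the scalar \<open>s d \<rho>'\<close> to
      \<open>s d \<rho>\<close>, so \<open>z\<close> and its image act alike.\<close>
    have "alg_act G d \<rho> (\<lambda>g. \<sigma> (z g)) = alg_act G d \<rho> z" if \<rho>: "is_irrep G d \<rho>" for d \<rho>
    proof -
      note c = is_repD(1)[OF is_irrepD(1)[OF \<rho>]]
      define \<rho>' where "\<rho>' g = map_mat \<theta> (\<rho> g)" for g
      have \<rho>': "is_irrep G d \<rho>'" unfolding \<rho>'_def
        by (rule is_irrep_map[OF \<theta> bij\<theta> \<rho>])
      note c' = is_repD(1)[OF is_irrepD(1)[OF \<rho>']]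
      have eq: "map_mat \<sigma> (\<rho>' g) = \<rho> g" for g by (intro eq_matI) (auto simp: \<rho>'_def \<sigma>\<theta>)
      interpret \<sigma>: comm_ring_hom \<sigma> by (rule \<sigma>)
      have "alg_act G d \<rho> (\<lambda>g. \<sigma> (z g)) = map_mat \<sigma> (alg_act G d \<rho>' z)"
        using alg_act_map[where G = G and \<rho> = \<rho>' and a = z, OF \<sigma> c'] by (simp add: eq)
      also have "\<dots> = \<sigma> (s d \<rho>') \<cdot>\<^sub>m 1\<^sub>m d"
        unfolding z[OF \<rho>'] by (intro eq_matI) (auto simp: zero one)
      also have "\<sigma> (s d \<rho>') = s d \<rho>"
      proof -
        have "block_rep G d \<rho> n K = map_mat \<sigma> (block_rep G d \<rho>' n K)"
          using block_rep_map[where G = G and \<rho> = \<rho>' and n = n and K = K, OF \<sigma> c'] by (simp add: eq K_def fix_F)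
        then show ?thesis by (simp add: s_def)
      qed
      finally show ?thesis using z[OF \<rho>] by simp
    qed
    from alg_act_eqI[OF fin char0' this g] neq show False by simp
  qed
  then have zF: "to_ac (of_ac (z g)) = z g" if "g \<in> carrier G" for g using that by (simp add: to_ac_of_ac)
  \<comment> \<open>Nothing is known about \<open>z\<close> outside the carrier, whereas elements of
    \<open>group_ring\<close> vanish there; this also makes \<open>y\<close> unique as a
    function.\<close>
  define y where "y g = (if g \<in> carrier G then of_ac (z g) else 0)" for g
  have y_cl: "y (h \<otimes> g \<otimes> inv h) = y g" if "g \<in> carrier G" "h \<in> carrier G" for g h
    using that cl by (simp add: y_def)
  have "y \<in> gr_center G UNIV"
    by (rule class_function_central) (auto simp: group_ring_def y_def y_cl, simp_all add: cl)
  moreover have "rep_ext G d \<rho> y = det (rep_ext_mat G d \<rho> n H) \<cdot>\<^sub>m 1\<^sub>m d" if "is_irrep G d \<rho>" for d \<rho>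
  proof -
    have "rep_ext G d \<rho> y = alg_act G d \<rho> z"
      unfolding rep_ext_eq alg_act_def by (intro eq_matI) (auto simp: y_def zF)
    then show ?thesis using z[OF that] by (simp add: rep_ext_mat_eq s_def K_def)
  qed
  ultimately have nr_y: "is_nr G n H y" by (auto simp: is_nr_def)
  have uniq: "w = y" if w: "is_nr G n H w" for w
  proof
    fix g
    show "w g = y g"
    proof (cases "g \<in> carrier G")
      case True
      have "to_ac (w g) = to_ac (y g)"
        using w nr_y True unfolding is_nr_def rep_ext_eq
        by (intro alg_act_eqI[OF fin char0', of "\<lambda>g. to_ac (w g)" "\<lambda>g. to_ac (y g)"]) auto
      then show ?thesis by simp
    next
      case False
      then show ?thesis using w by (auto simp: is_nr_def gr_center_def group_ring_def y_def)
    qed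
  qed
  have "nr G n H = y" unfolding nr_def using nr_y uniq by (rule the_equality)
  then show "is_nr G n H (nr G n H)"
    "\<And>g h. g \<in> carrier G \<Longrightarrow> h \<in> carrier G \<Longrightarrow> nr G n H (h \<otimes> g \<otimes> inv h) = nr G n H g"
    using nr_y y_cl by auto
qed

section \<open>Integral forms and linear characters\<close>

text \<open>Divisibility in a valuation ring is total, so a finite set of nonzero elements has a
  member \<open>m\<close> of least valuation.\<close>

lemma valuation_subring_dominant:
  assumes A: "valuation_subring A" and D: "finite D" "D \<noteq> {}" "0 \<notin> D"
  shows "\<exists>m\<in>D. \<forall>x\<in>D. x / m \<in> A"
  using D
proof (induction D rule: finite_ne_induct)
  have sub: "subring_of A" using A by (simp add: valuation_subring_def)
  {
    case (singleton x)
    then show ?case using subring_of_one[OF sub] by simp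
  next
    case (insert x D)
    then obtain m where m: "m \<in> D" "\<And>y. y \<in> D \<Longrightarrow> y / m \<in> A" by auto
    have nz: "m \<noteq> 0" "x \<noteq> 0" using m insert.prems by auto
    show ?case
    proof (cases "x / m \<in> A")
      case True
      then show ?thesis using m by (intro bexI[of _ m]) auto
    next
      case False
      then have mx: "m / x \<in> A"
        using A unfolding valuation_subring_def by (metis inverse_divide)
      have "y / x \<in> A" if "y \<in> D" for y
        using subring_of_mult[OF sub m(2)[OF that] mx] nz by simp
      then show ?thesis using nz subring_of_one[OF sub] by (intro bexI[of _ x]) auto
    qed
  }
qed

text \<open>Among the \<open>d\<close>-tuples of vectors \<open>\<rho> g e\<^sub>j\<close>, one whose determinant has minimal
  valuation is a basis of the lattice spanned by all of them, by Cramer's rule.\<close>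

lemma (in group) integral_form:
  fixes \<rho> :: "'a \<Rightarrow> 'k::field mat"
  assumes A: "valuation_subring A" and fin: "finite (carrier G)" and \<rho>: "is_rep G d \<rho>"
  obtains T \<tau> where "T \<in> carrier_mat d d" "det T \<noteq> 0"
    "\<And>g. g \<in> carrier G \<Longrightarrow> \<tau> g \<in> carrier_mat d d"
    "\<And>g. g \<in> carrier G \<Longrightarrow> \<rho> g * T = T * \<tau> g"
    "\<And>g i j. g \<in> carrier G \<Longrightarrow> i < d \<Longrightarrow> j < d \<Longrightarrow> \<tau> g $$ (i, j) \<in> A"
proof -
  have sub: "subring_of A" using A by (simp add: valuation_subring_def)
  note c = is_repD(1)[OF \<rho>]
  define M where "M f = mat d d (\<lambda>(i, j). \<rho> (fst (f j)) $$ (i, snd (f j)))" for f :: "nat \<Rightarrow> 'a \<times> nat"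
  define I where "I = ({..<d} \<rightarrow>\<^sub>E carrier G \<times> {..<d})"
  have finI: "finite I" unfolding I_def by (intro finite_PiE) (auto simp: fin)
  define D where "D = (\<lambda>f. det (M f)) ` I - {0}"
  have "1 \<in> D"
  proof -
    \<comment> \<open>The unit vectors themselves form one of the tuples, with determinant 1, so
      \<open>D\<close> is not empty.\<close>
    define f where "f = restrict (\<lambda>j. (\<one>, j)) {..<d}"
    have "f \<in> I" by (auto simp: f_def I_def)
    moreover have "M f = 1\<^sub>m d" using is_repD(2)[OF \<rho>] by (intro eq_matI) (auto simp: M_def f_def)
    then have "det (M f) = 1" by simp
    ultimately show ?thesis unfolding D_def by (metis Diff_iff image_eqI singletonD zero_neq_one)
  qed
  then have "\<exists>m\<in>D. \<forall>x\<in>D. x / m \<in> A"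
    using finI by (intro valuation_subring_dominant[OF A]) (auto simp: D_def)
  then obtain f where f: "f \<in> I" "det (M f) \<noteq> 0" and dom: "\<And>x. x \<in> D \<Longrightarrow> x / det (M f) \<in> A"
    by (auto simp: D_def)
  define T where "T = M f"
  have T: "T \<in> carrier_mat d d" by (simp add: T_def M_def)
  obtain S where S: "S \<in> carrier_mat d d" "T * S = 1\<^sub>m d" "S * T = 1\<^sub>m d"
    using det_nonzero_inverse[OF T] f by (metis T_def)
  define \<tau> where "\<tau> g = S * (\<rho> g * T)" for g
  have \<tau>c: "\<tau> g \<in> carrier_mat d d" if "g \<in> carrier G" for g using c[OF that] S T by (auto simp: \<tau>_def)
  have comm: "\<rho> g * T = T * \<tau> g" if "g \<in> carrier G" for g
  proof -
    have "T * \<tau> g = (T * S) * (\<rho> g * T)" unfolding \<tau>_def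
      using c[OF that] S T by (intro assoc_mult_mat[symmetric]) auto
    then show ?thesis using S c[OF that] T by simp
  qed
  have "\<tau> g $$ (i, j) \<in> A" if g: "g \<in> carrier G" and ij: "i < d" "j < d" for g i j
  proof -
    \<comment> \<open>Replacing vector \<open>i\<close> of the tuple \<open>f\<close> by
      \<open>\<rho> g\<close> applied to vector \<open>j\<close> gives another tuple of translates.
      By Cramer's rule the entry \<open>(i, j)\<close> of \<open>\<tau> g\<close> is the quotient of
      the two determinants.\<close>
    define f' where "f' = f(i := (g \<otimes> fst (f j), snd (f j)))"
    have fj: "fst (f j) \<in> carrier G" "snd (f j) < d"
      using f ij by (auto simp: I_def PiE_def Pi_def)
    have f': "f' \<in> I" using f fj g ij by (auto simp: I_def f'_def PiE_iff extensional_def)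
    have colx: "T *\<^sub>v col (\<tau> g) j = col (\<rho> g * T) j"
      using ij T \<tau>c[OF g] comm[OF g] by (simp add: col_mult2[of _ d d _ d])
    have "replace_col T (T *\<^sub>v col (\<tau> g) j) i = M f'"
    proof (rule eq_matI)
      fix a b assume "a < dim_row (M f')" "b < dim_col (M f')"
      then have ab: "a < d" "b < d" by (auto simp: M_def)
      show "replace_col T (T *\<^sub>v col (\<tau> g) j) i $$ (a, b) = M f' $$ (a, b)"
      proof (cases "b = i")
        case True
        have "replace_col T (T *\<^sub>v col (\<tau> g) j) i $$ (a, b) = (\<rho> g * T) $$ (a, j)"
          using True ab ij T c[OF g] unfolding colx by (simp add: replace_col_def)
        also have "\<dots> = (\<Sum>k<d. \<rho> g $$ (a, k) * T $$ (k, j))"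
          by (rule mult_mat_index[OF c[OF g] T ab(1) ij(2)])
        also have "\<dots> = (\<Sum>k<d. \<rho> g $$ (a, k) * \<rho> (fst (f j)) $$ (k, snd (f j)))"
          using ij by (simp add: T_def M_def)
        also have "\<dots> = \<rho> (g \<otimes> fst (f j)) $$ (a, snd (f j))"
          unfolding is_repD(3)[OF \<rho> g fj(1)] by (rule mult_mat_index[OF c[OF g] c[OF fj(1)] ab(1) fj(2), symmetric])
        finally show ?thesis using True ab by (simp add: M_def f'_def)
      next
        case False
        then show ?thesis using ab T by (simp add: replace_col_def f'_def M_def T_def)
      qed
    qed (use T in \<open>auto simp: replace_col_def M_def\<close>)
    then have eq: "det (M f') = \<tau> g $$ (i, j) * det T"
      using cramer_lemma_mat[OF T _ ij(1), of "col (\<tau> g) j"] \<tau>c[OF g] ij by auto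
    show ?thesis
    proof (cases "det (M f') = 0")
      case True
      then show ?thesis using eq f subring_of_zero[OF sub] by (auto simp: T_def)
    next
      case False
      then have "det (M f') / det (M f) \<in> A" using f' by (intro dom) (auto simp: D_def)
      then show ?thesis using eq f by (simp add: T_def)
    qed
  qed
  then show thesis using that T f \<tau>c comm by (metis T_def)
qed

text \<open>Each eigenspace of \<open>\<rho> g\<close> is invariant under the whole commutative
  group, so \<open>\<rho> g\<close> is scalar; then every line is invariant, in particular the one
  spanned by the first unit vector.\<close>

lemma (in comm_group) irrep_dim_1:
  fixes \<rho> :: "'a \<Rightarrow> 'k::alg_closed_field mat"
  assumes \<rho>: "is_irrep G d \<rho>"
  shows "d = 1"
proof -
  note r = is_repD[OF is_irrepD(1)[OF \<rho>]]
  have scalar: "\<exists>e. \<forall>v\<in>carrier_vec d. \<rho> g *\<^sub>v v = e \<cdot>\<^sub>v v" if g: "g \<in> carrier G" for g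
  proof -
    note c = r(1)[OF g]
    obtain e where "poly (char_poly (\<rho> g)) e = 0"
      using degree_monic_char_poly[OF c] alg_closed_imp_poly_has_root[of "char_poly (\<rho> g)"] is_irrepD(2)[OF \<rho>] by auto
    then have "eigenvalue (\<rho> g) e" using eigenvalue_root_char_poly[OF c] by simp
    then obtain v where v: "v \<in> carrier_vec d" "v \<noteq> 0\<^sub>v d" "\<rho> g *\<^sub>v v = e \<cdot>\<^sub>v v"
      using c unfolding eigenvalue_def eigenvector_def by auto
    define W where "W = {v \<in> carrier_vec d. \<rho> g *\<^sub>v v = e \<cdot>\<^sub>v v}"
    have "W = {0\<^sub>v d} \<or> W = carrier_vec d"
    proof (rule is_irrepD(3)[OF \<rho>])
      show "vec_subspace d W" unfolding vec_subspace_def W_def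
        using c by (auto simp: mult_add_distrib_mat_vec[OF c] smult_add_distrib_vec mult_mat_vec[OF c]
            smult_smult_assoc mult.commute)
      fix h w assume h: "h \<in> carrier G" and w: "w \<in> W"
      have "\<rho> g *\<^sub>v (\<rho> h *\<^sub>v w) = \<rho> (g \<otimes> h) *\<^sub>v w"
        using c r(1)[OF h] w g h by (simp add: r(3) W_def)
      also have "\<dots> = \<rho> (h \<otimes> g) *\<^sub>v w" using g h by (simp add: m_comm)
      also have "\<dots> = \<rho> h *\<^sub>v (e \<cdot>\<^sub>v w)"
        using c r(1)[OF h] w g h by (simp add: r(3) W_def)
      finally show "\<rho> h *\<^sub>v w \<in> W" using r(1)[OF h] w by (simp add: W_def mult_mat_vec[OF r(1)[OF h]])
    qed
    moreover have "v \<in> W" using v by (simp add: W_def)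
    ultimately have "W = carrier_vec d" using v(2) by blast
    then show ?thesis by (auto simp: W_def)
  qed
  have d0: "d > 0" by (rule is_irrepD(2)[OF \<rho>])
  define W where "W = {v \<in> carrier_vec d. \<forall>i<d. i \<noteq> 0 \<longrightarrow> v $ i = (0 :: 'k)}"
  have "W = {0\<^sub>v d} \<or> W = carrier_vec d"
  proof (rule is_irrepD(3)[OF \<rho>])
    show "vec_subspace d W" by (auto simp: vec_subspace_def W_def)
    fix g v assume g: "g \<in> carrier G" and v: "v \<in> W"
    obtain e where "\<rho> g *\<^sub>v v = e \<cdot>\<^sub>v v" using scalar[OF g] v by (auto simp: W_def)
    then show "\<rho> g *\<^sub>v v \<in> W" using v by (auto simp: W_def)
  qed
  moreover have "unit_vec d 0 \<in> W" by (auto simp: W_def)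
  moreover have "unit_vec d 0 \<noteq> (0\<^sub>v d :: 'k vec)" using d0 by (metis index_unit_vec(2) index_zero_vec(1) one_neq_zero)
  ultimately have W: "W = carrier_vec d" by blast
  show ?thesis
  proof (rule ccontr)
    assume "d \<noteq> 1"
    then have d1: "1 < d" using d0 by simp
    have "unit_vec d 1 \<in> W" by (simp add: W)
    then show False using d1 by (auto simp: W_def)
  qed
qed

section \<open>Linear characters and twists\<close>

definition linear_character :: "('g, 'b) monoid_scheme \<Rightarrow> ('g \<Rightarrow> 'k::field) \<Rightarrow> bool" where
  "linear_character G l \<longleftrightarrow> l \<one>\<^bsub>G\<^esub> = 1 \<and> (\<forall>g\<in>carrier G. \<forall>h\<in>carrier G. l (g \<otimes>\<^bsub>G\<^esub> h) = l g * l h)"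

text \<open>The list consists of the composition factors of the regular representation of the
  commutative quotient \<open>G / G'\<close>, inflated to \<open>G\<close>; they are
  one-dimensional, and \<open>m\<close> is the index of \<open>G'\<close>.\<close>

lemma (in group) linear_characters_sum:
  assumes fin: "finite (carrier G)"
  shows "\<exists>(ls :: ('a \<Rightarrow> 'k::alg_closed_field) list) m. m > 0 \<and> (\<forall>l\<in>set ls. linear_character G l) \<and>
    (\<forall>g\<in>carrier G. (\<Sum>l\<leftarrow>ls. l g) = (if g \<in> derived G (carrier G) then of_nat m else 0))"
proof -
  define D where "D = derived G (carrier G)"
  interpret D: normal D G unfolding D_def by (rule derived_self_is_normal)
  interpret Q: comm_group "G Mod D" unfolding D_def by (rule derived_quot_is_comm_group)
  have finQ: "finite (carrier (G Mod D))" unfolding carrier_FactGroup using fin by simp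
  obtain L :: "(nat \<times> ('a set \<Rightarrow> 'k mat)) list" where L: "\<And>e \<tau>. (e, \<tau>) \<in> set L \<Longrightarrow> is_irrep (G Mod D) e \<tau>"
    and tr: "\<And>x. x \<in> carrier (G Mod D) \<Longrightarrow>
      (\<Sum>(e, \<tau>)\<leftarrow>L. mtrace (\<tau> x)) = (if x = \<one>\<^bsub>G Mod D\<^esub> then of_nat (card (carrier (G Mod D))) else 0)"
    using Q.regular_character[OF finQ] by blast
  define ls where "ls = map (\<lambda>(e, \<tau>) g. \<tau> (D #> g) $$ (0, 0)) L"
  have cos: "D #> g \<in> carrier (G Mod D)" if "g \<in> carrier G" for g
    unfolding carrier_FactGroup using that by simp
  have "linear_character G l" if mem: "l \<in> set ls" for l
  proof -
    obtain e \<tau> where et: "(e, \<tau>) \<in> set L" and l: "l = (\<lambda>g. \<tau> (D #> g) $$ (0, 0))"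
      using mem by (auto simp: ls_def)
    have e: "e = 1" by (rule Q.irrep_dim_1[OF L[OF et]])
    note r = is_repD[OF is_irrepD(1)[OF L[OF et]], unfolded e]
    have one: "D #> \<one> = \<one>\<^bsub>G Mod D\<^esub>" using D.subset by (simp add: FactGroup_def coset_mult_one)
    have "\<tau> (D #> (g \<otimes> h)) $$ (0, 0) = \<tau> (D #> g) $$ (0, 0) * \<tau> (D #> h) $$ (0, 0)"
      if gh: "g \<in> carrier G" "h \<in> carrier G" for g h
    proof -
      have "D #> (g \<otimes> h) = (D #> g) \<otimes>\<^bsub>G Mod D\<^esub> (D #> h)"
        using D.r_coset_hom_Mod gh by (auto simp: hom_def)
      then show ?thesis using r(3)[OF cos[OF gh(1)] cos[OF gh(2)]]
        mult_mat_index[OF r(1)[OF cos[OF gh(1)]] r(1)[OF cos[OF gh(2)]], of 0 0] by simp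
    qed
    then show ?thesis unfolding linear_character_def l using one r(2) by simp
  qed
  moreover have "(\<Sum>l\<leftarrow>ls. l g) = (if g \<in> D then of_nat (card (carrier (G Mod D))) else 0)" if g: "g \<in> carrier G" for g
  proof -
    have "(\<Sum>l\<leftarrow>ls. l g) = (\<Sum>(e, \<tau>)\<leftarrow>L. \<tau> (D #> g) $$ (0, 0))"
      by (simp add: ls_def case_prod_unfold comp_def)
    also have "\<dots> = (\<Sum>(e, \<tau>)\<leftarrow>L. mtrace (\<tau> (D #> g)))"
    proof (intro arg_cong[of _ _ sum_list] map_cong refl, clarify)
      fix e \<tau> assume et: "(e, \<tau>) \<in> set L"
      have e: "e = 1" by (rule Q.irrep_dim_1[OF L[OF et]])
      show "\<tau> (D #> g) $$ (0, 0) = mtrace (\<tau> (D #> g))"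
        using is_repD(1)[OF is_irrepD(1)[OF L[OF et]] cos[OF g]] by (simp add: mtrace_def e)
    qed
    also have "\<dots> = (if D #> g = D then of_nat (card (carrier (G Mod D))) else 0)"
      using tr[OF cos[OF g]] by (simp add: FactGroup_def)
    also have "D #> g = D \<longleftrightarrow> g \<in> D"
      using g coset_join1[OF _ g D.is_subgroup] coset_join2[OF g D.is_subgroup] D.subset by blast
    finally show ?thesis .
  qed
  moreover have "card (carrier (G Mod D)) > 0" using finQ Q.one_closed by (auto simp: card_gt_0_iff)
  ultimately show ?thesis unfolding D_def by blast
qed

text \<open>A linear character has nonzero values, so \<open>\<rho>\<close> and its twist have the
  same invariant subspaces.\<close>

lemma (in group) is_irrep_twist:
  assumes l: "linear_character G l" and \<rho>: "is_irrep G d \<rho>"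
  shows "is_irrep G d (\<lambda>g. l g \<cdot>\<^sub>m \<rho> g)"
proof -
  note r = is_repD[OF is_irrepD(1)[OF \<rho>]]
  have "is_rep G d (\<lambda>g. l g \<cdot>\<^sub>m \<rho> g)"
    unfolding is_rep_def
  proof (intro conjI ballI)
    show "l \<one> \<cdot>\<^sub>m \<rho> \<one> = 1\<^sub>m d" using r(2) l by (intro eq_matI) (auto simp: linear_character_def)
    fix g h assume gh: "g \<in> carrier G" "h \<in> carrier G"
    have "(l g \<cdot>\<^sub>m \<rho> g) * (l h \<cdot>\<^sub>m \<rho> h) = (l g * l h) \<cdot>\<^sub>m (\<rho> g * \<rho> h)"
      using r(1)[OF gh(1)] r(1)[OF gh(2)]
      by (simp add: mult_smult_assoc_mat[of _ d d _ d] mult_smult_distrib[of _ d d _ d]) (intro eq_matI; simp)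
    then show "l (g \<otimes> h) \<cdot>\<^sub>m \<rho> (g \<otimes> h) = (l g \<cdot>\<^sub>m \<rho> g) * (l h \<cdot>\<^sub>m \<rho> h)"
      using gh l r(3) by (simp add: linear_character_def)
  qed (use r in auto)
  moreover have "W = {0\<^sub>v d} \<or> W = carrier_vec d"
    if W: "vec_subspace d W" and inv: "\<And>g v. g \<in> carrier G \<Longrightarrow> v \<in> W \<Longrightarrow> (l g \<cdot>\<^sub>m \<rho> g) *\<^sub>v v \<in> W" for W
  proof (rule is_irrepD(3)[OF \<rho> W])
    fix g v assume g: "g \<in> carrier G" and v: "v \<in> W"
    have "l g * l (inv g) = 1" using g l unfolding linear_character_def by (metis inv_closed r_inv)
    then have nz: "l g \<noteq> 0" by auto
    have vc: "v \<in> carrier_vec d" using W v by (auto simp: vec_subspace_def)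
    have "inverse (l g) \<cdot>\<^sub>v ((l g \<cdot>\<^sub>m \<rho> g) *\<^sub>v v) = \<rho> g *\<^sub>v v"
      using r(1)[OF g] vc nz by (intro eq_vecI) auto
    moreover have "inverse (l g) \<cdot>\<^sub>v ((l g \<cdot>\<^sub>m \<rho> g) *\<^sub>v v) \<in> W"
      using W inv[OF g v] by (auto simp: vec_subspace_def)
    ultimately show "\<rho> g *\<^sub>v v \<in> W" by simp
  qed
  ultimately show ?thesis using is_irrepD(2)[OF \<rho>] unfolding is_irrep_iff by blast
qed

text \<open>The functions on \<open>Y\<close> obtained by evaluating elements of the group ring
  \<open>A[G]\<close> at linear characters. They form a ring, which therefore contains the
  determinants of matrices over it; this keeps the coefficients in \<open>A\<close>.\<close>

definition character_combination ::
    "('g, 'b) monoid_scheme \<Rightarrow> 'k::field set \<Rightarrow> ('g \<Rightarrow> 'k) set \<Rightarrow> (('g \<Rightarrow> 'k) \<Rightarrow> 'k) \<Rightarrow> bool" where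
  "character_combination G A Y \<phi> \<longleftrightarrow>
    (\<exists>a. (\<forall>g\<in>carrier G. a g \<in> A) \<and> (\<forall>l\<in>Y. \<phi> l = (\<Sum>g\<in>carrier G. a g * l g)))"

context group
begin

context
  fixes A :: "'k::field set" and Y :: "('a \<Rightarrow> 'k) set"
  assumes A: "subring_of A" and fin: "finite (carrier G)" and Y: "\<And>l. l \<in> Y \<Longrightarrow> linear_character G l"
begin

lemma character_combination_const:
  assumes "c \<in> A"
  shows "character_combination G A Y (\<lambda>_. c)"
proof -
  have "c = (\<Sum>g\<in>carrier G. (if g = \<one> then c else 0) * l g)" if "l \<in> Y" for l
    using Y[OF that] fin by (simp add: if_distrib[of "\<lambda>x. x * _"] linear_character_def cong: if_cong)
  then show ?thesis unfolding character_combination_def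
    using assms subring_of_zero[OF A] by (intro exI[of _ "\<lambda>g. if g = \<one> then c else 0"]) auto
qed

lemma character_combination_add:
  assumes "character_combination G A Y \<phi>" "character_combination G A Y \<psi>"
  shows "character_combination G A Y (\<lambda>l. \<phi> l + \<psi> l)"
proof -
  obtain a b where "\<And>g. g \<in> carrier G \<Longrightarrow> a g \<in> A" "\<And>l. l \<in> Y \<Longrightarrow> \<phi> l = (\<Sum>g\<in>carrier G. a g * l g)"
    "\<And>g. g \<in> carrier G \<Longrightarrow> b g \<in> A" "\<And>l. l \<in> Y \<Longrightarrow> \<psi> l = (\<Sum>g\<in>carrier G. b g * l g)"
    using assms unfolding character_combination_def by blast
  then show ?thesis unfolding character_combination_def
    by (intro exI[of _ "\<lambda>g. a g + b g"]) (auto intro: subring_of_add[OF A] simp: distrib_right sum.distrib)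
qed

text \<open>The coefficients of the product are the convolution of \<open>a\<close> and
  \<open>b\<close>, because the members of \<open>Y\<close> are multiplicative.\<close>

lemma character_combination_mult:
  assumes "character_combination G A Y \<phi>" "character_combination G A Y \<psi>"
  shows "character_combination G A Y (\<lambda>l. \<phi> l * \<psi> l)"
proof -
  obtain a b where a: "\<And>g. g \<in> carrier G \<Longrightarrow> a g \<in> A" "\<And>l. l \<in> Y \<Longrightarrow> \<phi> l = (\<Sum>g\<in>carrier G. a g * l g)"
    and b: "\<And>g. g \<in> carrier G \<Longrightarrow> b g \<in> A" "\<And>l. l \<in> Y \<Longrightarrow> \<psi> l = (\<Sum>g\<in>carrier G. b g * l g)"
    using assms unfolding character_combination_def by blast
  define c where "c g = (\<Sum>h\<in>carrier G. a h * b (inv h \<otimes> g))" for g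
  have "\<phi> l * \<psi> l = (\<Sum>g\<in>carrier G. c g * l g)" if l: "l \<in> Y" for l
  proof -
    have "(\<Sum>g\<in>carrier G. c g * l g) = (\<Sum>h\<in>carrier G. \<Sum>g\<in>carrier G. a h * b (inv h \<otimes> g) * l g)"
      unfolding c_def sum_distrib_right by (rule sum.swap)
    also have "\<dots> = (\<Sum>h\<in>carrier G. \<Sum>g\<in>carrier G. a h * b (inv h \<otimes> (h \<otimes> g)) * l (h \<otimes> g))"
      by (intro sum.cong refl sum_translate[symmetric])
    also have "\<dots> = (\<Sum>h\<in>carrier G. \<Sum>g\<in>carrier G. (a h * l h) * (b g * l g))"
      using Y[OF l] by (intro sum.cong refl) (simp add: linear_character_def m_assoc[symmetric])
    also have "\<dots> = \<phi> l * \<psi> l"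
      by (simp add: a(2)[OF l] b(2)[OF l] sum_product)
    finally show ?thesis ..
  qed
  moreover have "c g \<in> A" if "g \<in> carrier G" for g
    unfolding c_def using that by (intro subring_of_sum[OF A] subring_of_mult[OF A] a b) auto
  ultimately show ?thesis unfolding character_combination_def by blast
qed

lemma character_combination_sum:
  "(\<And>i. i \<in> I \<Longrightarrow> character_combination G A Y (\<phi> i)) \<Longrightarrow> character_combination G A Y (\<lambda>l. \<Sum>i\<in>I. \<phi> i l)"
  by (induction I rule: infinite_finite_induct)
    (auto intro: character_combination_add character_combination_const subring_of_zero[OF A])

lemma character_combination_prod:
  "(\<And>i. i \<in> I \<Longrightarrow> character_combination G A Y (\<phi> i)) \<Longrightarrow> character_combination G A Y (\<lambda>l. \<Prod>i\<in>I. \<phi> i l)"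
  by (induction I rule: infinite_finite_induct)
    (auto intro: character_combination_mult character_combination_const subring_of_one[OF A])

lemma character_combination_det:
  assumes M: "\<And>l. M l \<in> carrier_mat N N"
    and comb: "\<And>i j. i < N \<Longrightarrow> j < N \<Longrightarrow> character_combination G A Y (\<lambda>l. M l $$ (i, j))"
  shows "character_combination G A Y (\<lambda>l. det (M l))"
  unfolding det_def'[OF M]
proof (intro character_combination_sum character_combination_mult character_combination_prod comb)
  fix p :: "nat \<Rightarrow> nat"
  have "signof p \<in> A"
    by (cases p rule: sign_cases) (auto intro: subring_of_one[OF A] subring_of_uminus[OF A])
  then show "character_combination G A Y (\<lambda>l. signof p)" by (rule character_combination_const)
  fix i assume p: "p \<in> {p. p permutes {0..<N}}" and i: "i \<in> {0..<N}"
  show "i < N" using i by simp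
  show "p i < N" using p i by (simp add: permutes_in_image[of p "{0..<N}", unfolded atLeastLessThan_iff, simplified])
qed

end

text \<open>Restricting \<open>z\<close> to a coset of the commutator subgroup amounts to averaging over the
  twists of \<open>\<rho>\<close> by linear characters; on an integral form of \<open>\<rho>\<close> the twisted determinants
  are combinations of the linear characters with integral coefficients.\<close>

lemma coset_component_scalar:
  fixes z :: "'a \<Rightarrow> 'k::alg_closed_field"
  assumes A: "valuation_subring A" and fin: "finite (carrier G)"
    and char0: "\<And>n. n > 0 \<Longrightarrow> of_nat n \<noteq> (0 :: 'k)"
    and K: "\<And>i j g. i < n \<Longrightarrow> j < n \<Longrightarrow> g \<in> carrier G \<Longrightarrow> K i j g \<in> A"
    and z: "\<And>d \<rho>. is_irrep G d \<rho> \<Longrightarrow> alg_act G d \<rho> z = det (block_rep G d \<rho> n K) \<cdot>\<^sub>m 1\<^sub>m d"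
    and \<rho>: "is_irrep G d \<rho>" and y: "y \<in> carrier G"
  shows "\<exists>c\<in>A. alg_act G d \<rho> (\<lambda>g. if inv y \<otimes> g \<in> derived G (carrier G) then z g else 0) = c \<cdot>\<^sub>m 1\<^sub>m d"
proof -
  let ?D = "derived G (carrier G)"
  have sub: "subring_of A" using A by (simp add: valuation_subring_def)
  note r = is_repD[OF is_irrepD(1)[OF \<rho>]]
  obtain ls :: "('a \<Rightarrow> 'k) list" and m where m: "m > 0" and ls: "\<And>l. l \<in> set ls \<Longrightarrow> linear_character G l"
    and ls_sum: "\<And>g. g \<in> carrier G \<Longrightarrow> (\<Sum>l\<leftarrow>ls. l g) = (if g \<in> ?D then of_nat m else 0)"
    using linear_characters_sum[OF fin] by blast
  have m0: "of_nat m \<noteq> (0 :: 'k)" using char0 m .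
  obtain T \<tau> where T: "T \<in> carrier_mat d d" "det T \<noteq> 0"
    and \<tau>c: "\<And>g. g \<in> carrier G \<Longrightarrow> \<tau> g \<in> carrier_mat d d"
    and comm: "\<And>g. g \<in> carrier G \<Longrightarrow> \<rho> g * T = T * \<tau> g"
    and \<tau>A: "\<And>g i j. g \<in> carrier G \<Longrightarrow> i < d \<Longrightarrow> j < d \<Longrightarrow> \<tau> g $$ (i, j) \<in> A"
    using integral_form[OF A fin is_irrepD(1)[OF \<rho>]] by metis
  have "character_combination G A (set ls) (\<lambda>l. det (block_rep G d (\<lambda>g. l g \<cdot>\<^sub>m \<tau> g) n K))"
  proof (rule character_combination_det[OF sub fin ls block_rep_carrier])
    fix i j assume ij: "i < n * d" "j < n * d"
    then have d: "d > 0" by (cases d) auto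
    have q: "i div d < n" "j div d < n" "i mod d < d" "j mod d < d"
      using ij d by (auto simp: less_mult_imp_div_less)
    show "character_combination G A (set ls) (\<lambda>l. block_rep G d (\<lambda>g. l g \<cdot>\<^sub>m \<tau> g) n K $$ (i, j))"
      unfolding character_combination_def
    proof (intro exI[of _ "\<lambda>g. K (i div d) (j div d) g * \<tau> g $$ (i mod d, j mod d)"] conjI ballI)
      fix g assume "g \<in> carrier G"
      then show "K (i div d) (j div d) g * \<tau> g $$ (i mod d, j mod d) \<in> A"
        using q by (intro subring_of_mult[OF sub] K \<tau>A)
    next
      fix l
      show "block_rep G d (\<lambda>g. l g \<cdot>\<^sub>m \<tau> g) n K $$ (i, j) =
        (\<Sum>g\<in>carrier G. K (i div d) (j div d) g * \<tau> g $$ (i mod d, j mod d) * l g)"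
        using ij q carrier_matD[OF \<tau>c] by (auto simp: block_rep_def intro!: sum.cong)
    qed
  qed
  then obtain a where a: "\<And>g. g \<in> carrier G \<Longrightarrow> a g \<in> A"
    and deta: "\<And>l. l \<in> set ls \<Longrightarrow> det (block_rep G d (\<lambda>g. l g \<cdot>\<^sub>m \<tau> g) n K) = (\<Sum>g\<in>carrier G. a g * l g)"
    unfolding character_combination_def by blast
  \<comment> \<open>Conjugation by \<open>T\<close> commutes with twisting, so the determinant for
    the twist of \<open>\<rho>\<close> may be computed on the twist of \<open>\<tau>\<close>, where
    its coefficients are integral.\<close>
  have act: "alg_act G d (\<lambda>g. l g \<cdot>\<^sub>m \<rho> g) z = (\<Sum>g\<in>carrier G. a g * l g) \<cdot>\<^sub>m 1\<^sub>m d" if l: "l \<in> set ls" for l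
  proof -
    have "det (block_rep G d (\<lambda>g. l g \<cdot>\<^sub>m \<rho> g) n K) = det (block_rep G d (\<lambda>g. l g \<cdot>\<^sub>m \<tau> g) n K)"
    proof (rule det_block_rep_iso[OF T])
      fix g assume g: "g \<in> carrier G"
      show "l g \<cdot>\<^sub>m \<rho> g \<in> carrier_mat d d" "l g \<cdot>\<^sub>m \<tau> g \<in> carrier_mat d d" using r(1)[OF g] \<tau>c[OF g] by auto
      show "l g \<cdot>\<^sub>m \<rho> g * T = T * (l g \<cdot>\<^sub>m \<tau> g)"
        using r(1)[OF g] \<tau>c[OF g] T(1) comm[OF g]
        by (simp add: mult_smult_assoc_mat[of _ d d _ d] mult_smult_distrib[of _ d d _ d])
    qed
    then show ?thesis using z[OF is_irrep_twist[OF ls[OF l] \<rho>]] deta[OF l] by simp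
  qed
  \<comment> \<open>The sum of the integral coefficients over the coset \<open>y G'\<close>.\<close>
  define c where "c = (\<Sum>g\<in>carrier G. if inv y \<otimes> g \<in> ?D then a g else 0)"
  \<comment> \<open>Orthogonality, shifted by \<open>y\<close>. It is used twice below, for
    \<open>b\<close> the products of \<open>z\<close> with the entries of \<open>\<rho>\<close> and
    for \<open>b = a\<close>; the factor \<open>of_nat m\<close> then occurs on both sides and
    cancels, so \<open>c\<close> itself needs no division.\<close>
  have avg: "(\<Sum>l\<leftarrow>ls. l (inv y) * (\<Sum>g\<in>carrier G. b g * l g)) =
    of_nat m * (\<Sum>g\<in>carrier G. if inv y \<otimes> g \<in> ?D then b g else 0)" for b
  proof -
    have "(\<Sum>l\<leftarrow>ls. l (inv y) * (\<Sum>g\<in>carrier G. b g * l g)) = (\<Sum>l\<leftarrow>ls. \<Sum>g\<in>carrier G. b g * l (inv y \<otimes> g))"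
    proof (intro arg_cong[of _ _ sum_list] map_cong refl)
      fix l assume "l \<in> set ls"
      then have "l (inv y \<otimes> g) = l (inv y) * l g" if "g \<in> carrier G" for g
        using that ls y by (simp add: linear_character_def)
      then show "l (inv y) * (\<Sum>g\<in>carrier G. b g * l g) = (\<Sum>g\<in>carrier G. b g * l (inv y \<otimes> g))"
        unfolding sum_distrib_left by (intro sum.cong refl) (simp add: mult_ac)
    qed
    also have "\<dots> = (\<Sum>g\<in>carrier G. b g * (\<Sum>l\<leftarrow>ls. l (inv y \<otimes> g)))"
      by (simp add: sum_list_sum_swap sum_list_const_mult)
    also have "\<dots> = (\<Sum>g\<in>carrier G. of_nat m * (if inv y \<otimes> g \<in> ?D then b g else 0))"
      using y by (intro sum.cong refl) (simp add: ls_sum)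
    finally show ?thesis by (simp add: sum_distrib_left)
  qed
  have "alg_act G d \<rho> (\<lambda>g. if inv y \<otimes> g \<in> ?D then z g else 0) = c \<cdot>\<^sub>m 1\<^sub>m d"
  proof (rule eq_matI)
    fix i j assume "i < dim_row (c \<cdot>\<^sub>m 1\<^sub>m d)" "j < dim_col (c \<cdot>\<^sub>m 1\<^sub>m d)"
    then have ij: "i < d" "j < d" by auto
    have "of_nat m * alg_act G d \<rho> (\<lambda>g. if inv y \<otimes> g \<in> ?D then z g else 0) $$ (i, j) =
      of_nat m * (\<Sum>g\<in>carrier G. if inv y \<otimes> g \<in> ?D then z g * \<rho> g $$ (i, j) else 0)"
      unfolding alg_act_index[OF ij] by (intro arg_cong[of _ _ "\<lambda>x. _ * x"] sum.cong) auto
    also have "\<dots> = (\<Sum>l\<leftarrow>ls. l (inv y) * (\<Sum>g\<in>carrier G. z g * \<rho> g $$ (i, j) * l g))"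
      by (rule avg[symmetric])
    also have "\<dots> = (\<Sum>l\<leftarrow>ls. l (inv y) * alg_act G d (\<lambda>g. l g \<cdot>\<^sub>m \<rho> g) z $$ (i, j))"
      unfolding alg_act_index[OF ij] using ij carrier_matD[OF r(1)]
      by (intro arg_cong[of _ _ sum_list] map_cong refl arg_cong[of _ _ "\<lambda>x. _ * x"] sum.cong) auto
    also have "\<dots> = (\<Sum>l\<leftarrow>ls. l (inv y) * (\<Sum>g\<in>carrier G. a g * l g) * 1\<^sub>m d $$ (i, j))"
      using ij by (intro arg_cong[of _ _ sum_list] map_cong refl) (simp add: act)
    also have "\<dots> = of_nat m * c * 1\<^sub>m d $$ (i, j)"
      by (simp add: sum_list_mult_const avg c_def)
    finally show "alg_act G d \<rho> (\<lambda>g. if inv y \<otimes> g \<in> ?D then z g else 0) $$ (i, j) = (c \<cdot>\<^sub>m 1\<^sub>m d) $$ (i, j)"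
      using m0 ij by simp
  qed (auto simp: alg_act_def)
  moreover have "c \<in> A" unfolding c_def
    by (intro subring_of_sum[OF sub]) (auto intro: a subring_of_zero[OF sub])
  ultimately show ?thesis by blast
qed

lemma derived_order_times_coeff_integral:
  fixes z :: "'a \<Rightarrow> 'k::alg_closed_field"
  assumes A: "valuation_subring A" and fin: "finite (carrier G)"
    and char0: "\<And>n. n > 0 \<Longrightarrow> of_nat n \<noteq> (0 :: 'k)"
    and K: "\<And>i j g. i < n \<Longrightarrow> j < n \<Longrightarrow> g \<in> carrier G \<Longrightarrow> K i j g \<in> A"
    and z: "\<And>d \<rho>. is_irrep G d \<rho> \<Longrightarrow> alg_act G d \<rho> z = det (block_rep G d \<rho> n K) \<cdot>\<^sub>m 1\<^sub>m d"
    and g: "g \<in> carrier G"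
  shows "of_nat (card (derived G (carrier G))) * z g \<in> A"
proof -
  define D where "D = derived G (carrier G)"
  interpret D: normal D G unfolding D_def by (rule derived_self_is_normal)
  have sub: "subring_of A" using A by (simp add: valuation_subring_def)
  have finD: "finite D" using D.subset fin by (rule finite_subset)
  define M where "M = card D"
  obtain e where e: "bij_betw e {..<M} D"
    using ex_bij_betw_nat_finite[OF finD] by (auto simp: M_def lessThan_atLeast0)
  have eD: "e i \<in> D" if "i < M" for i using e that by (auto simp: bij_betw_def)
  \<comment> \<open>Left multiplication by \<open>w\<close> on \<open>k[G']\<close> in the basis
    \<open>e\<close>: the coefficients of \<open>w\<close> are \<open>z (g \<otimes> t)\<close>, and
    the entry taking \<open>e b\<close> to \<open>e a\<close> is the one at
    \<open>t = e a \<otimes> inv (e b)\<close>.\<close>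
  define W where "W = mat M M (\<lambda>(a, b). z (g \<otimes> (e a \<otimes> inv (e b))))"
  have Wc: "W \<in> carrier_mat M M" by (simp add: W_def)
  have "mtrace W = (\<Sum>i<M. z g)"
    unfolding mtrace_def using eD D.subset g by (intro sum.cong) (auto simp: W_def)
  then have trW: "mtrace W = of_nat M * z g" by simp
  have "mtrace W \<in> A"
  proof (rule mtrace_mem_subring[OF sub Wc])
    fix \<mu> assume "eigenvalue W \<mu>"
    then obtain v where v: "v \<in> carrier_vec M" "v \<noteq> 0\<^sub>v M" "W *\<^sub>v v = \<mu> \<cdot>\<^sub>v v"
      using Wc unfolding eigenvalue_def eigenvector_def by auto
    \<comment> \<open>The eigenvector as an element of \<open>k[G']\<close>, extended by zero to
      \<open>G\<close> so that an irreducible representation of \<open>G\<close> can detect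
      it.\<close>
    define u where "u t = (if t \<in> D then v $ the_inv_into {..<M} e t else 0)" for t
    have ue: "u (e i) = v $ i" if "i < M" for i
      using that e eD by (simp add: u_def bij_betw_def the_inv_into_f_f)
    obtain i0 where i0: "i0 < M" "v $ i0 \<noteq> 0"
    proof -
      have "\<exists>i<M. v $ i \<noteq> 0" using v(1,2) by (metis carrier_vecD eq_vecI index_zero_vec)
      then show thesis using that by blast
    qed
    have "e i0 \<in> carrier G" "u (e i0) \<noteq> 0" using i0 eD D.subset by (auto simp: ue)
    from exists_irrep_nonzero[where v = u, OF fin char0 this]
    obtain d \<rho> where \<rho>: "is_irrep G d \<rho>" and U0: "alg_act G d \<rho> u \<noteq> 0\<^sub>m d d" by blast
    note r = is_repD[OF is_irrepD(1)[OF \<rho>]]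
    define U where "U = alg_act G d \<rho> u"
    have U: "U \<in> carrier_mat d d" by (simp add: U_def)
    have eig: "(\<Sum>t'\<in>D. z (g \<otimes> (t \<otimes> inv t')) * u t') = \<mu> * u t" if t: "t \<in> D" for t
    proof -
      obtain i where i: "i < M" "t = e i" using t e by (auto simp: bij_betw_def)
      have "(\<Sum>t'\<in>D. z (g \<otimes> (t \<otimes> inv t')) * u t') = (\<Sum>j<M. z (g \<otimes> (t \<otimes> inv (e j))) * u (e j))"
        using sum.reindex_bij_betw[OF e, of "\<lambda>t'. z (g \<otimes> (t \<otimes> inv t')) * u t'"] by simp
      also have "\<dots> = (\<Sum>j<M. W $$ (i, j) * v $ j)"
        using i by (intro sum.cong refl) (simp add: W_def ue)
      also have "\<dots> = (W *\<^sub>v v) $ i" by (rule mult_mat_vec_index[OF Wc v(1) i(1), symmetric])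
      also have "\<dots> = \<mu> * u t" using i v by (simp add: ue)
      finally show ?thesis .
    qed
    let ?zg = "\<lambda>h. if inv g \<otimes> h \<in> D then z h else 0"
    obtain c where c: "c \<in> A" "alg_act G d \<rho> ?zg = c \<cdot>\<^sub>m 1\<^sub>m d"
      using coset_component_scalar[OF A fin char0 K z \<rho> g] unfolding D_def by blast
    \<comment> \<open>In \<open>k[G]\<close> the relation \<open>w u = \<mu> u\<close> multiplied by
      \<open>g\<close> reads \<open>z\<^sub>g u = \<mu> g u\<close>; this is its image under
      \<open>\<rho>\<close>, where \<open>z\<^sub>g\<close> is the scalar \<open>c\<close>.\<close>
    have "\<mu> \<cdot>\<^sub>m (\<rho> g * U) = c \<cdot>\<^sub>m U"
    proof (rule eq_matI)
      fix i j assume "i < dim_row (c \<cdot>\<^sub>m U)" "j < dim_col (c \<cdot>\<^sub>m U)"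
      then have ij: "i < d" "j < d" using U by auto
      have Uentry: "U $$ (k, j) = (\<Sum>t\<in>D. u t * \<rho> t $$ (k, j))" if "k < d" for k
        unfolding U_def alg_act_index[OF that ij(2)] using D.subset fin
        by (intro sum.mono_neutral_right) (auto simp: u_def)
      have "(\<mu> \<cdot>\<^sub>m (\<rho> g * U)) $$ (i, j) = \<mu> * (\<Sum>k<d. \<rho> g $$ (i, k) * U $$ (k, j))"
        using ij r(1)[OF g] U mult_mat_index[OF r(1)[OF g] U ij] by simp
      also have "\<dots> = (\<Sum>t\<in>D. (\<mu> * u t) * (\<Sum>k<d. \<rho> g $$ (i, k) * \<rho> t $$ (k, j)))"
        by (simp add: Uentry sum_distrib_left mult_ac sum.swap[of _ "{..<d}" D])
      also have "\<dots> = (\<Sum>t\<in>D. (\<mu> * u t) * \<rho> (g \<otimes> t) $$ (i, j))"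
        using D.subset g ij mult_mat_index[OF r(1)[OF g] r(1)]
        by (intro sum.cong refl) (auto simp: r(3) simp del: index_mult_mat)
      also have "\<dots> = (\<Sum>t\<in>D. \<Sum>t'\<in>D. z (g \<otimes> (t \<otimes> inv t')) * u t' * \<rho> (g \<otimes> t) $$ (i, j))"
        by (intro sum.cong refl) (simp add: sum_distrib_right flip: eig)
      also have "\<dots> = (\<Sum>t'\<in>D. \<Sum>t\<in>D. z (g \<otimes> (t \<otimes> inv t')) * u t' * \<rho> (g \<otimes> t) $$ (i, j))"
        by (rule sum.swap)
      \<comment> \<open>Substitution \<open>h = g \<otimes> (t \<otimes> inv t')\<close>: as
        \<open>t\<close> runs through \<open>G'\<close>, \<open>h\<close> runs through the coset
        \<open>g G'\<close>, outside of which \<open>?zg\<close> vanishes.\<close>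
      also have "\<dots> = (\<Sum>t'\<in>D. \<Sum>h\<in>carrier G. ?zg h * u t' * \<rho> (h \<otimes> t') $$ (i, j))"
      proof (rule sum.cong[OF refl])
        fix t' assume t': "t' \<in> D"
        have t'c: "t' \<in> carrier G" using t' D.subset by auto
        have "(\<Sum>t\<in>D. z (g \<otimes> (t \<otimes> inv t')) * u t' * \<rho> (g \<otimes> t) $$ (i, j)) =
          (\<Sum>h\<in>{h \<in> carrier G. inv g \<otimes> h \<in> D}. z h * u t' * \<rho> (h \<otimes> t') $$ (i, j))"
        proof (rule sum.reindex_bij_witness[of _ "\<lambda>h. inv g \<otimes> h \<otimes> t'" "\<lambda>t. g \<otimes> (t \<otimes> inv t')"])
          fix t assume t: "t \<in> D"
          then have tc: "t \<in> carrier G" using D.subset by auto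
          show "inv g \<otimes> (g \<otimes> (t \<otimes> inv t')) \<otimes> t' = t"
            using g tc t'c by (simp add: m_assoc[symmetric]) (simp add: m_assoc)
          have "inv g \<otimes> (g \<otimes> (t \<otimes> inv t')) = t \<otimes> inv t'"
            using g tc t'c by (simp add: m_assoc[symmetric])
          then show "g \<otimes> (t \<otimes> inv t') \<in> {h \<in> carrier G. inv g \<otimes> h \<in> D}"
            using g tc t'c t t' by simp
          have "g \<otimes> (t \<otimes> inv t') \<otimes> t' = g \<otimes> t" using g tc t'c by (simp add: m_assoc)
          then show "z (g \<otimes> (t \<otimes> inv t')) * u t' * \<rho> (g \<otimes> (t \<otimes> inv t') \<otimes> t') $$ (i, j) =
            z (g \<otimes> (t \<otimes> inv t')) * u t' * \<rho> (g \<otimes> t) $$ (i, j)" by simp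
        next
          fix h assume h: "h \<in> {h \<in> carrier G. inv g \<otimes> h \<in> D}"
          then show "inv g \<otimes> h \<otimes> t' \<in> D" using t' by simp
          have "inv g \<otimes> h \<otimes> t' \<otimes> inv t' = inv g \<otimes> h" using h g t'c by (simp add: m_assoc)
          then show "g \<otimes> (inv g \<otimes> h \<otimes> t' \<otimes> inv t') = h" using h g by (simp add: m_assoc[symmetric])
        qed
        also have "\<dots> = (\<Sum>h\<in>carrier G. ?zg h * u t' * \<rho> (h \<otimes> t') $$ (i, j))"
          by (rule sum.mono_neutral_cong_left) (auto simp: fin)
        finally show "(\<Sum>t\<in>D. z (g \<otimes> (t \<otimes> inv t')) * u t' * \<rho> (g \<otimes> t) $$ (i, j)) =
          (\<Sum>h\<in>carrier G. ?zg h * u t' * \<rho> (h \<otimes> t') $$ (i, j))" .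
      qed
      also have "\<dots> = (\<Sum>t'\<in>D. \<Sum>h\<in>carrier G. \<Sum>k<d. (?zg h * \<rho> h $$ (i, k)) * (u t' * \<rho> t' $$ (k, j)))"
      proof (intro sum.cong refl)
        fix t' h assume t': "t' \<in> D" and h: "h \<in> carrier G"
        have t'c: "t' \<in> carrier G" using t' D.subset by auto
        show "?zg h * u t' * \<rho> (h \<otimes> t') $$ (i, j) = (\<Sum>k<d. (?zg h * \<rho> h $$ (i, k)) * (u t' * \<rho> t' $$ (k, j)))"
          unfolding r(3)[OF h t'c] mult_mat_index[OF r(1)[OF h] r(1)[OF t'c] ij]
          by (simp add: sum_distrib_left mult_ac)
      qed
      also have "\<dots> = (\<Sum>k<d. (\<Sum>h\<in>carrier G. ?zg h * \<rho> h $$ (i, k)) * U $$ (k, j))"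
        by (simp add: Uentry sum_product sum.swap[of _ "{..<d}"] sum.swap[of _ "carrier G" D])
      also have "\<dots> = (\<Sum>k<d. alg_act G d \<rho> ?zg $$ (i, k) * U $$ (k, j))"
        using ij by (intro sum.cong refl) (simp add: alg_act_index)
      also have "\<dots> = (\<Sum>k<d. if k = i then c * U $$ (k, j) else 0)"
        using ij by (intro sum.cong refl) (simp add: c(2))
      also have "\<dots> = (c \<cdot>\<^sub>m U) $$ (i, j)" using ij U by simp
      finally show "(\<mu> \<cdot>\<^sub>m (\<rho> g * U)) $$ (i, j) = (c \<cdot>\<^sub>m U) $$ (i, j)" .
    qed (use U r(1)[OF g] in auto)
    note step = this
    \<comment> \<open>The scalar \<open>c\<close> commutes with every matrix, so the relation can be
      iterated although \<open>U\<close> need not be invertible and \<open>\<rho> g\<close> need not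
      be scalar.\<close>
    have pow: "\<mu> ^ m \<cdot>\<^sub>m (\<rho> (g [^] m) * U) = c ^ m \<cdot>\<^sub>m U" for m :: nat
    proof (induction m)
      case 0
      show ?case using r(2) U by simp
    next
      case (Suc m)
      have gm: "g [^] m \<in> carrier G" using g by simp
      note cm = r(1)[OF gm] and cg = r(1)[OF g]
      have "\<mu> ^ Suc m \<cdot>\<^sub>m (\<rho> (g [^] Suc m) * U) = \<mu> ^ m \<cdot>\<^sub>m (\<rho> (g [^] m) * (\<mu> \<cdot>\<^sub>m (\<rho> g * U)))"
        using cm cg U r(3)[OF gm g]
        by (simp add: mult_smult_distrib[OF cm, of _ d] assoc_mult_mat[OF cm cg U]) (intro eq_matI; simp)
      also have "\<dots> = c \<cdot>\<^sub>m (\<mu> ^ m \<cdot>\<^sub>m (\<rho> (g [^] m) * U))"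
        unfolding step mult_smult_distrib[OF cm U] by (intro eq_matI; simp)
      also have "\<dots> = c ^ Suc m \<cdot>\<^sub>m U" unfolding Suc.IH by (intro eq_matI; simp)
      finally show ?case .
    qed
    \<comment> \<open>With the group order as exponent, \<open>\<rho> (g [^] N)\<close> becomes the
      identity, and a nonzero entry of \<open>U\<close> leaves
      \<open>\<mu> ^ N = c ^ N\<close>.\<close>
    define N where "N = Coset.order G"
    have "g [^] N = \<one>" unfolding N_def using g by (rule pow_order_eq_1)
    then have eqU: "\<mu> ^ N \<cdot>\<^sub>m U = c ^ N \<cdot>\<^sub>m U" using pow[of N] r(2) U by simp
    obtain i j where ij: "i < d" "j < d" "U $$ (i, j) \<noteq> 0"
    proof -
      have "\<exists>i<d. \<exists>j<d. U $$ (i, j) \<noteq> 0"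
      proof (rule ccontr)
        assume "\<not> ?thesis"
        then have "U = 0\<^sub>m d d" using U by (intro eq_matI) auto
        then show False using U0 by (simp add: U_def)
      qed
      then show thesis using that by blast
    qed
    have "\<mu> ^ N = c ^ N"
      using U ij arg_cong[OF eqU, of "\<lambda>B. B $$ (i, j)"] by simp
    then have "\<mu> ^ N \<in> A" using subring_of_power[OF sub c(1)] by simp
    moreover have "N > 0" using fin by (auto simp: N_def Coset.order_def card_gt_0_iff)
    ultimately show "\<mu> \<in> A" using valuation_subring_power_cancel[OF A] by blast
  qed
  then show ?thesis using trW by (simp add: M_def D_def)
qed

end

section \<open>Characteristic zero and the passage from valuation rings to \<open>R\<close>\<close>

lemma extends_Qp_char_0:
  fixes \<phi> :: "(nat \<Rightarrow> int) \<Rightarrow> 'f::field"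
  assumes p: "prime p" and \<phi>: "extends_Qp p \<phi>" and m: "m > 0"
  shows "of_nat m \<noteq> (0 :: 'f)"
proof -
  have p1: "p > 1" using p by (rule prime_gt_1_int)
  \<comment> \<open>The coherent sequence of the natural number \<open>k\<close>, which the
    embedding must send to \<open>of_nat k\<close>.\<close>
  define x where "x k = (\<lambda>n. int k mod p ^ n)" for k
  have x: "x k \<in> padic_ints p" for k
    using p1 by (auto simp: padic_ints_def x_def mod_mod_cancel)
  have one: "x 1 = zp_one p" by (auto simp: x_def zp_one_def)
  have add: "\<phi> (x (k + l)) = \<phi> (x k) + \<phi> (x l)" for k l
  proof -
    have "x (k + l) = zp_add p (x k) (x l)" by (auto simp: x_def zp_add_def mod_add_eq)
    then show ?thesis using \<phi> x unfolding extends_Qp_def by metis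
  qed
  have zero: "\<phi> (x 0) = 0" using add[of 0 0] by (metis add.right_neutral add_left_cancel)
  have \<phi>x: "\<phi> (x k) = of_nat k" for k
  proof (induction k)
    case (Suc k)
    then show ?case using add[of k 1] one \<phi> by (simp add: extends_Qp_def add.commute)
  qed (simp add: zero)
  \<comment> \<open>The component at index \<open>m\<close> already separates \<open>m\<close> from
    0, since \<open>m < p ^ m\<close>.\<close>
  have "x m m \<noteq> x 0 m"
  proof -
    have "int m < p ^ m"
    proof -
      have "m < 2 ^ m" by (rule less_exp)
      then have "int m < 2 ^ m" by (metis of_nat_less_iff of_nat_numeral of_nat_power)
      also have "(2::int) ^ m \<le> p ^ m" using p1 by (intro power_mono) auto
      finally show ?thesis .
    qed
    then show ?thesis using m by (simp add: x_def)
  qed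
  then have "x m \<noteq> x 0" by metis
  then have "\<phi> (x m) \<noteq> \<phi> (x 0)" using \<phi> x by (auto simp: extends_Qp_def inj_on_def)
  then show ?thesis using \<phi>x zero by simp
qed

text \<open>A monic polynomial over the image of \<open>R\<close> in the closure comes from one over
  \<open>R\<close>, and their values at \<open>x\<close> correspond. So an element of
  \<open>F\<close> outside \<open>R\<close> is not integral over \<open>R\<close> in the closure
  either.\<close>

lemma exists_valuation_subring_of_closure:
  fixes R :: "'f::field set"
  assumes R: "subring_of R" "integrally_closed_in R" and x: "x \<notin> R"
  shows "\<exists>A. valuation_subring A \<and> to_ac ` R \<subseteq> A \<and> to_ac x \<notin> A"
proof (rule valuation_subring_avoiding_nonintegral)
  show "subring_of (to_ac ` R)" unfolding subring_of_def
    using R(1) by (auto simp: subring_of_def image_iff simp flip: to_ac_0 to_ac_1 to_ac_add to_ac_diff to_ac_mult)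
  fix P :: "'f alg_closure poly"
  assume monic: "lead_coeff P = 1" and P: "\<And>i. coeff P i \<in> to_ac ` R"
  show "poly P (to_ac x) \<noteq> 0"
  proof
    assume root: "poly P (to_ac x) = 0"
    define Q where "Q = map_poly of_ac P"
    have cQ: "to_ac (coeff Q i) = coeff P i" for i
      using P[of i] by (auto simp: Q_def coeff_map_poly)
    have dQ: "degree Q = degree P"
      by (rule antisym; rule degree_le) (metis cQ coeff_eq_0 to_ac_eq_0_iff)+
    have "lead_coeff Q = 1" using monic cQ dQ by (metis to_ac_1 to_ac_eq_iff)
    moreover have "coeff Q i \<in> R" for i using P[of i] cQ[of i] by (auto simp: image_iff)
    moreover have "to_ac (poly Q x) = 0" using root
      by (simp add: poly_altdef to_ac_sum cQ dQ)
    then have "poly Q x = 0" by simp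
    ultimately show False using R(2) x unfolding integrally_closed_in_def by blast
  qed
qed

theorem theorem3p2:
  fixes p :: int and G :: "('g, 'b) monoid_scheme"
    and \<phi> :: "(nat \<Rightarrow> int) \<Rightarrow> 'f::field" and R :: "'f set"
    and n :: nat and H :: "nat \<Rightarrow> nat \<Rightarrow> 'g \<Rightarrow> 'f"
  assumes "prime p"
    and "group G" and "finite (carrier G)"
    and "extends_Qp p \<phi>"
    and "subring_of R" and "noetherian_subring R" and "integrally_closed_in R"
    and "fraction_field_is_UNIV R"
    and "\<forall>i<n. \<forall>j<n. H i j \<in> group_ring G R"
  shows "(\<lambda>g. of_nat (card (derived G (carrier G))) * nr G n H g) \<in> gr_center G R"
proof -
  interpret group G by fact
  note fin = \<open>finite (carrier G)\<close>
  have char0: "of_nat m \<noteq> (0 :: 'f)" if "m > 0" for m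
    using extends_Qp_char_0[OF assms(1,4) that] .
  have char0': "of_nat m \<noteq> (0 :: 'f alg_closure)" if "m > 0" for m
    using char0[OF that] by (metis to_ac_eq_0_iff to_ac_of_nat)
  let ?z = "nr G n H" and ?c = "card (derived G (carrier G))"
  note nr = is_nr_nr[where n = n and H = H, OF fin char0]
  have integral: "of_nat ?c * ?z g \<in> R" if g: "g \<in> carrier G" for g
  proof (rule ccontr)
    \<comment> \<open>The valuation ring is chosen for this one coefficient, which it is supposed to
      exclude.\<close>
    assume "of_nat ?c * ?z g \<notin> R"
    from exists_valuation_subring_of_closure[OF assms(5,7) this]
    obtain A where A: "valuation_subring A" "to_ac ` R \<subseteq> A" "to_ac (of_nat ?c * ?z g) \<notin> A" by blast
    have "of_nat ?c * to_ac (?z g) \<in> A"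
    proof (rule derived_order_times_coeff_integral[where n = n and K = "\<lambda>i j g. to_ac (H i j g)"
          and z = "\<lambda>g. to_ac (?z g)", OF A(1) fin char0' _ _ g])
      show "to_ac (H i j g) \<in> A" if "i < n" "j < n" "g \<in> carrier G" for i j g
        using that assms(9) A(2) by (auto simp: group_ring_def)
      show "alg_act G d \<rho> (\<lambda>g. to_ac (?z g)) = det (block_rep G d \<rho> n (\<lambda>i j g. to_ac (H i j g))) \<cdot>\<^sub>m 1\<^sub>m d"
        if "is_irrep G d \<rho>" for d \<rho>
        using nr(1) that by (simp add: is_nr_def rep_ext_eq rep_ext_mat_eq)
    qed
    then show False using A(3) by simp
  qed
  have outside: "?z g = 0" if "g \<notin> carrier G" for g
    using nr(1) that by (auto simp: is_nr_def gr_center_def group_ring_def)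
  show ?thesis
    by (rule class_function_central) (auto simp: group_ring_def integral outside nr(2))
qed

end
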